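(* Let $G$ be a finitely generated group acting minimally on two simplicial trees $T_1,T_2$, and assume that for each $i\in\{1,2\}$: (a) the stabilizer of each edge of $T_i$ acts non-trivially on the other tree; (b) $G$ does not split over a subgroup of infinite index of the stabilizer of an edge of $T_i$. Then $\mathcal{C}=\mathcal{A}_1=\mathcal{A}_2$. Furthermore, assume that for each $i\in\{1,2\}$ and each edge $e_i$ of $T_i$, the minimal $G_{e_i}$-invariant subtree of the other tree is a line. Then $\mathcal{C}\setminus V(\mathcal{C})$ is a surface, where $V(\mathcal{C})$ is the set of vertices of $\mathcal{C}$.
   Context: Actions on simplicial trees are without inversions. $G_x$ denotes the stabilizer of a point or edge $x$. A group acts trivially on a tree if each of its elements fixes a point; if a group $H$ acts non-trivially on $T$, $\mathrm{Min}_T(H)$ is its unique minimal non-empty invariant subtree. $G$ splits over a subgroup $H$ if $G$ acts non-trivially, with one orbit of edges, on a simplicial tree with $H$ as an edge stabilizer. Core: a direction in $T$ based at $x\in T$ is a connected component of $T\setminus\{x\}$. A quadrant is a product $\delta_1\times\delta_2\subset T_1\times T_2$ of directions. Fix a base point $*=( *_1,*_2)$ (the choice does not matter). A quadrant $Q$ is heavy if there is a sequence $\gamma_k\in G$ with $\gamma_k.*\in Q$ and $d(\gamma_k.*_i,*_i)\to\infty$ for both $i=1,2$; otherwise light. The core $\mathcal{C}=\mathcal{C}(T_1\times T_2)$ is the complement in $T_1\times T_2$ of the union of all light quadrants; it is a subcomplex of $T_1\times T_2$. Asymmetric cores: $\mathcal{A}_1=\bigcup_{x_1\in T_1}\{x_1\}\times\mathrm{Min}_{T_2}(G_{x_1})$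 and $\mathcal{A}_2=\bigcup_{x_2\in T_2}\mathrm{Min}_{T_1}(G_{x_2})\times\{x_2\}$, as subsets of $T_1\times T_2$ (here $x_i$ ranges over all points of $T_i$, and the stabilizer of an interior point of an edge is the edge stabilizer). *)

theory Defs
  imports "HOL-Analysis.Analysis" "HOL-Algebra.Group_Action" "HOL-Algebra.Generated_Groups"
begin

section \<open>Simplicial trees and their realizations\<close>

record 'v sgraph =
  verts :: "'v set"
  edges :: "'v set set"

definition edge_path :: "'v sgraph \<Rightarrow> 'v \<Rightarrow> 'v \<Rightarrow> 'v list \<Rightarrow> bool" where
  "edge_path T u v p \<longleftrightarrow>
     p \<noteq> [] \<and> set p \<subseteq> verts T \<and> distinct p \<and> hd p = u \<and> last p = v \<and>
     successively (\<lambda>x y. {x, y} \<in> edges T) p"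

definition simplicial_tree :: "'v sgraph \<Rightarrow> bool" where
  "simplicial_tree T \<longleftrightarrow>
     verts T \<noteq> {} \<and> (\<forall>e \<in> edges T. e \<subseteq> verts T \<and> card e = 2) \<and>
     (\<forall>u \<in> verts T. \<forall>v \<in> verts T. \<exists>!p. edge_path T u v p)"

definition simplices :: "'v sgraph \<Rightarrow> 'v set set" where
  "simplices T = (\<lambda>v. {v}) ` verts T \<union> edges T"

text \<open>
  Points of the geometric realization are given by barycentric coordinates; the support of
  a point is the unique open simplex that contains it. The realization of a subgraph is
  literally a subset of the realization of the graph.
\<close>

definition points :: "'v sgraph \<Rightarrow> ('v \<Rightarrow> real) set" where
  "points T = {x. (\<forall>v. 0 \<le> x v) \<and> {v. x v \<noteq> 0} \<in> simplices T \<and> (\<Sum>v | x v \<noteq> 0. x v) = 1}"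

definition vertex_points :: "'v sgraph \<Rightarrow> ('v \<Rightarrow> real) set" where
  "vertex_points T = (\<lambda>v. indicator {v}) ` verts T"

text \<open>
  The path metric in which every edge has length 1: \<open>chain T x l y\<close> says that there is a
  sequence from \<open>x\<close> to \<open>y\<close> of total length \<open>l\<close> whose consecutive points lie in a common closed
  simplex. On a closed edge \<open>{u, v}\<close> the two coordinates of a point sum to 1, so the supremum
  below is \<open>\<bar>y u - z u\<bar> = \<bar>y v - z v\<bar>\<close>, the distance along the edge.
\<close>

inductive chain :: "'v sgraph \<Rightarrow> ('v \<Rightarrow> real) \<Rightarrow> real \<Rightarrow> ('v \<Rightarrow> real) \<Rightarrow> bool" for T where
  chain_refl: "x \<in> points T \<Longrightarrow> chain T x 0 x"
| chain_step: "chain T x l y \<Longrightarrow> z \<in> points T \<Longrightarrow> \<sigma> \<in> simplices T \<Longrightarrow>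
    {v. y v \<noteq> 0 \<or> z v \<noteq> 0} \<subseteq> \<sigma> \<Longrightarrow> chain T x (l + (SUP v. \<bar>y v - z v\<bar>)) z"

definition tree_dist :: "'v sgraph \<Rightarrow> ('v \<Rightarrow> real) \<Rightarrow> ('v \<Rightarrow> real) \<Rightarrow> real" where
  "tree_dist T x y = (if x \<in> points T \<and> y \<in> points T then Inf {l. chain T x l y} else 0)"

definition tree_top :: "'v sgraph \<Rightarrow> ('v \<Rightarrow> real) topology" where
  "tree_top T = Metric_space.mtopology (points T) (tree_dist T)"

definition is_line :: "('p \<Rightarrow> 'p \<Rightarrow> real) \<Rightarrow> 'p set \<Rightarrow> bool" where
  "is_line d Y \<longleftrightarrow> (\<exists>f :: real \<Rightarrow> 'p. range f = Y \<and> (\<forall>s t. d (f s) (f t) = \<bar>s - t\<bar>))"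


section \<open>Actions on trees\<close>

locale tree_action = group_action G "verts T" \<phi>
  for G (structure) and T :: "'v sgraph" and \<phi> +
  assumes tree: "simplicial_tree T"
    and edge_image: "\<lbrakk>g \<in> carrier G; e \<in> edges T\<rbrakk> \<Longrightarrow> \<phi> g ` e \<in> edges T"
    and no_inversion: "\<lbrakk>g \<in> carrier G; {u, v} \<in> edges T; \<phi> g u = v\<rbrakk> \<Longrightarrow> \<phi> g v \<noteq> u"

definition real_act ::
    "('g, 'm) monoid_scheme \<Rightarrow> 'v sgraph \<Rightarrow> ('g \<Rightarrow> 'v \<Rightarrow> 'v) \<Rightarrow> 'g \<Rightarrow> ('v \<Rightarrow> real) \<Rightarrow> 'v \<Rightarrow> real" where
  "real_act G T \<phi> g = (\<lambda>x \<in> points T. \<lambda>w. if w \<in> verts T then x (\<phi> (inv\<^bsub>G\<^esub> g) w) else 0)"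

abbreviation point_stab ::
    "('g, 'm) monoid_scheme \<Rightarrow> 'v sgraph \<Rightarrow> ('g \<Rightarrow> 'v \<Rightarrow> 'v) \<Rightarrow> ('v \<Rightarrow> real) \<Rightarrow> 'g set" where
  "point_stab G T \<phi> x \<equiv> stabilizer G (real_act G T \<phi>) x"

abbreviation edge_stab ::
    "('g, 'm) monoid_scheme \<Rightarrow> ('g \<Rightarrow> 'v \<Rightarrow> 'v) \<Rightarrow> 'v set \<Rightarrow> 'g set" where
  "edge_stab G \<phi> e \<equiv> stabilizer G (\<lambda>g. (`) (\<phi> g)) e"

definition acts_trivially ::
    "('g, 'm) monoid_scheme \<Rightarrow> 'v sgraph \<Rightarrow> ('g \<Rightarrow> 'v \<Rightarrow> 'v) \<Rightarrow> 'g set \<Rightarrow> bool" where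
  "acts_trivially G T \<phi> H \<longleftrightarrow> (\<forall>h \<in> H. \<exists>x \<in> points T. real_act G T \<phi> h x = x)"

definition invariant_subtree ::
    "'v sgraph \<Rightarrow> ('g \<Rightarrow> 'v \<Rightarrow> 'v) \<Rightarrow> 'g set \<Rightarrow> 'v sgraph \<Rightarrow> bool" where
  "invariant_subtree T \<phi> H S \<longleftrightarrow>
     simplicial_tree S \<and> verts S \<subseteq> verts T \<and> edges S \<subseteq> edges T \<and>
     (\<forall>h \<in> H. \<phi> h ` verts S = verts S \<and> (`) (\<phi> h) ` edges S = edges S)"

definition minimal_action ::
    "('g, 'm) monoid_scheme \<Rightarrow> 'v sgraph \<Rightarrow> ('g \<Rightarrow> 'v \<Rightarrow> 'v) \<Rightarrow> bool" where
  "minimal_action G T \<phi> \<longleftrightarrow> (\<forall>S. invariant_subtree T \<phi> (carrier G) S \<longrightarrow> S = T)"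

definition minimal_subtree ::
    "'v sgraph \<Rightarrow> ('g \<Rightarrow> 'v \<Rightarrow> 'v) \<Rightarrow> 'g set \<Rightarrow> 'v sgraph" where
  "minimal_subtree T \<phi> H =
     (THE S. invariant_subtree T \<phi> H S \<and>
        (\<forall>S'. invariant_subtree T \<phi> H S' \<and> verts S' \<subseteq> verts S \<and> edges S' \<subseteq> edges S \<longrightarrow> S' = S))"

definition finitely_generated :: "('g, 'm) monoid_scheme \<Rightarrow> bool" where
  "finitely_generated G \<longleftrightarrow> (\<exists>S. finite S \<and> S \<subseteq> carrier G \<and> generate G S = carrier G)"

definition splitting ::
    "('g, 'm) monoid_scheme \<Rightarrow> 'v sgraph \<Rightarrow> ('g \<Rightarrow> 'v \<Rightarrow> 'v) \<Rightarrow> 'g set \<Rightarrow> bool" where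
  "splitting G T \<phi> H \<longleftrightarrow>
     tree_action G T \<phi> \<and> \<not> acts_trivially G T \<phi> (carrier G) \<and>
     (\<exists>e \<in> edges T. edges T = orbit G (\<lambda>g. (`) (\<phi> g)) e \<and> H = edge_stab G \<phi> e)"

text \<open>
  The vertex type has to be fixed in the existential quantifier below. This is no restriction:
  if there is one orbit of edges, then there are at most two orbits of vertices, so vertices can
  be coded by cosets of two vertex stabilizers, tagged by a Boolean. Lemma \<open>splits_overI\<close> proves
  that a splitting on a tree with vertices in an arbitrary type gives \<open>splits_over\<close>.
\<close>

definition splits_over :: "('g, 'm) monoid_scheme \<Rightarrow> 'g set \<Rightarrow> bool" where
  "splits_over G H \<longleftrightarrow> (\<exists>(T :: ('g set \<times> bool) sgraph) \<phi>. splitting G T \<phi> H)"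

definition infinite_index_subgroup :: "('g, 'm) monoid_scheme \<Rightarrow> 'g set \<Rightarrow> 'g set \<Rightarrow> bool" where
  "infinite_index_subgroup G K H \<longleftrightarrow>
     subgroup H (G\<lparr>carrier := K\<rparr>) \<and> infinite (rcosets\<^bsub>G\<lparr>carrier := K\<rparr>\<^esub> H)"


section \<open>The core and the asymmetric cores\<close>

definition directions :: "'v sgraph \<Rightarrow> ('v \<Rightarrow> real) set set" where
  "directions T = (\<Union>x \<in> points T. connected_components_of (subtopology (tree_top T) (points T - {x})))"

definition quadrants ::
    "'v sgraph \<Rightarrow> 'w sgraph \<Rightarrow> (('v \<Rightarrow> real) \<times> ('w \<Rightarrow> real)) set set" where
  "quadrants T1 T2 = {\<delta>1 \<times> \<delta>2 | \<delta>1 \<delta>2. \<delta>1 \<in> directions T1 \<and> \<delta>2 \<in> directions T2}"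

definition heavy ::
    "('g, 'm) monoid_scheme \<Rightarrow> 'v sgraph \<Rightarrow> ('g \<Rightarrow> 'v \<Rightarrow> 'v) \<Rightarrow> 'w sgraph \<Rightarrow> ('g \<Rightarrow> 'w \<Rightarrow> 'w) \<Rightarrow>
     ('v \<Rightarrow> real) \<Rightarrow> ('w \<Rightarrow> real) \<Rightarrow> (('v \<Rightarrow> real) \<times> ('w \<Rightarrow> real)) set \<Rightarrow> bool" where
  "heavy G T1 \<phi>1 T2 \<phi>2 b1 b2 Q \<longleftrightarrow>
     (\<exists>\<gamma> :: nat \<Rightarrow> 'g.
        (\<forall>k. \<gamma> k \<in> carrier G \<and> (real_act G T1 \<phi>1 (\<gamma> k) b1, real_act G T2 \<phi>2 (\<gamma> k) b2) \<in> Q) \<and>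
        filterlim (\<lambda>k. tree_dist T1 (real_act G T1 \<phi>1 (\<gamma> k) b1) b1) at_top sequentially \<and>
        filterlim (\<lambda>k. tree_dist T2 (real_act G T2 \<phi>2 (\<gamma> k) b2) b2) at_top sequentially)"

definition core ::
    "('g, 'm) monoid_scheme \<Rightarrow> 'v sgraph \<Rightarrow> ('g \<Rightarrow> 'v \<Rightarrow> 'v) \<Rightarrow> 'w sgraph \<Rightarrow> ('g \<Rightarrow> 'w \<Rightarrow> 'w) \<Rightarrow>
     ('v \<Rightarrow> real) \<Rightarrow> ('w \<Rightarrow> real) \<Rightarrow> (('v \<Rightarrow> real) \<times> ('w \<Rightarrow> real)) set" where
  "core G T1 \<phi>1 T2 \<phi>2 b1 b2 =
     points T1 \<times> points T2 - \<Union>{Q \<in> quadrants T1 T2. \<not> heavy G T1 \<phi>1 T2 \<phi>2 b1 b2 Q}"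

definition asym_core1 ::
    "('g, 'm) monoid_scheme \<Rightarrow> 'v sgraph \<Rightarrow> ('g \<Rightarrow> 'v \<Rightarrow> 'v) \<Rightarrow> 'w sgraph \<Rightarrow> ('g \<Rightarrow> 'w \<Rightarrow> 'w) \<Rightarrow>
     (('v \<Rightarrow> real) \<times> ('w \<Rightarrow> real)) set" where
  "asym_core1 G T1 \<phi>1 T2 \<phi>2 =
     (\<Union>x1 \<in> points T1. {x1} \<times> points (minimal_subtree T2 \<phi>2 (point_stab G T1 \<phi>1 x1)))"

definition asym_core2 ::
    "('g, 'm) monoid_scheme \<Rightarrow> 'v sgraph \<Rightarrow> ('g \<Rightarrow> 'v \<Rightarrow> 'v) \<Rightarrow> 'w sgraph \<Rightarrow> ('g \<Rightarrow> 'w \<Rightarrow> 'w) \<Rightarrow>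
     (('v \<Rightarrow> real) \<times> ('w \<Rightarrow> real)) set" where
  "asym_core2 G T1 \<phi>1 T2 \<phi>2 =
     (\<Union>x2 \<in> points T2. points (minimal_subtree T1 \<phi>1 (point_stab G T2 \<phi>2 x2)) \<times> {x2})"

text \<open>A surface is a 2-manifold without boundary; it need be neither connected nor compact.\<close>

definition surface :: "'p topology \<Rightarrow> bool" where
  "surface X \<longleftrightarrow>
     Hausdorff_space X \<and> second_countable X \<and>
     (\<forall>x \<in> topspace X. \<exists>U (W :: (real \<times> real) set).
        openin X U \<and> x \<in> U \<and> open W \<and> subtopology X U homeomorphic_space top_of_set W)"


section \<open>The path metric is a metric\<close>

lemma points_le_1:
  assumes "x \<in> points T" shows "0 \<le> x v" "x v \<le> 1"
proof -
  show "0 \<le> x v" using assms by (simp add: points_def)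
  have "(\<Sum>v | x v \<noteq> 0. x v) = 1" using assms by (simp add: points_def)
  then have "finite {v. x v \<noteq> 0}" by (metis sum.infinite zero_neq_one)
  then show "x v \<le> 1"
    using assms member_le_sum[of v "{v. x v \<noteq> 0}" x] by (cases "x v = 0") (auto simp: points_def)
qed

lemma bdd_coord_diff:
  assumes "x \<in> points T" "y \<in> points T" shows "bdd_above (range (\<lambda>v. \<bar>x v - y v\<bar>))"
proof (rule bdd_aboveI[of _ 1])
  fix r assume "r \<in> range (\<lambda>v. \<bar>x v - y v\<bar>)"
  then obtain v where "r = \<bar>x v - y v\<bar>" by auto
  then show "r \<le> 1"
    using points_le_1[OF assms(1), of v] points_le_1[OF assms(2), of v] by linarith
qed

lemma chain_points: "chain T x l y \<Longrightarrow> x \<in> points T \<and> y \<in> points T"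
  by (induction rule: chain.induct) auto

lemma chain_ge_coord: "chain T x l y \<Longrightarrow> \<bar>x v - y v\<bar> \<le> l"
proof (induction rule: chain.induct)
  case (chain_step x l y z \<sigma>)
  have "\<bar>y v - z v\<bar> \<le> (SUP v. \<bar>y v - z v\<bar>)"
    using bdd_coord_diff[of y T z] chain_step.hyps chain_points[of T x l y] by (intro cSUP_upper) auto
  with chain_step.IH show ?case by linarith
qed simp

lemma chain_nonneg: "chain T x l y \<Longrightarrow> 0 \<le> l"
  using chain_ge_coord by (metis abs_ge_zero order_trans)

lemma chain_trans:
  assumes "chain T x l y" "chain T y m z" shows "chain T x (l + m) z"
  using assms(2,1)
proof (induction arbitrary: rule: chain.induct)
  case (chain_step y m z w \<sigma>)
  then show ?case using chain.chain_step[of T x "l + m" z w \<sigma>] by (simp add: add.assoc)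
qed simp

lemma chain_sym: "chain T x l y \<Longrightarrow> chain T y l x"
proof (induction rule: chain.induct)
  case (chain_step x l y z \<sigma>)
  have "chain T z (0 + (SUP v. \<bar>z v - y v\<bar>)) y"
    using chain_step chain_points[of T x l y]
    by (intro chain.chain_step[where \<sigma>=\<sigma>]) (auto intro: chain.intros)
  from chain_trans[OF this chain_step.IH]
  show ?case by (simp add: abs_minus_commute add.commute)
qed (rule chain.intros)

lemma indicator_points: "v \<in> verts T \<Longrightarrow> indicator {v} \<in> points T"
proof -
  assume "v \<in> verts T"
  moreover have "{w. (indicator {v} w :: real) \<noteq> 0} = {v}" by (auto simp: indicator_def)
  ultimately show ?thesis by (auto simp: points_def simplices_def)
qed

lemma chain_to_vertex:
  assumes "simplicial_tree T" "x \<in> points T"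
  shows "\<exists>v \<in> verts T. \<exists>l. chain T x l (indicator {v})"
proof -
  let ?s = "{v. x v \<noteq> 0}"
  have s: "?s \<in> simplices T" using assms(2) by (simp add: points_def)
  have E: "\<sigma> \<noteq> {} \<and> \<sigma> \<subseteq> verts T" if "\<sigma> \<in> simplices T" for \<sigma>
    using that assms(1) by (auto simp: simplices_def simplicial_tree_def)
  obtain v where v: "v \<in> ?s" "v \<in> verts T" using E[OF s] by auto
  have "chain T x (0 + (SUP w. \<bar>x w - indicator {v} w\<bar>)) (indicator {v})"
    using v s indicator_points[of v T] assms(2)
    by (intro chain.chain_step[where \<sigma>="?s"] chain_refl) (auto simp: indicator_eq_0_iff)
  with v show ?thesis by blast
qed

lemma chain_along_path:
  assumes "successively (\<lambda>x y. {x, y} \<in> edges T) p" "p \<noteq> []" "set p \<subseteq> verts T"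
  shows "\<exists>l. chain T (indicator {hd p}) l (indicator {last p})"
  using assms
proof (induction p rule: induct_list012)
  case (2 x)
  then show ?case using indicator_points[of x T] by (auto intro: chain.intros)
next
  case (3 x y zs)
  then obtain l where l: "chain T (indicator {y}) l (indicator {last (y # zs)})" by auto
  have "chain T (indicator {x}) (0 + (SUP w. \<bar>indicator {x} w - indicator {y} w\<bar>)) (indicator {y})"
  proof (rule chain.chain_step[where \<sigma>="{x, y}"])
    show "chain T (indicator {x}) 0 (indicator {x})" "indicator {y} \<in> points T"
      using 3 indicator_points[of x T] indicator_points[of y T] chain_refl by auto
    show "{x, y} \<in> simplices T" using 3 by (auto simp: simplices_def)
  qed (auto simp: indicator_def)
  from chain_trans[OF this l] show ?case by auto
qed simp

lemma chain_exists:
  assumes "simplicial_tree T" "x \<in> points T" "y \<in> points T"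
  shows "\<exists>l. chain T x l y"
proof -
  obtain u l where u: "u \<in> verts T" "chain T x l (indicator {u})"
    using chain_to_vertex assms by blast
  obtain v m where v: "v \<in> verts T" "chain T y m (indicator {v})"
    using chain_to_vertex assms by blast
  obtain p where "edge_path T u v p" using assms(1) u v unfolding simplicial_tree_def by blast
  then obtain n where "chain T (indicator {u}) n (indicator {v})"
    using chain_along_path[of T p] by (auto simp: edge_path_def)
  then show ?thesis using chain_trans chain_sym u(2) v(2) by blast
qed

lemma Metric_space_tree:
  assumes "simplicial_tree T" shows "Metric_space (points T) (tree_dist T)"
proof
  have sym: "{l. chain T x l y} = {l. chain T y l x}" for x y
    by (intro Collect_cong) (metis chain_sym)
  have bdd: "bdd_below {l. chain T x l y}" for x y
    using chain_nonneg by (intro bdd_belowI[of _ 0]) auto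
  have ne: "{l. chain T x l y} \<noteq> {}" if "x \<in> points T" "y \<in> points T" for x y
    using chain_exists assms that by blast
  have ge: "\<bar>x v - y v\<bar> \<le> tree_dist T x y" if "x \<in> points T" "y \<in> points T" for x y v
    using ne[OF that] that chain_ge_coord[of T x _ y v]
    by (auto simp: tree_dist_def intro!: cInf_greatest)
  have le: "tree_dist T x y \<le> l" if "chain T x l y" for x y l
    using that chain_points[OF that] bdd[of x y] by (auto simp: tree_dist_def intro: cInf_lower)
  show "0 \<le> tree_dist T x y" for x y
  proof (cases "x \<in> points T \<and> y \<in> points T")
    case True then show ?thesis using ge[of x y undefined] by linarith
  next
    case False then show ?thesis by (auto simp: tree_dist_def)
  qed
  show "tree_dist T x y = tree_dist T y x" for x y by (simp add: tree_dist_def sym)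
  fix x y assume x: "x \<in> points T" and y: "y \<in> points T"
  show "tree_dist T x y = 0 \<longleftrightarrow> x = y"
  proof
    assume "tree_dist T x y = 0"
    then have "\<bar>x v - y v\<bar> \<le> 0" for v using ge[OF x y, of v] by simp
    then show "x = y" by (intro ext) simp
  next
    assume "x = y"
    then have "tree_dist T x y \<le> 0" using x by (intro le) (auto intro: chain.intros)
    with ge[OF x y, of undefined] \<open>x = y\<close> show "tree_dist T x y = 0" by simp
  qed
  fix z assume z: "z \<in> points T"
  have "tree_dist T x z - m \<le> tree_dist T x y" if m: "chain T y m z" for m
  proof -
    have "tree_dist T x z - m \<le> l" if "chain T x l y" for l
      using le[OF chain_trans[OF that m]] by simp
    then show ?thesis using ne[OF x y] x y by (auto simp: tree_dist_def[of T x y] intro!: cInf_greatest)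
  qed
  then have "tree_dist T x z - tree_dist T x y \<le> m" if m: "chain T y m z" for m
    using that by (auto simp: algebra_simps)
  then have "tree_dist T x z - tree_dist T x y \<le> tree_dist T y z"
    using ne[OF y z] y z by (auto simp: tree_dist_def[of T y z] intro!: cInf_greatest)
  then show "tree_dist T x z \<le> tree_dist T x y + tree_dist T y z" by simp
qed

section \<open>Splittings do not depend on the vertex type\<close>

definition graph_image :: "('v \<Rightarrow> 'w) \<Rightarrow> 'v sgraph \<Rightarrow> 'w sgraph" where
  "graph_image f T = \<lparr>verts = f ` verts T, edges = (`) f ` edges T\<rparr>"

lemma graph_image_simps [simp]:
  "verts (graph_image f T) = f ` verts T" "edges (graph_image f T) = (`) f ` edges T"
  by (simp_all add: graph_image_def)

lemma image_in_edges_iff: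
  assumes "\<forall>e \<in> edges T. e \<subseteq> verts T" "inj_on f (verts T)" "e \<subseteq> verts T"
  shows "f ` e \<in> (`) f ` edges T \<longleftrightarrow> e \<in> edges T"
proof
  assume "f ` e \<in> (`) f ` edges T"
  then obtain d where "d \<in> edges T" "f ` e = f ` d" by blast
  then show "e \<in> edges T" using assms inj_on_image_eq_iff[of f "verts T" e d] by simp
qed simp

lemma edge_path_image_iff:
  assumes "\<forall>e \<in> edges T. e \<subseteq> verts T" "inj_on f (verts T)" "set p \<subseteq> verts T"
    "u \<in> verts T" "v \<in> verts T"
  shows "edge_path (graph_image f T) (f u) (f v) (map f p) \<longleftrightarrow> edge_path T u v p"
proof (cases "p = []")
  case False
  have "successively (\<lambda>x y. {x, y} \<in> (`) f ` edges T) (map f p)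
      \<longleftrightarrow> successively (\<lambda>x y. {f x, f y} \<in> (`) f ` edges T) p"
    by (simp add: successively_map)
  also have "\<dots> \<longleftrightarrow> successively (\<lambda>x y. {x, y} \<in> edges T) p"
  proof (rule successively_cong)
    fix x y assume "x \<in> set p" "y \<in> set p"
    then show "({f x, f y} \<in> (`) f ` edges T) = ({x, y} \<in> edges T)"
      using image_in_edges_iff[OF assms(1,2), of "{x, y}"] assms(3) by auto
  qed simp
  finally have succ: "successively (\<lambda>x y. {x, y} \<in> (`) f ` edges T) (map f p)
      \<longleftrightarrow> successively (\<lambda>x y. {x, y} \<in> edges T) p" .
  have dist: "distinct (map f p) = distinct p"
    using inj_on_subset[OF assms(2,3)] by (simp add: distinct_map)
  have in_V: "hd p \<in> verts T" "last p \<in> verts T" using False assms(3) by auto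
  have hd: "f (hd p) = f u \<longleftrightarrow> hd p = u" using in_V assms by (metis inj_on_eq_iff)
  have last: "f (last p) = f v \<longleftrightarrow> last p = v" using in_V assms by (metis inj_on_eq_iff)
  have set: "f ` set p \<subseteq> f ` verts T" using assms(3) by blast
  show ?thesis
    using False assms(3) set by (simp add: edge_path_def succ dist hd last hd_map last_map)
qed (simp add: edge_path_def)

lemma simplicial_tree_image:
  assumes T: "simplicial_tree T" and f: "inj_on f (verts T)"
  shows "simplicial_tree (graph_image f T)"
proof -
  have E: "\<forall>e \<in> edges T. e \<subseteq> verts T" using T by (simp add: simplicial_tree_def)
  have "\<exists>!q. edge_path (graph_image f T) (f u) (f v) q" if uv: "u \<in> verts T" "v \<in> verts T" for u v
  proof -
    have "\<exists>!p. edge_path T u v p" using T uv by (simp add: simplicial_tree_def)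
    then obtain p where p: "edge_path T u v p" and uniq: "\<And>p'. edge_path T u v p' \<Longrightarrow> p' = p"
      by metis
    show ?thesis
    proof (rule ex1I[of _ "map f p"])
      show "edge_path (graph_image f T) (f u) (f v) (map f p)"
        using edge_path_image_iff[OF E f _ uv] p by (auto simp: edge_path_def)
    next
      fix q assume q: "edge_path (graph_image f T) (f u) (f v) q"
      let ?p = "map (inv_into (verts T) f) q"
      have sub: "set q \<subseteq> f ` verts T" using q by (simp add: edge_path_def)
      then have "map f ?p = q" by (auto intro!: map_idI simp: f_inv_into_f)
      moreover have "set ?p \<subseteq> verts T" using sub by (auto intro!: inv_into_into)
      ultimately show "q = map f p"
        using edge_path_image_iff[OF E f _ uv, of ?p] q uniq by metis
    qed
  qed
  then have paths: "\<forall>u \<in> f ` verts T. \<forall>v \<in> f ` verts T. \<exists>!q. edge_path (graph_image f T) u v q"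
    by blast
  have "card (f ` e) = 2" if "e \<in> edges T" for e
    using that T inj_on_subset[OF f, of e] by (simp add: simplicial_tree_def card_image)
  then have "\<forall>e \<in> (`) f ` edges T. e \<subseteq> f ` verts T \<and> card e = 2" using E by blast
  moreover have "verts T \<noteq> {}" using T by (simp add: simplicial_tree_def)
  ultimately show ?thesis using paths by (simp add: simplicial_tree_def)
qed

lemma splitting_image:
  assumes S: "splitting G T \<phi> H" and f: "inj_on f (verts T)"
  shows "\<exists>\<phi>'. splitting G (graph_image f T) \<phi>' H"
proof -
  let ?V = "verts T"
  interpret tree_action G T \<phi> using S by (simp add: splitting_def)
  interpret group_hom G "BijGroup ?V" \<phi> by (rule group_hom)
  have E: "\<forall>e \<in> edges T. e \<subseteq> ?V" using tree by (simp add: simplicial_tree_def)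
  have \<phi>_in: "\<phi> g v \<in> ?V" if "g \<in> carrier G" "v \<in> ?V" for g v
    using that by (meson element_image)
  define \<phi>' where "\<phi>' g = (\<lambda>w \<in> f ` ?V. f (\<phi> g (inv_into ?V f w)))" for g
  have \<phi>': "\<phi>' g (f v) = f (\<phi> g v)" if "v \<in> ?V" for g v
    using that f by (simp add: \<phi>'_def)
  have img: "\<phi>' g ` f ` e = f ` \<phi> g ` e" if "e \<subseteq> ?V" for g e
    unfolding image_image using that by (intro image_cong \<phi>') auto
  have Bij: "\<phi>' g \<in> Bij (f ` ?V)" if g: "g \<in> carrier G" for g
  proof -
    have "\<phi>' g ` f ` ?V = f ` ?V" using img[of ?V g] surj_prop[OF g] by simp
    moreover have "inj_on (\<phi>' g) (f ` ?V)"
    proof (rule inj_onI)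
      fix x y assume "x \<in> f ` ?V" "y \<in> f ` ?V" and eq: "\<phi>' g x = \<phi>' g y"
      then obtain u v where uv: "u \<in> ?V" "v \<in> ?V" "x = f u" "y = f v" by blast
      with eq \<phi>' have "f (\<phi> g u) = f (\<phi> g v)" by simp
      then have "\<phi> g u = \<phi> g v" using f \<phi>_in[OF g] uv by (simp add: inj_on_eq_iff)
      then show "x = y" using inj_prop[OF g] uv by (simp add: inj_on_eq_iff)
    qed
    ultimately show ?thesis by (auto simp: Bij_def bij_betw_def \<phi>'_def)
  qed
  have mult: "\<phi>' (g \<otimes>\<^bsub>G\<^esub> h) = \<phi>' g \<otimes>\<^bsub>BijGroup (f ` ?V)\<^esub> \<phi>' h"
    if g: "g \<in> carrier G" "h \<in> carrier G" for g h
  proof -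
    have "\<phi>' (g \<otimes>\<^bsub>G\<^esub> h) = compose (f ` ?V) (\<phi>' g) (\<phi>' h)"
    proof
      fix w
      show "\<phi>' (g \<otimes>\<^bsub>G\<^esub> h) w = compose (f ` ?V) (\<phi>' g) (\<phi>' h) w"
      proof (cases "w \<in> f ` ?V")
        case True
        then obtain v where v: "v \<in> ?V" "w = f v" by blast
        then have "\<phi> (g \<otimes>\<^bsub>G\<^esub> h) v = \<phi> g (\<phi> h v)" using g by (metis composition_rule)
        then show ?thesis using v \<phi>_in[OF g(2)] by (simp add: compose_def \<phi>')
      qed (auto simp: \<phi>'_def compose_def)
    qed
    then show ?thesis using Bij g by (simp add: BijGroup_def)
  qed
  have act: "group_action G (f ` ?V) \<phi>'"
    unfolding group_action_def group_hom_def group_hom_axioms_def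
    using Bij mult group_BijGroup by (auto simp: hom_def BijGroup_def)
  have "tree_action G (graph_image f T) \<phi>'"
  proof (intro tree_action.intro tree_action_axioms.intro)
    show "group_action G (verts (graph_image f T)) \<phi>'" using act by simp
    show "simplicial_tree (graph_image f T)" by (rule simplicial_tree_image[OF tree f])
  next
    fix g e assume g: "g \<in> carrier G" and "e \<in> edges (graph_image f T)"
    then obtain d where d: "d \<in> edges T" "e = f ` d" by auto
    then have "\<phi>' g ` e = f ` \<phi> g ` d" using img E by blast
    then show "\<phi>' g ` e \<in> edges (graph_image f T)" using edge_image[OF g d(1)] by simp
  next
    fix g x y assume g: "g \<in> carrier G" and xy: "{x, y} \<in> edges (graph_image f T)" and x: "\<phi>' g x = y"
    from xy obtain d where d: "d \<in> edges T" "{x, y} = f ` d" by auto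
    then have "x \<in> f ` d" "y \<in> f ` d" by blast+
    then obtain u v where uv: "u \<in> d" "v \<in> d" "x = f u" "y = f v" by blast
    have V: "u \<in> ?V" "v \<in> ?V" using uv d E by blast+
    have "f ` {u, v} = f ` d" using uv d by simp
    then have "{u, v} = d" using inj_on_image_eq_iff[OF f, of "{u, v}" d] V d E by blast
    moreover have "\<phi> g u = v"
      using x uv V \<phi>' \<phi>_in[OF g] f by (metis inj_on_eq_iff)
    ultimately have "\<phi> g v \<noteq> u" using no_inversion g d by blast
    then show "\<phi>' g y \<noteq> x" using uv V \<phi>' \<phi>_in[OF g] f by (metis inj_on_eq_iff)
  qed
  moreover have "\<not> acts_trivially G (graph_image f T) \<phi>' (carrier G)"
  proof
    assume triv: "acts_trivially G (graph_image f T) \<phi>' (carrier G)"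
    have "\<exists>x \<in> points T. real_act G T \<phi> g x = x" if g: "g \<in> carrier G" for g
    proof -
      obtain y where y: "y \<in> points (graph_image f T)" "real_act G (graph_image f T) \<phi>' g y = y"
        using triv g by (auto simp: acts_trivially_def)
      define x where "x v = (if v \<in> ?V then y (f v) else 0)" for v
      have simp_y: "{w. y w \<noteq> 0} \<in> simplices (graph_image f T)" using y by (simp add: points_def)
      then obtain s where s: "s \<in> simplices T" "{w. y w \<noteq> 0} = f ` s"
        by (auto simp: simplices_def)
      have sV: "s \<subseteq> ?V" using s(1) E by (auto simp: simplices_def)
      have supp: "{v. x v \<noteq> 0} = s"
      proof -
        have "v \<in> s \<longleftrightarrow> y (f v) \<noteq> 0" if "v \<in> ?V" for v
          using s(2) sV that f by (metis (mono_tags, lifting) inj_on_image_mem_iff mem_Collect_eq)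
        then show ?thesis using sV by (auto simp: x_def)
      qed
      have "(\<Sum>v \<in> s. x v) = (\<Sum>w \<in> f ` s. y w)"
        using sum.reindex[OF inj_on_subset[OF f sV], of y] sV by (auto simp: x_def intro!: sum.cong)
      also have "\<dots> = 1" using y(1) s(2) by (simp add: points_def)
      finally have x: "x \<in> points T"
        using y(1) s(1) supp by (auto simp: points_def x_def)
      have ginv: "inv\<^bsub>G\<^esub> g \<in> carrier G" using g by simp
      have "real_act G T \<phi> g x w = x w" for w
      proof (cases "w \<in> ?V")
        case True
        have "x (\<phi> (inv\<^bsub>G\<^esub> g) w) = y (\<phi>' (inv\<^bsub>G\<^esub> g) (f w))" using True \<phi>_in[OF ginv] \<phi>' by (simp add: x_def)
        also have "\<dots> = real_act G (graph_image f T) \<phi>' g y (f w)"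
          using y(1) True by (simp add: real_act_def)
        finally show ?thesis using y(2) True x by (simp add: real_act_def x_def)
      qed (use x in \<open>simp add: real_act_def x_def\<close>)
      then show ?thesis using x by blast
    qed
    then show False using S by (simp add: splitting_def acts_trivially_def)
  qed
  moreover have "\<exists>e \<in> edges (graph_image f T).
      edges (graph_image f T) = orbit G (\<lambda>g. (`) (\<phi>' g)) e \<and> H = edge_stab G \<phi>' e"
  proof -
    obtain e where e: "e \<in> edges T" "edges T = orbit G (\<lambda>g. (`) (\<phi> g)) e" "H = edge_stab G \<phi> e"
      using S by (auto simp: splitting_def)
    have eV: "e \<subseteq> ?V" using e E by blast
    have "edges (graph_image f T) = orbit G (\<lambda>g. (`) (\<phi>' g)) (f ` e)"
      using e(2) img[OF eV] by (auto simp: orbit_def)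
    moreover have "H = edge_stab G \<phi>' (f ` e)"
    proof -
      have "f ` \<phi> g ` e = f ` e \<longleftrightarrow> \<phi> g ` e = e" if "g \<in> carrier G" for g
        using inj_on_image_eq_iff[OF f, of "\<phi> g ` e" e] eV \<phi>_in[OF that] by blast
      then show ?thesis unfolding e(3) stabilizer_def img[OF eV] by blast
    qed
    ultimately show ?thesis using e(1) by auto
  qed
  ultimately show ?thesis by (auto simp: splitting_def)
qed

lemma splits_overI:
  assumes S: "splitting G T \<phi> H"
  shows "splits_over G H"
proof -
  interpret tree_action G T \<phi> using S by (simp add: splitting_def)
  obtain e where e: "e \<in> edges T" "edges T = orbit G (\<lambda>g. (`) (\<phi> g)) e"
    using S by (auto simp: splitting_def)
  obtain a b where ab: "e = {a, b}" "a \<noteq> b"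
    using e(1) tree card_2_iff[of e] unfolding simplicial_tree_def by metis
  have V: "a \<in> verts T" "b \<in> verts T" using e(1) tree ab by (auto simp: simplicial_tree_def)
  have cover: "\<exists>g \<in> carrier G. \<phi> g a = v \<or> \<phi> g b = v" if v: "v \<in> verts T" for v
  proof -
    obtain c where c: "c \<in> verts T" "c \<noteq> v" using V ab by metis
    have "\<exists>!p. edge_path T v c p" using tree v c by (simp add: simplicial_tree_def)
    then obtain p where p: "edge_path T v c p" by metis
    obtain q where q: "p = v # q" using p unfolding edge_path_def by (metis list.exhaust_sel)
    have "q \<noteq> []" using p c(2) q by (auto simp: edge_path_def)
    then obtain d q' where "q = d # q'" by (cases q) auto
    then have "{v, d} \<in> edges T" using p q by (simp add: edge_path_def)
    then obtain g where g: "g \<in> carrier G" "{v, d} = {\<phi> g a, \<phi> g b}"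
      using e(2) ab by (auto simp: orbit_def)
    then have "v = \<phi> g a \<or> v = \<phi> g b" by (metis insertCI insertE singletonD)
    then show ?thesis using g(1) by blast
  qed
  define f where "f v = (if \<exists>g \<in> carrier G. \<phi> g a = v then ({g \<in> carrier G. \<phi> g a = v}, False)
      else ({g \<in> carrier G. \<phi> g b = v}, True))" for v
  have "inj_on f (verts T)"
  proof (rule inj_onI)
    fix u v assume u: "u \<in> verts T" and eq: "f u = f v"
    show "u = v"
    proof (cases "\<exists>g \<in> carrier G. \<phi> g a = u")
      case True
      then obtain g where "g \<in> carrier G" "\<phi> g a = u" by blast
      then have "g \<in> fst (f u)" "\<not> snd (f u)" by (auto simp: f_def)
      then show ?thesis using eq \<open>\<phi> g a = u\<close> by (auto simp: f_def split: if_splits)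
    next
      case False
      then obtain g where "g \<in> carrier G" "\<phi> g b = u" using cover[OF u] by blast
      then have "g \<in> fst (f u)" "snd (f u)" using False by (auto simp: f_def)
      then show ?thesis using eq \<open>\<phi> g b = u\<close> by (auto simp: f_def split: if_splits)
    qed
  qed
  from splitting_image[OF S this] show ?thesis by (auto simp: splits_over_def)
qed

end

theory Submission
  imports Defs
begin

text \<open>
  For a simplex \<open>\<sigma>\<close> of \<open>T1\<close> let \<open>M2 \<sigma>\<close> be the minimal subtree of \<open>T2\<close> under the pointwise
  stabilizer of \<open>\<sigma>\<close>, and define \<open>M1 \<tau>\<close> for a simplex \<open>\<tau>\<close> of \<open>T2\<close> likewise. There are no inversions,
  so the stabilizer of a point fixes the vertices of the open simplex around it, and the two
  asymmetric cores are the unions of the open cells \<open>\<sigma> \<times> \<tau>\<close> with \<open>\<tau> \<subseteq> M2 \<sigma>\<close> and with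
  \<open>\<sigma> \<subseteq> M1 \<tau>\<close>. All subtrees are handled as convex sets of vertices, and the basic tool is the
  partition of the vertices of a tree into the two sides of an edge.

  The heart of the matter is that \<open>\<tau> \<subseteq> M2 \<sigma>\<close> implies \<open>\<sigma> \<subseteq> M1 \<tau>\<close> (\<open>M2_imp_M1\<close>); the converse
  follows by symmetry. The cells with \<open>\<sigma> \<subseteq> M1 \<tau>\<close> form a complex that fibers over \<open>T2\<close> with the
  trees \<open>M1 \<tau>\<close> as fibers, so it is simply connected. Its fiber over \<open>\<sigma>\<close> is the subgraph of \<open>T2\<close> that
  consists of the \<open>\<tau>\<close> with \<open>\<sigma> \<subseteq> M1 \<tau>\<close>, and one has to show that this contains \<open>M2 \<sigma>\<close>. Collapse every
  component of every such fiber to a point. Because the complex is simply connected, this gives a tree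
  on which \<open>G\<close> acts, with a map to \<open>T1\<close>. Every edge of the minimal subtree of this new tree lies on the
  axis of some element, hence survives when all other orbits of edges are collapsed, and \<open>G\<close> splits
  over its stabilizer (\<open>shifted_edge_splits\<close>). By assumption this stabilizer has finite index in the
  stabilizer of the edge \<open>e\<close> of \<open>T1\<close> below, so the component that the edge comes from contains \<open>M2 e\<close>
  (\<open>Mq_edge\<close>). In particular only one component over each \<open>e\<close> occurs; so the minimal subtree maps
  isomorphically to \<open>T1\<close> (\<open>Mq_pr_inj\<close>), and the vertex of it above a vertex \<open>v\<close> of \<open>T1\<close> is a component
  that is invariant under the stabilizer of \<open>v\<close> and so contains \<open>M2 {v}\<close>.

  The common asymmetric core has trees as fibers in both directions. So a cell outside it lies in a
  product of half-trees that misses it (\<open>separating_halves\<close>), and such a quadrant is light, since the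
  orbit of a point of the core stays in the core. Conversely, if \<open>\<tau> \<subseteq> M2 \<sigma>\<close>, then there are elements
  that fix \<open>\<sigma>\<close> and have an axis going into any given half-tree around \<open>\<tau>\<close>; composed with
  elements that move the base point far away in \<open>T1\<close>, their powers show that quadrants around
  \<open>\<sigma> \<times> \<tau>\<close> are heavy (\<open>far_orbit_points\<close>).

  Finally, the part of the core above an open edge of one tree is the product of an open interval with
  a line, and it is open in the core. These products cover the core except for its vertices, and
  there are countably many of them because \<open>G\<close> is countable and acts minimally.
\<close>

section \<open>Trees, half-trees and convex sets\<close>

definition adj :: "'v sgraph \<Rightarrow> ('v \<times> 'v) set" where
  "adj T = {(u, v). {u, v} \<in> edges T}"

text \<open>
  The vertices on the side of \<open>b\<close> of an edge \<open>{a, b}\<close>: those that can be reached from \<open>b\<close> without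
  using the edge.
\<close>

definition half :: "'v sgraph \<Rightarrow> 'v \<Rightarrow> 'v \<Rightarrow> 'v set" where
  "half T a b = (adj T - {(a, b), (b, a)})\<^sup>* `` {b}"

lemma sym_adj: "(u, v) \<in> adj T \<longleftrightarrow> (v, u) \<in> adj T"
  by (simp add: adj_def insert_commute)

lemma rtrancl_sym_swap:
  assumes "sym r" "(u, v) \<in> r\<^sup>*" shows "(v, u) \<in> r\<^sup>*"
  using assms by (metis rtrancl_converseI sym_conv_converse_eq)

lemma rtrancl_crosses:
  assumes "(u, v) \<in> r\<^sup>*" "u \<in> P" "v \<notin> P"
  shows "\<exists>x y. (x, y) \<in> r \<and> x \<in> P \<and> y \<notin> P \<and> (u, x) \<in> r\<^sup>*"
  using assms by (induction rule: rtrancl_induct) blast+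

lemma rtrancl_imp_simple_path:
  assumes "(u, v) \<in> r\<^sup>*"
  shows "\<exists>p. p \<noteq> [] \<and> distinct p \<and> hd p = u \<and> last p = v \<and> successively (\<lambda>x y. (x, y) \<in> r) p"
  using assms
proof (induction rule: rtrancl_induct)
  case base
  show ?case by (rule exI[of _ "[u]"]) simp
next
  case (step y z)
  then obtain p where p: "p \<noteq> []" "distinct p" "hd p = u" "last p = y"
    "successively (\<lambda>x y. (x, y) \<in> r) p" by blast
  show ?case
  proof (cases "z \<in> set p")
    case True
    then obtain q q' where q: "p = q @ z # q'" by (meson split_list)
    have "successively (\<lambda>x y. (x, y) \<in> r) (q @ [z])"
      using p(5) q by (auto simp: successively_append_iff)
    then show ?thesis using p q by (intro exI[of _ "q @ [z]"]) (auto simp: hd_append)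
  next
    case False
    then show ?thesis using p step.hyps
      by (intro exI[of _ "p @ [z]"]) (auto simp: successively_append_iff)
  qed
qed

lemma successively_imp_rtrancl:
  assumes "successively (\<lambda>x y. (x, y) \<in> r) p" "p \<noteq> []"
  shows "(hd p, last p) \<in> r\<^sup>*"
  using assms by (induction p rule: induct_list012) (auto intro: converse_rtrancl_into_rtrancl)

lemma successively_in_Field:
  assumes "successively (\<lambda>x y. (x, y) \<in> r) p" "p \<noteq> []" "hd p \<in> V"
    and "\<And>x y. (x, y) \<in> r \<Longrightarrow> y \<in> V"
  shows "set p \<subseteq> V"
  using assms(1-3) by (induction p rule: induct_list012) (use assms(4) in auto)

lemma successively_edge_path:
  "successively (\<lambda>x y. {x, y} \<in> edges T) p \<longleftrightarrow> successively (\<lambda>x y. (x, y) \<in> adj T) p"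
  by (simp add: adj_def)

text \<open>
  A connected graph in which every edge is a bridge is a tree: of two paths that leave a vertex
  along different edges, one could be used to go round the other's first edge.
\<close>

lemma bridges_imp_unique_path:
  assumes bridge: "\<And>a b. (a, b) \<in> adj T \<Longrightarrow> (a, b) \<notin> (adj T - {(a, b), (b, a)})\<^sup>*"
    and "edge_path T u v p" "edge_path T u v q"
  shows "p = q"
  using assms(2,3)
proof (induction p arbitrary: u q)
  case Nil
  then show ?case by (simp add: edge_path_def)
next
  case (Cons z p)
  have [simp]: "z = u" using Cons.prems by (simp add: edge_path_def)
  obtain q' where q: "q = u # q'"
    using Cons.prems(2) unfolding edge_path_def by (metis list.collapse)
  show ?case
  proof (cases "u = v")
    case True
    have "p = []"
      using Cons.prems(1) True unfolding edge_path_def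
      by (metis distinct.simps(2) last_ConsR last_in_set list.sel(1))
    moreover have "q' = []"
      using Cons.prems(2) True q unfolding edge_path_def
      by (metis distinct.simps(2) last_ConsR last_in_set)
    ultimately show ?thesis using q by simp
  next
    case False
    have "p \<noteq> []" using Cons.prems(1) False by (auto simp: edge_path_def)
    then obtain x p' where p: "p = x # p'" by (cases p) auto
    have "q' \<noteq> []" using Cons.prems(2) q False by (auto simp: edge_path_def)
    then obtain y q'' where q': "q' = y # q''" by (cases q') auto
    have ux: "(u, x) \<in> adj T" and uy: "(u, y) \<in> adj T"
      using Cons.prems p q q' by (auto simp: edge_path_def adj_def)
    have px: "edge_path T x v p"
      using Cons.prems(1) p by (auto simp: edge_path_def)
    have qy: "edge_path T y v q'"
      using Cons.prems(2) q q' by (auto simp: edge_path_def)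
    let ?r = "adj T - {(u, x), (x, u)}"
    have avoid: "(w, v) \<in> ?r\<^sup>*" if w: "edge_path T w v s" "u \<notin> set s" for w s
    proof -
      have "successively (\<lambda>a b. (a, b) \<in> ?r) s"
        using w unfolding edge_path_def successively_edge_path
        by (auto elim!: successively_mono)
      from successively_imp_rtrancl[OF this] show ?thesis using w by (simp add: edge_path_def)
    qed
    have "x = y"
    proof (rule ccontr)
      assume "x \<noteq> y"
      have "(x, v) \<in> ?r\<^sup>*" using avoid[OF px] Cons.prems(1) by (simp add: edge_path_def)
      moreover have "(y, v) \<in> ?r\<^sup>*" using avoid[OF qy] Cons.prems(2) q by (simp add: edge_path_def)
      moreover have "(u, y) \<in> ?r"
        using uy \<open>x \<noteq> y\<close> Cons.prems(2) q q' by (auto simp: edge_path_def)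
      moreover have "sym ?r" using sym_adj by (fastforce intro!: symI)
      ultimately have "(u, x) \<in> ?r\<^sup>*"
        by (meson converse_rtrancl_into_rtrancl rtrancl_sym_swap rtrancl_trans)
      then show False using bridge[OF ux] by blast
    qed
    then show ?thesis using Cons.IH[OF px] qy q by simp
  qed
qed

lemma simplicial_treeI:
  assumes V: "verts T \<noteq> {}" and E: "\<And>e. e \<in> edges T \<Longrightarrow> e \<subseteq> verts T \<and> card e = 2"
    and conn: "\<And>u v. u \<in> verts T \<Longrightarrow> v \<in> verts T \<Longrightarrow> (u, v) \<in> (adj T)\<^sup>*"
    and bridge: "\<And>a b. (a, b) \<in> adj T \<Longrightarrow> (a, b) \<notin> (adj T - {(a, b), (b, a)})\<^sup>*"
  shows "simplicial_tree T"
proof -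
  have "\<exists>!p. edge_path T u v p" if uv: "u \<in> verts T" "v \<in> verts T" for u v
  proof -
    obtain p where p: "p \<noteq> []" "distinct p" "hd p = u" "last p = v"
      "successively (\<lambda>x y. (x, y) \<in> adj T) p"
      using rtrancl_imp_simple_path[OF conn[OF uv]] by blast
    have "set p \<subseteq> verts T"
    proof (rule successively_in_Field[OF p(5,1)])
      show "(x, y) \<in> adj T \<Longrightarrow> y \<in> verts T" for x y using E by (auto simp: adj_def)
    qed (use p uv in simp)
    then have "edge_path T u v p" using p by (simp add: edge_path_def successively_edge_path)
    then show ?thesis using bridges_imp_unique_path[OF bridge] by blast
  qed
  then show ?thesis using V E by (simp add: simplicial_tree_def)
qed

locale stree =
  fixes T :: "'v sgraph"
  assumes tree: "simplicial_tree T"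
begin

lemma edge_verts: "{a, b} \<in> edges T \<Longrightarrow> a \<in> verts T \<and> b \<in> verts T \<and> a \<noteq> b"
  using tree by (fastforce simp: simplicial_tree_def)

lemma edgeE:
  assumes "e \<in> edges T" obtains a b where "e = {a, b}" "a \<noteq> b"
  using tree assms card_2_iff[of e] unfolding simplicial_tree_def by metis

lemma verts_nonempty: "verts T \<noteq> {}"
  using tree by (simp add: simplicial_tree_def)

lemma connected: "u \<in> verts T \<Longrightarrow> v \<in> verts T \<Longrightarrow> (u, v) \<in> (adj T)\<^sup>*"
proof -
  assume "u \<in> verts T" "v \<in> verts T"
  then obtain p where p: "edge_path T u v p" using tree unfolding simplicial_tree_def by blast
  then show ?thesis
    using successively_imp_rtrancl[of "adj T" p] by (simp add: edge_path_def successively_edge_path)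
qed

lemma half_subset_verts: assumes "{a, b} \<in> edges T" shows "half T a b \<subseteq> verts T"
proof -
  have "v \<in> verts T" if "(b, v) \<in> (adj T - {(a, b), (b, a)})\<^sup>*" for v
    using that by (induction rule: rtrancl_induct) (use edge_verts assms in \<open>auto simp: adj_def\<close>)
  then show ?thesis by (auto simp: half_def)
qed

lemma bridge: assumes "{a, b} \<in> edges T" shows "a \<notin> half T a b"
proof
  let ?r = "adj T - {(a, b), (b, a)}"
  assume "a \<in> half T a b"
  then have "(b, a) \<in> ?r\<^sup>*" by (simp add: half_def)
  then obtain p where p: "p \<noteq> []" "distinct p" "hd p = b" "last p = a" "successively (\<lambda>x y. (x, y) \<in> ?r) p"
    using rtrancl_imp_simple_path by metis
  have ab: "a \<in> verts T" "b \<in> verts T" "a \<noteq> b" using edge_verts assms by auto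
  have "successively (\<lambda>x y. (x, y) \<in> adj T) p"
    using p(5) by (auto elim!: successively_mono)
  moreover have "set p \<subseteq> verts T"
  proof (rule successively_in_Field[OF p(5,1)])
    show "(x, y) \<in> ?r \<Longrightarrow> y \<in> verts T" for x y using edge_verts by (auto simp: adj_def)
  qed (use p ab in simp)
  ultimately have "edge_path T b a p" using p by (simp add: edge_path_def successively_edge_path)
  moreover have "edge_path T b a [b, a]"
    using ab assms by (auto simp: edge_path_def insert_commute)
  ultimately have "p = [b, a]" using tree ab unfolding simplicial_tree_def by metis
  then show False using p(5) by simp
qed

lemma half_self: "b \<in> half T a b" by (simp add: half_def)

lemma half_step:
  assumes "x \<in> half T a b" "{x, y} \<in> edges T" "{x, y} \<noteq> {a, b}"
  shows "y \<in> half T a b"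
proof -
  have "(x, y) \<in> adj T - {(a, b), (b, a)}" using assms by (auto simp: adj_def)
  then show ?thesis using assms(1) by (auto simp: half_def intro: rtrancl_into_rtrancl)
qed

lemma half_disjoint: assumes "{a, b} \<in> edges T" shows "half T a b \<inter> half T b a = {}"
proof (rule ccontr)
  let ?r = "adj T - {(a, b), (b, a)}"
  assume "half T a b \<inter> half T b a \<noteq> {}"
  then obtain v where "(b, v) \<in> ?r\<^sup>*" "(a, v) \<in> ?r\<^sup>*"
    by (auto simp: half_def insert_commute)
  moreover have "sym ?r" using sym_adj by (fastforce intro!: symI)
  ultimately have "(b, a) \<in> ?r\<^sup>*" by (meson rtrancl_sym_swap rtrancl_trans)
  then show False using bridge[OF assms] by (simp add: half_def)
qed

lemma half_cover: assumes "{a, b} \<in> edges T" shows "half T a b \<union> half T b a = verts T"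
proof
  show "half T a b \<union> half T b a \<subseteq> verts T"
    using half_subset_verts assms by (auto simp: insert_commute)
  show "verts T \<subseteq> half T a b \<union> half T b a"
  proof
    fix v assume v: "v \<in> verts T"
    have "b \<in> verts T" using edge_verts assms by auto
    from connected[OF this v] show "v \<in> half T a b \<union> half T b a"
    proof (induction rule: rtrancl_induct)
      case (step y z)
      then show ?case
        using half_step[of y a b z] half_step[of y b a z] half_self[of a b] half_self
        by (cases "{y, z} = {a, b}") (auto simp: adj_def doubleton_eq_iff)
    qed (simp add: half_self)
  qed
qed

lemma half_compl: "{a, b} \<in> edges T \<Longrightarrow> v \<in> verts T \<Longrightarrow> v \<notin> half T a b \<longleftrightarrow> v \<in> half T b a"
  using half_disjoint half_cover by blast

lemma half_crossing:
  assumes "{a, b} \<in> edges T" "{x, y} \<in> edges T" "x \<in> half T a b" "y \<notin> half T a b"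
  shows "x = b \<and> y = a"
  using half_step[OF assms(3,2)] assms(4) half_self[of b a] assms(3) bridge[OF assms(1)]
  by (auto simp: doubleton_eq_iff)

lemma connected_one_side:
  assumes "{a, b} \<in> edges T" and "r \<subseteq> adj T" and "(a, b) \<notin> r" "(b, a) \<notin> r"
    and "(u, v) \<in> r\<^sup>*"
  shows "u \<in> half T a b \<longleftrightarrow> v \<in> half T a b"
  using assms(5)
proof (induction rule: rtrancl_induct)
  case (step y z)
  have yz: "{y, z} \<in> edges T" "{z, y} \<in> edges T" using step(2) assms(2) by (auto simp: adj_def insert_commute)
  show ?case
    using half_crossing[OF assms(1) yz(1)] half_crossing[OF assms(1) yz(2)] step assms(3,4) by blast
qed simp

text \<open>
  A half-tree is determined by the only edge that leaves it; this is how group elements are seen to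
  map half-trees to half-trees.
\<close>

lemma half_unique:
  assumes ab: "{a, b} \<in> edges T" and "S \<subseteq> verts T" "b \<in> S" "a \<notin> S"
    and cross: "\<And>x y. {x, y} \<in> edges T \<Longrightarrow> x \<in> S \<Longrightarrow> y \<notin> S \<Longrightarrow> x = b \<and> y = a"
  shows "S = half T a b"
proof -
  have 1: "half T x y \<subseteq> P"
    if "y \<in> P" and P: "\<And>u v. {u, v} \<in> edges T \<Longrightarrow> u \<in> P \<Longrightarrow> v \<notin> P \<Longrightarrow> {u, v} = {x, y}" for P x y
  proof -
    have "v \<in> P" if "(y, v) \<in> (adj T - {(x, y), (y, x)})\<^sup>*" for v
      using that
    proof (induction rule: rtrancl_induct)
      case (step u v) then show ?case using P[of u v] by (auto simp: adj_def doubleton_eq_iff)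
    qed (fact \<open>y \<in> P\<close>)
    then show ?thesis by (auto simp: half_def)
  qed
  have "half T a b \<subseteq> S" using assms by (intro 1) (auto simp: doubleton_eq_iff)
  moreover have "half T b a \<subseteq> - S"
  proof (rule 1)
    fix u v assume "{u, v} \<in> edges T" "u \<in> - S" "v \<notin> - S"
    then show "{u, v} = {b, a}" using cross[of v u] by (auto simp: insert_commute)
  qed (use assms in simp)
  ultimately show ?thesis using half_cover[OF ab] assms(2) by blast
qed

text \<open>
  A walk in \<open>half T c d\<close> from \<open>d\<close> to any other vertex avoids \<open>a\<close>, so it does not cross \<open>{a, b}\<close>.
\<close>

lemma half_nested:
  assumes ab: "{a, b} \<in> edges T" and cd: "{c, d} \<in> edges T"
    and "c \<in> half T a b" "a \<notin> half T c d"
  shows "half T c d \<subseteq> half T a b"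
proof
  fix v assume v: "v \<in> half T c d"
  let ?r = "adj T \<inter> half T c d \<times> half T c d"
  have "(d, v) \<in> ?r\<^sup>*"
  proof -
    have "(d, v) \<in> (adj T - {(c, d), (d, c)})\<^sup>*" using v by (simp add: half_def)
    then show ?thesis
    proof (induction rule: rtrancl_induct)
      case (step y z)
      then have "(y, z) \<in> ?r" by (auto simp: half_def intro: rtrancl_into_rtrancl)
      with step show ?case by (meson rtrancl_into_rtrancl)
    qed simp
  qed
  then have "d \<in> half T a b \<longleftrightarrow> v \<in> half T a b"
    using assms(4) by (intro connected_one_side[OF ab]) auto
  moreover have "d \<in> half T a b"
    using half_crossing[OF ab cd assms(3)] assms(4) half_self[of d c] by blast
  ultimately show "v \<in> half T a b" by simp
qed

text \<open>
  The edges between two vertices. It is convenient to treat paths through the set of edges that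
  separate their ends, as \<open>sep u w\<close> is the symmetric difference of \<open>sep u v\<close> and \<open>sep v w\<close>.
\<close>

definition sep :: "'v \<Rightarrow> 'v \<Rightarrow> 'v set set" where
  "sep u v = {{a, b} | a b. {a, b} \<in> edges T \<and> u \<in> half T b a \<and> v \<in> half T a b}"

lemma sep_iff:
  assumes "{a, b} \<in> edges T" "u \<in> verts T" "v \<in> verts T"
  shows "{a, b} \<in> sep u v \<longleftrightarrow> (u \<in> half T a b \<longleftrightarrow> v \<notin> half T a b)"
proof -
  have *: "{c, d} = {a, b} \<longleftrightarrow> c = a \<and> d = b \<or> c = b \<and> d = a" for c d
    by (auto simp: doubleton_eq_iff)
  have "{b, a} \<in> edges T" using assms(1) by (simp add: insert_commute)
  then show ?thesis
    using half_compl[OF assms(1)] half_compl[of b a] assms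
    unfolding sep_def mem_Collect_eq by (metis (no_types, lifting) *)
qed

lemma sep_subset: "sep u v \<subseteq> edges T" by (auto simp: sep_def)

lemma sep_self: "u \<in> verts T \<Longrightarrow> sep u u = {}"
  using sep_iff[of _ _ u u] sep_subset by (metis (no_types, opaque_lifting) edgeE equals0I in_mono)

lemma sep_sym: assumes "u \<in> verts T" "v \<in> verts T" shows "sep u v = sep v u"
proof -
  have "e \<in> sep u v \<longleftrightarrow> e \<in> sep v u" if "e \<in> edges T" for e
    using that sep_iff[OF _ assms] sep_iff[OF _ assms(2,1)] by (metis edgeE)
  then show ?thesis using sep_subset by blast
qed

lemma sep_trans:
  assumes "u \<in> verts T" "v \<in> verts T" "w \<in> verts T"
  shows "sep u w = (sep u v - sep v w) \<union> (sep v w - sep u v)"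
proof -
  have "e \<in> sep u w \<longleftrightarrow> (e \<in> sep u v) \<noteq> (e \<in> sep v w)" if "e \<in> edges T" for e
    using that sep_iff[OF _ assms(1,2)] sep_iff[OF _ assms(2,3)] sep_iff[OF _ assms(1,3)] by (metis edgeE)
  then show ?thesis using sep_subset by blast
qed

lemma sep_edge: assumes "{u, v} \<in> edges T" shows "sep u v = {{u, v}}"
proof -
  have uv: "u \<in> verts T" "v \<in> verts T" "{v, u} \<in> edges T"
    using edge_verts[OF assms] assms by (auto simp: insert_commute)
  have "{u, v} \<in> sep u v" using sep_iff[OF assms uv(1,2)] bridge[OF assms] half_self[of v u] by simp
  moreover have "{a, b} = {u, v}" if "{a, b} \<in> sep u v" for a b
  proof -
    have ab: "{a, b} \<in> edges T" using that sep_subset by blast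
    then have "u \<in> half T a b \<longleftrightarrow> v \<notin> half T a b" using that sep_iff uv by blast
    then show ?thesis using half_crossing[OF ab assms] half_crossing[OF ab uv(3)] by blast
  qed
  moreover have "\<exists>a b. e = {a, b}" if "e \<in> sep u v" for e using that by (auto simp: sep_def)
  ultimately show ?thesis by blast
qed

lemma finite_sep: assumes "u \<in> verts T" "v \<in> verts T" shows "finite (sep u v)"
proof -
  from connected[OF assms] show ?thesis
  proof (induction rule: rtrancl_induct)
    case base then show ?case using sep_self assms by simp
  next
    case (step y z)
    have yz: "{y, z} \<in> edges T" using step by (simp add: adj_def)
    then show ?case using sep_trans[of u y z] sep_edge[OF yz] edge_verts[OF yz] assms step by simp
  qed
qed

definition tdist :: "'v \<Rightarrow> 'v \<Rightarrow> nat" where "tdist u v = card (sep u v)"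

lemma first_edge:
  assumes "u \<in> verts T" "v \<in> verts T" "u \<noteq> v"
  shows "\<exists>x. {u, x} \<in> edges T \<and> v \<in> half T u x"
proof -
  from connected[OF assms(1,2)] have "v = u \<or> ?thesis"
  proof (induction rule: rtrancl_induct)
    case (step y z)
    have yz: "{y, z} \<in> edges T" using step by (simp add: adj_def)
    show ?case
    proof (cases "y = u")
      case True
      then show ?thesis using yz half_self by blast
    next
      case False
      then obtain x where "{u, x} \<in> edges T" "y \<in> half T u x" using step by blast
      then show ?thesis using half_step[of y u x z] yz False by (auto simp: doubleton_eq_iff)
    qed
  qed simp
  then show ?thesis using assms by blast
qed

lemma sep_nonempty: assumes "u \<in> verts T" "v \<in> verts T" "u \<noteq> v" shows "sep u v \<noteq> {}"
proof -
  obtain x where x: "{u, x} \<in> edges T" "v \<in> half T u x" using first_edge[OF assms] by blast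
  then show ?thesis using half_self[of u x] sep_def half_self by blast
qed

lemma tdist_triangle:
  assumes "u \<in> verts T" "v \<in> verts T" "w \<in> verts T"
  shows "tdist u w \<le> tdist u v + tdist v w"
proof -
  have "card (sep u w) \<le> card (sep u v \<union> sep v w)"
    using finite_sep assms by (intro card_mono) (auto simp: sep_trans[OF assms])
  also have "\<dots> \<le> card (sep u v) + card (sep v w)" by (rule card_Un_le)
  finally show ?thesis by (simp add: tdist_def)
qed

lemma tdist_sym: "u \<in> verts T \<Longrightarrow> v \<in> verts T \<Longrightarrow> tdist u v = tdist v u"
  using sep_sym by (simp add: tdist_def)

lemma tdist_edge: "{u, v} \<in> edges T \<Longrightarrow> tdist u v = 1"
  using sep_edge by (simp add: tdist_def)

lemma tdist_self: "u \<in> verts T \<Longrightarrow> tdist u u = 0"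
  using sep_self by (simp add: tdist_def)

lemma tdist_first_edge:
  assumes "{u, x} \<in> edges T" "v \<in> half T u x"
  shows "tdist u v = Suc (tdist x v)"
proof -
  have V: "u \<in> verts T" "x \<in> verts T" "v \<in> verts T"
    using edge_verts assms half_subset_verts by blast+
  have "{u, x} \<in> sep u v" using sep_def half_self assms by blast
  moreover have "{u, x} \<notin> sep x v" using sep_iff[OF assms(1) V(2,3)] half_self[of x u] assms(2) by simp
  then have "sep u v = insert {u, x} (sep x v)"
    using sep_trans[OF V] sep_edge[OF assms(1)] by auto
  ultimately show ?thesis using finite_sep V \<open>{u, x} \<notin> sep x v\<close> by (simp add: tdist_def)
qed

subsection \<open>Convex sets of vertices\<close>

text \<open>
  Convex sets are the vertex sets of subtrees. Closure under the paths between members, rather than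
  connectedness, is taken as the definition because it passes to intersections.
\<close>

definition conv :: "'v set \<Rightarrow> bool" where
  "conv C \<longleftrightarrow> C \<subseteq> verts T \<and> (\<forall>u \<in> C. \<forall>v \<in> C. \<Union>(sep u v) \<subseteq> C)"

lemma convD: "conv C \<Longrightarrow> u \<in> C \<Longrightarrow> v \<in> C \<Longrightarrow> {a, b} \<in> sep u v \<Longrightarrow> a \<in> C \<and> b \<in> C"
  unfolding conv_def by blast

lemma conv_verts: "conv (verts T)"
  using edge_verts sep_subset unfolding conv_def by (blast elim: edgeE)

lemma conv_Inter: "\<F> \<noteq> {} \<Longrightarrow> (\<And>C. C \<in> \<F> \<Longrightarrow> conv C) \<Longrightarrow> conv (\<Inter>\<F>)"
  unfolding conv_def by blast

text \<open>
  A walk that joins two vertices crosses every edge that separates them, so connected sets are convex.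
\<close>

lemma rtrancl_conv:
  assumes C: "C \<subseteq> verts T" and r: "r \<subseteq> adj T \<inter> C \<times> C"
    and conn: "\<And>u v. u \<in> C \<Longrightarrow> v \<in> C \<Longrightarrow> (u, v) \<in> r\<^sup>*"
  shows "conv C"
  unfolding conv_def
proof (intro conjI ballI C subsetI)
  fix u v x assume uv: "u \<in> C" "v \<in> C" and "x \<in> \<Union>(sep u v)"
  then obtain a b where ab: "{a, b} \<in> edges T" "u \<in> half T b a" "v \<in> half T a b" "x \<in> {a, b}"
    by (auto simp: sep_def)
  have "{b, a} \<in> edges T" using ab by (simp add: insert_commute)
  moreover have "v \<notin> half T b a" using ab half_disjoint by blast
  ultimately have "(a, b) \<in> r \<or> (b, a) \<in> r"
    using connected_one_side[of b a r u v] conn[OF uv] r ab by blast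
  then show "x \<in> C" using ab(4) r by blast
qed

lemma conv_half: assumes "{a, b} \<in> edges T" shows "conv (half T a b)"
proof (rule rtrancl_conv[OF half_subset_verts[OF assms]])
  let ?r = "adj T \<inter> half T a b \<times> half T a b"
  have 1: "(b, v) \<in> ?r\<^sup>*" if "v \<in> half T a b" for v
  proof -
    have "(b, v) \<in> (adj T - {(a, b), (b, a)})\<^sup>*" using that by (simp add: half_def)
    then show ?thesis
    proof (induction rule: rtrancl_induct)
      case (step y z)
      then have "(y, z) \<in> ?r" by (auto simp: half_def intro: rtrancl_into_rtrancl)
      with step show ?case by (meson rtrancl_into_rtrancl)
    qed simp
  qed
  have "sym ?r" using sym_adj by (fastforce intro!: symI)
  then show "(u, v) \<in> ?r\<^sup>*" if "u \<in> half T a b" "v \<in> half T a b" for u v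
    using 1 that by (meson rtrancl_sym_swap rtrancl_trans)
qed simp

lemma conv_connected:
  assumes "conv C" "u \<in> C" "v \<in> C"
  shows "(u, v) \<in> (adj T \<inter> C \<times> C)\<^sup>*"
  using assms(2)
proof (induction "tdist u v" arbitrary: u)
  case 0
  have "u \<in> verts T" "v \<in> verts T" using assms 0 by (auto simp: conv_def)
  then have "u = v" using 0 sep_nonempty[of u v] finite_sep[of u v] by (auto simp: tdist_def)
  then show ?case by simp
next
  case (Suc n)
  have V: "u \<in> verts T" "v \<in> verts T" using assms Suc by (auto simp: conv_def)
  then have "u \<noteq> v" using Suc.hyps tdist_self by force
  then obtain x where x: "{u, x} \<in> edges T" "v \<in> half T u x" using first_edge V by blast
  then have "{u, x} \<in> sep u v" using sep_def half_self by blast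
  then have xC: "x \<in> C" using assms Suc convD by blast
  have "n = tdist x v" using tdist_first_edge[OF x] Suc by simp
  then have "(x, v) \<in> (adj T \<inter> C \<times> C)\<^sup>*" using Suc xC by blast
  moreover have "(u, x) \<in> adj T \<inter> C \<times> C" using x xC Suc by (simp add: adj_def)
  ultimately show ?case by (meson converse_rtrancl_into_rtrancl)
qed

lemma conv_one_side:
  assumes "conv C" "{a, b} \<in> edges T" "\<not> (a \<in> C \<and> b \<in> C)" "u \<in> C" "v \<in> C"
  shows "u \<in> half T a b \<longleftrightarrow> v \<in> half T a b"
  using assms convD[OF assms(1,4,5)] sep_iff[OF assms(2)] unfolding conv_def by blast

lemma conv_separate:
  assumes "conv C" "C \<noteq> {}" "c \<in> verts T" "c \<notin> C"
  shows "\<exists>a b. {a, b} \<in> edges T \<and> C \<subseteq> half T b a \<and> c \<in> half T a b"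
proof -
  obtain z where z: "z \<in> C" using assms by blast
  then have zV: "z \<in> verts T" using assms by (auto simp: conv_def)
  obtain x where x: "{c, x} \<in> edges T" "z \<in> half T c x" using first_edge[OF assms(3) zV] z assms(4) by blast
  have "C \<subseteq> half T c x"
    using conv_one_side[OF assms(1) x(1) _ z] assms(4) x(2) by blast
  then show ?thesis using x half_self by (metis insert_commute)
qed

definition induced :: "'v set \<Rightarrow> 'v sgraph" where
  "induced C = \<lparr>verts = C, edges = {e \<in> edges T. e \<subseteq> C}\<rparr>"

lemma induced_simps [simp]:
  "verts (induced C) = C" "edges (induced C) = {e \<in> edges T. e \<subseteq> C}"
  by (simp_all add: induced_def)

lemma adj_induced: "adj (induced C) = adj T \<inter> C \<times> C"
  by (auto simp: adj_def)

lemma induced_tree: assumes "conv C" "C \<noteq> {}" shows "simplicial_tree (induced C)"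
proof (rule simplicial_treeI)
  show "verts (induced C) \<noteq> {}" using assms by simp
  show "e \<subseteq> verts (induced C) \<and> card e = 2" if "e \<in> edges (induced C)" for e
    using that tree by (simp add: simplicial_tree_def)
  show "(u, v) \<in> (adj (induced C))\<^sup>*" if "u \<in> verts (induced C)" "v \<in> verts (induced C)" for u v
    using conv_connected[OF assms(1)] that by (simp add: adj_induced)
  show "(a, b) \<notin> (adj (induced C) - {(a, b), (b, a)})\<^sup>*" if "(a, b) \<in> adj (induced C)" for a b
  proof
    assume "(a, b) \<in> (adj (induced C) - {(a, b), (b, a)})\<^sup>*"
    moreover have "adj (induced C) - {(a, b), (b, a)} \<subseteq> adj T - {(a, b), (b, a)}"
      by (auto simp: adj_induced)
    ultimately have "(a, b) \<in> (adj T - {(a, b), (b, a)})\<^sup>*" by (meson in_mono rtrancl_mono)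
    then have "b \<in> half T b a" by (simp add: half_def insert_commute)
    moreover have "{b, a} \<in> edges T" using that by (simp add: adj_def insert_commute)
    ultimately show False using bridge by blast
  qed
qed

text \<open>
  Subtrees are induced subgraphs: a walk in the subtree between the ends of an edge has to use that edge.
\<close>

lemma subtree_conv:
  assumes S: "simplicial_tree S" "verts S \<subseteq> verts T" "edges S \<subseteq> edges T"
  shows "conv (verts S) \<and> verts S \<noteq> {} \<and> S = induced (verts S)"
proof -
  interpret S: stree S using S(1) by unfold_locales
  have sub: "adj S \<subseteq> adj T \<inter> verts S \<times> verts S" using S(3) S.edge_verts by (auto simp: adj_def)
  have "conv (verts S)" by (rule rtrancl_conv[OF S(2) sub S.connected])
  moreover have "edges S = {e \<in> edges T. e \<subseteq> verts S}"
  proof -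
    have "e \<in> edges S" if e: "e \<in> edges T" "e \<subseteq> verts S" for e
    proof -
      obtain a b where ab: "e = {a, b}" using e edgeE by metis
      have "(a, b) \<in> adj S \<or> (b, a) \<in> adj S"
        using connected_one_side[of a b "adj S" a b] S.connected[of a b] bridge[of a b] half_self[of b a]
          sub ab e by auto
      then show ?thesis using ab by (auto simp: adj_def insert_commute)
    qed
    moreover have "e \<subseteq> verts S" if "e \<in> edges S" for e
      using that S.edge_verts by (metis S.edgeE empty_subsetI insert_subset)
    ultimately show ?thesis using S(3) by blast
  qed
  ultimately show ?thesis using S.verts_nonempty by (simp add: induced_def)
qed

end

section \<open>Groups acting on trees\<close>

lemma (in stree) edge_subset: "e \<in> edges T \<Longrightarrow> e \<subseteq> verts T"
  using tree by (simp add: simplicial_tree_def)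

sublocale tree_action \<subseteq> stree T
  by unfold_locales (rule tree)

sublocale tree_action \<subseteq> group G
  using group_hom by (simp add: group_hom_def)

context tree_action
begin

lemma act_closed: "g \<in> carrier G \<Longrightarrow> v \<in> verts T \<Longrightarrow> \<phi> g v \<in> verts T"
  using element_image by blast

lemma act_mult:
  "g \<in> carrier G \<Longrightarrow> h \<in> carrier G \<Longrightarrow> v \<in> verts T \<Longrightarrow> \<phi> (g \<otimes> h) v = \<phi> g (\<phi> h v)"
  by (rule composition_rule)

lemma act_one: "v \<in> verts T \<Longrightarrow> \<phi> \<one> v = v"
  using id_eq_one by (metis restrict_apply')

lemma act_inv:
  assumes "g \<in> carrier G" "v \<in> verts T"
  shows "\<phi> (inv g) (\<phi> g v) = v" "\<phi> g (\<phi> (inv g) v) = v"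
  using assms by (simp_all flip: act_mult add: act_one)

lemma act_inj: "g \<in> carrier G \<Longrightarrow> u \<in> verts T \<Longrightarrow> v \<in> verts T \<Longrightarrow> \<phi> g u = \<phi> g v \<longleftrightarrow> u = v"
  using act_inv by metis

lemma act_image_inv: "g \<in> carrier G \<Longrightarrow> C \<subseteq> verts T \<Longrightarrow> \<phi> g ` \<phi> (inv g) ` C = C"
  unfolding image_image by (rule image_cong[of C C _ "\<lambda>x. x", simplified]) (auto simp: act_inv)

lemma act_image_psubset:
  assumes g: "g \<in> carrier G" and "C \<subset> D" "D \<subseteq> verts T" shows "\<phi> g ` C \<subset> \<phi> g ` D"
proof -
  have "\<phi> g ` C \<noteq> \<phi> g ` D"
    using inj_on_image_eq_iff[OF inj_prop[OF g], of C D] assms by blast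
  then show ?thesis using assms by blast
qed

lemma act_pow_Suc:
  assumes "g \<in> carrier G" "v \<in> verts T"
  shows "\<phi> (g [^] Suc n) v = \<phi> g (\<phi> (g [^] n) v)"
  using assms act_mult[of g "g [^] n" v] by (metis nat_pow_Suc2 nat_pow_closed)

lemma act_pow_add:
  assumes "g \<in> carrier G" "v \<in> verts T"
  shows "\<phi> (g [^] (m + n)) v = \<phi> (g [^] (m::nat)) (\<phi> (g [^] (n::nat)) v)"
  using assms by (simp flip: act_mult add: nat_pow_mult)

lemma edge_act: "g \<in> carrier G \<Longrightarrow> {a, b} \<in> edges T \<Longrightarrow> {\<phi> g a, \<phi> g b} \<in> edges T"
  using edge_image[of g "{a, b}"] by simp

lemma edge_act_iff:
  assumes "g \<in> carrier G" "a \<in> verts T" "b \<in> verts T"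
  shows "{\<phi> g a, \<phi> g b} \<in> edges T \<longleftrightarrow> {a, b} \<in> edges T"
  using assms edge_act[of g a b] edge_act[of "inv g" "\<phi> g a" "\<phi> g b"] by (auto simp: act_inv)

lemma half_act:
  assumes g: "g \<in> carrier G" and ab: "{a, b} \<in> edges T"
  shows "\<phi> g ` half T a b = half T (\<phi> g a) (\<phi> g b)"
proof (rule half_unique)
  have H: "half T a b \<subseteq> verts T" by (rule half_subset_verts[OF ab])
  have V: "a \<in> verts T" "b \<in> verts T" using edge_verts ab by auto
  show "{\<phi> g a, \<phi> g b} \<in> edges T" using edge_act g ab by blast
  show "\<phi> g ` half T a b \<subseteq> verts T" using H act_closed[OF g] by blast
  show "\<phi> g b \<in> \<phi> g ` half T a b" using half_self by blast
  show "\<phi> g a \<notin> \<phi> g ` half T a b"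
  proof
    assume "\<phi> g a \<in> \<phi> g ` half T a b"
    then obtain u where "u \<in> half T a b" "\<phi> g a = \<phi> g u" by blast
    then show False using bridge[OF ab] act_inj[OF g V(1)] H by blast
  qed
  fix x y assume xy: "{x, y} \<in> edges T" "x \<in> \<phi> g ` half T a b" "y \<notin> \<phi> g ` half T a b"
  then obtain u where u: "u \<in> half T a b" "x = \<phi> g u" by blast
  define w where "w = \<phi> (inv g) y"
  have y: "y \<in> verts T" using edge_verts xy by auto
  then have w: "w \<in> verts T" "y = \<phi> g w" using g act_closed act_inv by (auto simp: w_def)
  have "{u, w} \<in> edges T" using xy u w H edge_act_iff[OF g, of u w] by auto
  moreover have "w \<notin> half T a b" using xy w by blast
  ultimately have "u = b \<and> w = a" using half_crossing[OF ab] u by blast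
  then show "x = \<phi> g b \<and> y = \<phi> g a" using u w by simp
qed

lemma half_act_iff:
  assumes "g \<in> carrier G" "{a, b} \<in> edges T" "v \<in> verts T"
  shows "\<phi> g v \<in> half T (\<phi> g a) (\<phi> g b) \<longleftrightarrow> v \<in> half T a b"
  using assms half_subset_verts[OF assms(2)] act_inj[OF assms(1,3)]
  by (simp flip: half_act) blast

lemma sep_act:
  assumes g: "g \<in> carrier G" and "u \<in> verts T" "v \<in> verts T"
  shows "sep (\<phi> g u) (\<phi> g v) = (`) (\<phi> g) ` sep u v"
proof -
  have 1: "(`) (\<phi> h) ` sep x y \<subseteq> sep (\<phi> h x) (\<phi> h y)"
    if h: "h \<in> carrier G" "x \<in> verts T" "y \<in> verts T" for h x y
  proof
    fix e assume "e \<in> (`) (\<phi> h) ` sep x y"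
    then obtain a b where ab: "e = {\<phi> h a, \<phi> h b}" "{a, b} \<in> edges T" "x \<in> half T b a" "y \<in> half T a b"
      by (auto simp: sep_def)
    then have "{b, a} \<in> edges T" by (simp add: insert_commute)
    then show "e \<in> sep (\<phi> h x) (\<phi> h y)"
      using ab edge_act[OF h(1)] half_act_iff[OF h(1) ab(2) h(3)] half_act_iff[OF h(1) _ h(2)]
      unfolding sep_def by blast
  qed
  have "e \<in> (`) (\<phi> g) ` sep u v" if e: "e \<in> sep (\<phi> g u) (\<phi> g v)" for e
  proof -
    have "\<phi> (inv g) ` e \<in> sep u v"
      using 1[of "inv g" "\<phi> g u" "\<phi> g v"] e assms act_closed act_inv by auto
    moreover have "e \<subseteq> verts T"
      using e sep_subset edge_subset by blast
    then have "\<phi> g ` \<phi> (inv g) ` e = e" by (rule act_image_inv[OF g])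
    ultimately show ?thesis by (metis imageI)
  qed
  then show ?thesis using 1[OF assms] by blast
qed

lemma conv_act:
  assumes g: "g \<in> carrier G" and C: "conv C" shows "conv (\<phi> g ` C)"
proof -
  have V: "C \<subseteq> verts T" using C by (simp add: conv_def)
  have "\<Union>(sep (\<phi> g u) (\<phi> g v)) \<subseteq> \<phi> g ` C" if "u \<in> C" "v \<in> C" for u v
  proof -
    have "\<Union>(sep u v) \<subseteq> C" using C that by (simp add: conv_def)
    moreover have "u \<in> verts T" "v \<in> verts T" using V that by auto
    ultimately show ?thesis by (auto simp: sep_act[OF g])
  qed
  then show ?thesis using V act_closed[OF g] by (auto simp: conv_def)
qed

lemma tdist_act:
  assumes g: "g \<in> carrier G" and "u \<in> verts T" "v \<in> verts T"
  shows "tdist (\<phi> g u) (\<phi> g v) = tdist u v"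
proof -
  have "inj_on ((`) (\<phi> g)) (sep u v)"
  proof (rule inj_on_subset[OF inj_on_image_Pow[OF inj_prop[OF g]]])
    show "sep u v \<subseteq> Pow (verts T)" using sep_subset edge_subset by blast
  qed
  then show ?thesis by (simp add: tdist_def sep_act[OF assms] card_image)
qed

lemma edge_fixed:
  assumes g: "g \<in> carrier G" and ab: "{a, b} \<in> edges T" and im: "\<phi> g ` {a, b} = {a, b}"
  shows "\<phi> g a = a \<and> \<phi> g b = b"
  using no_inversion[OF g ab] im by (auto simp: doubleton_eq_iff)

subsection \<open>Elements that shift an edge\<close>

text \<open>
  This says that \<open>g\<close> is hyperbolic and that its axis crosses the edge \<open>{a, b}\<close> in the direction
  of \<open>b\<close>. Axes enter only through this property.
\<close>

definition shifts where
  "shifts g a b \<longleftrightarrow> \<phi> g ` half T a b \<subset> half T a b"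

lemma shifts_pow:
  assumes g: "g \<in> carrier G" and ab: "{a, b} \<in> edges T" and s: "shifts g a b"
  shows "shifts (g [^] Suc n) a b"
proof (induction n)
  case 0
  then show ?case using s g by simp
next
  case (Suc n)
  have H: "half T a b \<subseteq> verts T" by (rule half_subset_verts[OF ab])
  have "\<phi> (g [^] Suc (Suc n)) ` half T a b = \<phi> g ` \<phi> (g [^] Suc n) ` half T a b"
    unfolding image_image by (intro image_cong refl act_pow_Suc[OF g]) (use H in blast)
  also have "\<dots> \<subseteq> \<phi> g ` half T a b" using Suc by (auto simp: shifts_def)
  finally show ?case using s unfolding shifts_def by (meson subset_psubset_trans)
qed

lemma shifts_inv:
  assumes g: "g \<in> carrier G" and ab: "{a, b} \<in> edges T" and s: "shifts g a b"
  shows "shifts (inv g) b a"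
proof -
  have ba: "{b, a} \<in> edges T" using ab by (simp add: insert_commute)
  have H: "half T a b \<subseteq> verts T" "half T b a \<subseteq> verts T"
    using half_subset_verts ab ba by blast+
  have iff: "v \<in> half T a b \<longleftrightarrow> v \<notin> half T b a" if "v \<in> verts T" for v
    using half_compl[OF ab that] by blast
  have "\<phi> (inv g) v \<in> half T b a" if v: "v \<in> half T b a" for v
  proof (rule ccontr)
    assume "\<phi> (inv g) v \<notin> half T b a"
    then have "\<phi> (inv g) v \<in> half T a b" using iff act_closed g v H by blast
    then have "\<phi> g (\<phi> (inv g) v) \<in> half T a b" using s by (auto simp: shifts_def)
    then show False using v H iff act_inv g by auto
  qed
  moreover obtain w where w: "w \<in> half T a b" "w \<notin> \<phi> g ` half T a b"
    using s by (auto simp: shifts_def)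
  have "\<phi> (inv g) w \<in> half T b a"
  proof (rule ccontr)
    assume "\<phi> (inv g) w \<notin> half T b a"
    then have "\<phi> (inv g) w \<in> half T a b" using iff act_closed g w H by blast
    then have "\<phi> g (\<phi> (inv g) w) \<in> \<phi> g ` half T a b" by blast
    then show False using w H act_inv g by auto
  qed
  have "\<phi> (inv g) w \<notin> \<phi> (inv g) ` half T b a"
  proof
    assume "\<phi> (inv g) w \<in> \<phi> (inv g) ` half T b a"
    then obtain v where v: "v \<in> half T b a" "\<phi> (inv g) w = \<phi> (inv g) v" by blast
    then have "w = v" using act_inj[of "inv g" w v] g w H by blast
    then show False using v w iff H by blast
  qed
  ultimately show ?thesis using \<open>\<phi> (inv g) w \<in> half T b a\<close> by (auto simp: shifts_def)
qed

lemma edge_orbit_inj: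
  assumes g: "g \<in> carrier G" and ab: "{a, b} \<in> edges T"
    and moved: "\<And>k. \<phi> (g [^] Suc k) ` {a, b} \<noteq> {a, b}"
  shows "inj (\<lambda>n::nat. \<phi> (g [^] n) ` {a, b})"
proof -
  have V: "{a, b} \<subseteq> verts T" using edge_verts ab by auto
  have "\<phi> (g [^] m) ` {a, b} \<noteq> \<phi> (g [^] n) ` {a, b}" if "m < n" for m n :: nat
  proof
    assume eq: "\<phi> (g [^] m) ` {a, b} = \<phi> (g [^] n) ` {a, b}"
    obtain k where k: "n = m + Suc k" using \<open>m < n\<close> less_imp_Suc_add by auto
    let ?e = "\<phi> (g [^] Suc k) ` {a, b}"
    have "\<phi> (g [^] n) ` {a, b} = \<phi> (g [^] m) ` ?e"
      unfolding k image_image by (intro image_cong refl act_pow_add[OF g]) (use V in blast)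
    moreover have "g [^] m \<in> carrier G" "g [^] Suc k \<in> carrier G" using g by (simp_all del: nat_pow_Suc)
    then have "inj_on (\<phi> (g [^] m)) (verts T)" "?e \<subseteq> verts T" using inj_prop act_closed V by blast+
    ultimately have "?e = {a, b}" using eq V by (metis inj_on_image_eq_iff)
    then show False using moved by blast
  qed
  then show ?thesis by (intro linorder_injI) blast
qed

lemma shifted_edges_distinct:
  assumes g: "g \<in> carrier G" and ab: "{a, b} \<in> edges T" and s: "shifts g a b"
  shows "\<phi> (g [^] Suc k) ` {a, b} \<noteq> {a, b}"
proof
  have gk: "g [^] Suc k \<in> carrier G" using g by (simp del: nat_pow_Suc)
  assume "\<phi> (g [^] Suc k) ` {a, b} = {a, b}"
  then have "\<phi> (g [^] Suc k) a = a \<and> \<phi> (g [^] Suc k) b = b" by (rule edge_fixed[OF gk ab])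
  then have "\<phi> (g [^] Suc k) ` half T a b = half T a b" using half_act[OF gk ab] by simp
  then show False using shifts_pow[OF assms, of k] by (simp del: nat_pow_Suc add: shifts_def)
qed

lemma shifts_pow_subset:
  assumes "g \<in> carrier G" "{a, b} \<in> edges T" "shifts g a b"
  shows "\<phi> (g [^] (n::nat)) ` half T a b \<subseteq> half T a b"
proof (cases n)
  case 0
  then show ?thesis using half_subset_verts[OF assms(2)] act_one by auto
next
  case (Suc k)
  then show ?thesis using shifts_pow[OF assms, of k] by (auto simp del: nat_pow_Suc simp: shifts_def)
qed

text \<open>
  If all positive powers of \<open>g\<close> move an edge and keep some vertex \<open>c\<close> on one side of it, then
  they end up moving every vertex \<open>u\<close> to that side: the exponents for which they do not correspond
  to distinct edges between \<open>u\<close> and \<open>c\<close>.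
\<close>

lemma eventually_in_half:
  assumes g: "g \<in> carrier G" and ab: "{a, b} \<in> edges T"
    and moved: "\<And>k. \<phi> (g [^] Suc k) ` {a, b} \<noteq> {a, b}"
    and c: "c \<in> verts T" "\<And>n::nat. \<phi> (g [^] n) c \<in> half T a b" and u: "u \<in> verts T"
  shows "\<exists>N. \<forall>n\<ge>N. \<phi> (g [^] (n::nat)) u \<in> half T a b"
proof -
  let ?B = "{n::nat. \<phi> (g [^] n) u \<notin> half T a b}"
  let ?f = "\<lambda>n::nat. \<phi> (inv g [^] n) ` {a, b}"
  have V: "{a, b} \<subseteq> verts T" using edge_verts ab by auto
  have "?f ` ?B \<subseteq> sep u c"
  proof
    fix e assume "e \<in> ?f ` ?B"
    then obtain n where n: "e = ?f n" "\<phi> (g [^] n) u \<notin> half T a b" by blast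
    define h where "h = g [^] n"
    have h: "h \<in> carrier G" "inv h \<in> carrier G" using g by (auto simp: h_def)
    have ih: "inv g [^] n = inv h" using g by (simp add: h_def nat_pow_inv)
    have 1: "v \<in> half T (\<phi> (inv h) a) (\<phi> (inv h) b) \<longleftrightarrow> \<phi> h v \<in> half T a b" if "v \<in> verts T" for v
      using half_act_iff[OF h(2) ab, of "\<phi> h v"] that act_closed h act_inv by simp
    have "\<phi> h c \<in> half T a b" using c(2) by (simp add: h_def)
    then have "{\<phi> (inv h) a, \<phi> (inv h) b} \<in> sep u c"
      using sep_iff[OF edge_act[OF h(2) ab] u c(1)] 1[OF u] 1[OF c(1)] n(2) by (simp add: h_def)
    then show "e \<in> sep u c" using n ih by simp
  qed
  then have "finite (?f ` ?B)" using finite_sep[OF u c(1)] by (rule finite_subset)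
  moreover have "\<phi> (inv g [^] Suc k) ` {a, b} \<noteq> {a, b}" for k
  proof
    have gk: "g [^] Suc k \<in> carrier G" using g by (simp del: nat_pow_Suc)
    assume "\<phi> (inv g [^] Suc k) ` {a, b} = {a, b}"
    then have "\<phi> (g [^] Suc k) ` \<phi> (inv (g [^] Suc k)) ` {a, b} = \<phi> (g [^] Suc k) ` {a, b}"
      using nat_pow_inv[OF g, of "Suc k"] by simp
    then show False using act_image_inv[OF gk V] moved[of k] by simp
  qed
  then have "inj_on ?f ?B"
    using edge_orbit_inj[OF inv_closed[OF g] ab] by (blast intro: inj_on_subset)
  ultimately have "finite ?B" using finite_imageD by blast
  then obtain N where "\<forall>n \<in> ?B. n < N" using finite_nat_set_iff_bounded by blast
  then show ?thesis by (intro exI[of _ N]) (auto simp: not_less[symmetric])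
qed

lemma shifts_absorbs:
  assumes g: "g \<in> carrier G" and ab: "{a, b} \<in> edges T" and s: "shifts g a b" and u: "u \<in> verts T"
  shows "\<exists>N. \<forall>n\<ge>N. \<phi> (g [^] (n::nat)) u \<in> half T a b"
proof (rule eventually_in_half[OF g ab shifted_edges_distinct[OF g ab s] _ _ u])
  show "b \<in> verts T" using edge_verts ab by blast
  show "\<phi> (g [^] n) b \<in> half T a b" for n :: nat
    using shifts_pow_subset[OF g ab s, of n] half_self by blast
qed

text \<open>
  An orbit point that has crossed the first \<open>k\<close> translates of the shifted edge is at least \<open>k\<close> away
  from it.
\<close>

lemma shifts_far:
  assumes g: "g \<in> carrier G" and ab: "{a, b} \<in> edges T" and s: "shifts g a b"
    and u: "u \<in> verts T" and c: "c \<in> verts T"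
  shows "\<exists>N. \<forall>n\<ge>N. \<phi> (g [^] (n::nat)) u \<in> half T a b \<and> k \<le> tdist (\<phi> (g [^] n) u) c"
proof -
  have V: "a \<in> verts T" "b \<in> verts T" using edge_verts ab by auto
  obtain N where N: "\<And>n::nat. n \<ge> N \<Longrightarrow> \<phi> (g [^] n) u \<in> half T a b" using shifts_absorbs[OF assms(1-4)] by blast
  let ?K = "k + tdist a c"
  have "k \<le> tdist (\<phi> (g [^] n) u) c" if n: "n \<ge> N + ?K" for n :: nat
  proof -
    let ?w = "\<phi> (g [^] n) u"
    have w: "?w \<in> verts T" using act_closed g u by simp
    have "(\<lambda>i. \<phi> (g [^] i) ` {a, b}) ` {..<?K} \<subseteq> sep a ?w"
    proof
      fix e assume "e \<in> (\<lambda>i. \<phi> (g [^] i) ` {a, b}) ` {..<?K}"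
      then obtain i where i: "i < ?K" "e = {\<phi> (g [^] i) a, \<phi> (g [^] i) b}" by auto
      have gi: "g [^] i \<in> carrier G" using g by simp
      have im: "\<phi> (g [^] i) ` half T a b = half T (\<phi> (g [^] i) a) (\<phi> (g [^] i) b)" by (rule half_act[OF gi ab])
      have "?w = \<phi> (g [^] i) (\<phi> (g [^] (n - i)) u)"
        using act_pow_add[OF g u, of i "n - i"] i n by simp
      then have "?w \<in> half T (\<phi> (g [^] i) a) (\<phi> (g [^] i) b)" using N[of "n - i"] i n im by auto
      moreover have "a \<notin> half T (\<phi> (g [^] i) a) (\<phi> (g [^] i) b)"
        using shifts_pow_subset[OF g ab s, of i] bridge[OF ab] im by blast
      ultimately show "e \<in> sep a ?w" using sep_iff[OF edge_act[OF gi ab] V(1) w] i by simp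
    qed
    then have "card ((\<lambda>i. \<phi> (g [^] i) ` {a, b}) ` {..<?K}) \<le> tdist a ?w"
      unfolding tdist_def by (rule card_mono[OF finite_sep[OF V(1) w]])
    moreover have "card ((\<lambda>i. \<phi> (g [^] i) ` {a, b}) ` {..<?K}) = ?K"
      using edge_orbit_inj[OF g ab shifted_edges_distinct[OF g ab s]]
      by (subst card_image) (auto intro: inj_on_subset)
    moreover have "tdist a ?w \<le> tdist a c + tdist c ?w" using tdist_triangle V w c by blast
    ultimately show ?thesis using tdist_sym[OF w c] by linarith
  qed
  then show ?thesis using N by (intro exI[of _ "N + ?K"]) auto
qed

lemma pow_fixes:
  assumes "g \<in> carrier G" "v \<in> verts T" "\<phi> g v = v" shows "\<phi> (g [^] (n::nat)) v = v"
proof (induction n)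
  case (Suc n)
  then show ?case using act_pow_Suc[OF assms(1,2), of n] assms(3) by simp
qed (simp add: act_one assms)

lemma shifts_no_fixed_vertex:
  assumes g: "g \<in> carrier G" and ab: "{a, b} \<in> edges T" and s: "shifts g a b" and v: "v \<in> verts T"
  shows "\<phi> g v \<noteq> v"
proof
  assume fix1: "\<phi> g v = v"
  then have fix2: "\<phi> (inv g) v = v" using act_inv(1)[OF g v] by simp
  have ba: "{b, a} \<in> edges T" using ab by (simp add: insert_commute)
  have "v \<in> half T a b"
    using shifts_absorbs[OF g ab s v] pow_fixes[OF g v fix1] by auto
  moreover have "v \<in> half T b a"
    using shifts_absorbs[OF inv_closed[OF g] ba shifts_inv[OF g ab s] v] pow_fixes[OF inv_closed[OF g] v fix2] by auto
  ultimately show False using half_disjoint[OF ab] by blast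
qed

text \<open>
  An element without fixed vertex shifts the first edge on the way from \<open>v\<close> to its image, if \<open>v\<close>
  is moved as little as possible: otherwise that edge and its image would both separate \<open>v\<close> from
  its image, and the other end of the edge would be moved less.
\<close>

lemma fixed_point_free_shifts:
  assumes g: "g \<in> carrier G" and nofix: "\<And>v. v \<in> verts T \<Longrightarrow> \<phi> g v \<noteq> v"
  shows "\<exists>a b. {a, b} \<in> edges T \<and> shifts g a b"
proof -
  obtain v where v: "v \<in> verts T" and min: "\<And>w. w \<in> verts T \<Longrightarrow> tdist v (\<phi> g v) \<le> tdist w (\<phi> g w)"
    using ex_has_least_nat[of "\<lambda>v. v \<in> verts T" _ "\<lambda>w. tdist w (\<phi> g w)"] verts_nonempty by blast
  have gv: "\<phi> g v \<in> verts T" using act_closed g v by blast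
  obtain b where vb: "{v, b} \<in> edges T" and gvb: "\<phi> g v \<in> half T v b"
    using first_edge[OF v gv] nofix[OF v] by metis
  have b: "b \<in> verts T" "\<phi> g b \<in> verts T" using edge_verts[OF vb] act_closed g by auto
  have ge: "{\<phi> g v, \<phi> g b} \<in> edges T" by (rule edge_act[OF g vb])
  have ne: "{\<phi> g v, \<phi> g b} \<noteq> {v, b}"
    using no_inversion[OF g vb] nofix[OF v] by (auto simp: doubleton_eq_iff)
  have gb: "\<phi> g b \<in> half T v b" using half_step[OF gvb ge ne] .
  have vn: "v \<notin> half T (\<phi> g v) (\<phi> g b)"
  proof
    assume "v \<in> half T (\<phi> g v) (\<phi> g b)"
    have 1: "{v, b} \<in> sep v (\<phi> g v)" using sep_iff[OF vb v gv] gvb bridge[OF vb] by blast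
    have 2: "{\<phi> g v, \<phi> g b} \<in> sep v (\<phi> g v)"
      using sep_iff[OF ge v gv] \<open>v \<in> half T (\<phi> g v) (\<phi> g b)\<close> bridge[OF ge] by blast
    have "sep v (\<phi> g b) = sep v (\<phi> g v) - {{\<phi> g v, \<phi> g b}}"
      using sep_trans[OF v gv b(2)] sep_edge[OF ge] 2 by auto
    moreover have "sep b v = {{v, b}}" using sep_edge[OF vb] sep_sym v b by simp
    ultimately have "sep b (\<phi> g b) = sep v (\<phi> g v) - {{\<phi> g v, \<phi> g b}} - {{v, b}}"
      using sep_trans[OF b(1) v b(2)] 1 ne by auto
    then have "tdist b (\<phi> g b) < tdist v (\<phi> g v)"
      unfolding tdist_def using 1 finite_sep[OF v gv] by (intro psubset_card_mono) auto
    then show False using min[OF b(1)] by simp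
  qed
  have sub: "half T (\<phi> g v) (\<phi> g b) \<subseteq> half T v b"
    by (rule half_nested[OF vb ge gvb vn])
  have "b \<notin> half T (\<phi> g v) (\<phi> g b)"
    using half_step[of b "\<phi> g v" "\<phi> g b" v] vn vb ne by (auto simp: insert_commute)
  then have "shifts g v b" using sub half_self[of b v] half_act[OF g vb] by (auto simp: shifts_def)
  then show ?thesis using vb by blast
qed

subsection \<open>Minimal invariant subtrees\<close>

text \<open>
  The vertex set of the minimal invariant subtree. As an intersection it is contained in every
  invariant subtree; that it is not empty, if some element has no fixed vertex, is because the axis of
  that element lies in all of them.
\<close>

definition minv where
  "minv A = \<Inter>{C. conv C \<and> C \<noteq> {} \<and> (\<forall>h \<in> A. \<phi> h ` C \<subseteq> C)}"

lemma minv_least: "conv C \<Longrightarrow> C \<noteq> {} \<Longrightarrow> (\<And>h. h \<in> A \<Longrightarrow> \<phi> h ` C \<subseteq> C) \<Longrightarrow> minv A \<subseteq> C"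
  unfolding minv_def by blast

lemma minv_conv: assumes "A \<subseteq> carrier G" shows "conv (minv A)"
  unfolding minv_def
proof (rule conv_Inter)
  have "verts T \<in> {C. conv C \<and> C \<noteq> {} \<and> (\<forall>h\<in>A. \<phi> h ` C \<subseteq> C)}"
    using conv_verts verts_nonempty surj_prop assms by auto
  then show "{C. conv C \<and> C \<noteq> {} \<and> (\<forall>h\<in>A. \<phi> h ` C \<subseteq> C)} \<noteq> {}" by blast
qed simp

lemma minv_verts: "A \<subseteq> carrier G \<Longrightarrow> minv A \<subseteq> verts T"
  using minv_conv by (simp add: conv_def)

lemma minv_invariant: "h \<in> A \<Longrightarrow> \<phi> h ` minv A \<subseteq> minv A"
  unfolding minv_def by blast

lemma minv_mono: "A \<subseteq> B \<Longrightarrow> minv A \<subseteq> minv B"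
  unfolding minv_def by blast

lemma minv_conj:
  assumes g: "g \<in> carrier G" and B: "B \<subseteq> carrier G" and A: "A \<subseteq> carrier G"
    and conj: "\<And>h. h \<in> A \<Longrightarrow> g \<otimes> h \<otimes> inv g \<in> B"
  shows "\<phi> g ` minv A \<subseteq> minv B"
proof -
  have "\<phi> g ` minv A \<subseteq> C" if C: "conv C" "C \<noteq> {}" "\<And>h. h \<in> B \<Longrightarrow> \<phi> h ` C \<subseteq> C" for C
  proof -
    have CV: "C \<subseteq> verts T" using C by (simp add: conv_def)
    have "minv A \<subseteq> \<phi> (inv g) ` C"
    proof (rule minv_least)
      show "conv (\<phi> (inv g) ` C)" using conv_act C g by simp
      show "\<phi> (inv g) ` C \<noteq> {}" using C by simp
      fix h assume h: "h \<in> A"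
      then have hG: "h \<in> carrier G" using A by blast
      have "\<phi> h (\<phi> (inv g) v) \<in> \<phi> (inv g) ` C" if v: "v \<in> C" for v
      proof -
        have "v \<in> verts T" using v CV by blast
        then have "\<phi> h (\<phi> (inv g) v) = \<phi> (inv g) (\<phi> (g \<otimes> h \<otimes> inv g) v)"
          using g hG act_inv act_closed by (simp add: act_mult)
        then show ?thesis using C(3)[OF conj[OF h]] v by blast
      qed
      then show "\<phi> h ` \<phi> (inv g) ` C \<subseteq> \<phi> (inv g) ` C" by blast
    qed
    then have "\<phi> g ` minv A \<subseteq> \<phi> g ` \<phi> (inv g) ` C" by blast
    also have "\<dots> = C" by (rule act_image_inv[OF g CV])
    finally show ?thesis .
  qed
  then show ?thesis unfolding minv_def[of B] by blast
qed

lemma minv_no_edges: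
  assumes "edges T = {}" "A \<subseteq> carrier G" shows "minv A = verts T"
proof -
  have "u = v" if "u \<in> verts T" "v \<in> verts T" for u v
    using sep_nonempty[OF that] sep_subset assms by blast
  then have "C = verts T" if "conv C" "C \<noteq> {}" for C using that by (auto simp: conv_def)
  then show ?thesis
    using conv_verts verts_nonempty surj_prop assms(2) unfolding minv_def by blast
qed

lemma induced_invariant:
  assumes A: "A \<subseteq> carrier G" "\<And>h. h \<in> A \<Longrightarrow> inv h \<in> A"
    and C: "conv C" "C \<noteq> {}" "\<And>h. h \<in> A \<Longrightarrow> \<phi> h ` C \<subseteq> C"
  shows "invariant_subtree T \<phi> A (induced C)"
proof -
  have CV: "C \<subseteq> verts T" using C by (simp add: conv_def)
  have eq: "\<phi> h ` C = C" if h: "h \<in> A" for h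
  proof -
    have hG: "h \<in> carrier G" using h A by blast
    have "C = \<phi> h ` \<phi> (inv h) ` C" by (rule act_image_inv[OF hG CV, symmetric])
    also have "\<dots> \<subseteq> \<phi> h ` C" using C(3)[OF A(2)[OF h]] by blast
    finally show ?thesis using C(3)[OF h] by blast
  qed
  have sub: "(`) (\<phi> h) ` {e \<in> edges T. e \<subseteq> C} \<subseteq> {e \<in> edges T. e \<subseteq> C}" if h: "h \<in> A" for h
    using eq[OF h] edge_image[of h] h A by blast
  have "(`) (\<phi> h) ` {e \<in> edges T. e \<subseteq> C} = {e \<in> edges T. e \<subseteq> C}" if h: "h \<in> A" for h
  proof
    have hG: "h \<in> carrier G" using h A by blast
    show "{e \<in> edges T. e \<subseteq> C} \<subseteq> (`) (\<phi> h) ` {e \<in> edges T. e \<subseteq> C}"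
    proof
      fix e assume e: "e \<in> {e \<in> edges T. e \<subseteq> C}"
      then have "\<phi> (inv h) ` e \<in> {e \<in> edges T. e \<subseteq> C}" using sub[OF A(2)[OF h]] by blast
      moreover have "\<phi> h ` \<phi> (inv h) ` e = e" using e edge_subset by (intro act_image_inv[OF hG]) blast
      ultimately show "e \<in> (`) (\<phi> h) ` {e \<in> edges T. e \<subseteq> C}"
        using image_eqI[of e "(`) (\<phi> h)" "\<phi> (inv h) ` e"] by simp
    qed
  qed (rule sub[OF h])
  then show ?thesis using induced_tree[OF C(1,2)] CV eq by (auto simp: invariant_subtree_def)
qed

text \<open>
  Every invariant subtree contains the one on \<open>minv A\<close>, so that one is the unique minimal one.
\<close>

lemma minimal_subtree_eq:
  assumes A: "A \<subseteq> carrier G" "\<And>h. h \<in> A \<Longrightarrow> inv h \<in> A" and ne: "minv A \<noteq> {}"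
  shows "minimal_subtree T \<phi> A = induced (minv A)"
proof -
  have conv_S: "conv (verts S) \<and> verts S \<noteq> {} \<and> S = induced (verts S) \<and> minv A \<subseteq> verts S"
    if "invariant_subtree T \<phi> A S" for S
    using subtree_conv[of S] minv_least[of "verts S" A] that
    unfolding invariant_subtree_def by blast
  have 1: "invariant_subtree T \<phi> A (induced (minv A))"
    using induced_invariant[OF A minv_conv[OF A(1)] ne] minv_invariant by blast
  show ?thesis
    unfolding minimal_subtree_def
  proof (rule the_equality)
    show "invariant_subtree T \<phi> A (induced (minv A)) \<and>
        (\<forall>S'. invariant_subtree T \<phi> A S' \<and> verts S' \<subseteq> verts (induced (minv A)) \<and>
          edges S' \<subseteq> edges (induced (minv A)) \<longrightarrow> S' = induced (minv A))"
    proof (intro conjI 1 allI impI)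
      fix S' assume S': "invariant_subtree T \<phi> A S' \<and> verts S' \<subseteq> verts (induced (minv A)) \<and>
          edges S' \<subseteq> edges (induced (minv A))"
      then have "verts S' = minv A" using conv_S[of S'] by auto
      then show "S' = induced (minv A)" using conv_S[of S'] S' by simp
    qed
  next
    fix S assume S: "invariant_subtree T \<phi> A S \<and>
        (\<forall>S'. invariant_subtree T \<phi> A S' \<and> verts S' \<subseteq> verts S \<and> edges S' \<subseteq> edges S \<longrightarrow> S' = S)"
    then have S': "S = induced (verts S)" "minv A \<subseteq> verts S" using conv_S by blast+
    have "edges (induced (minv A)) \<subseteq> edges (induced (verts S))" using S'(2) by auto
    then have "edges (induced (minv A)) \<subseteq> edges S" using S'(1) by metis
    then have "induced (minv A) = S" using S S'(2) 1 by (metis induced_simps(1))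
    then show "S = induced (minv A)" by simp
  qed
qed

lemma minimal_action_minv:
  assumes "minimal_action G T \<phi>" shows "minv (carrier G) = verts T"
proof -
  have "C = verts T" if "conv C" "C \<noteq> {}" "\<And>h. h \<in> carrier G \<Longrightarrow> \<phi> h ` C \<subseteq> C" for C
  proof -
    have "induced C = T"
      using assms induced_invariant[OF _ _ that] by (simp add: minimal_action_def)
    then show ?thesis by (metis induced_simps(1))
  qed
  then show ?thesis
    using conv_verts verts_nonempty surj_prop unfolding minv_def by blast
qed

text \<open>
  Each of the two edges lies on one side of the other; the four combinations are the four cases.
\<close>

lemma edge_trichotomy:
  assumes ab: "{a, b} \<in> edges T" and cd: "{c, d} \<in> edges T" and ne: "{a, b} \<noteq> {c, d}"
  shows "half T a b \<subseteq> half T c d \<or> half T c d \<subseteq> half T a b \<or> half T a b \<inter> half T c d = {} \<or>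
    half T a b \<union> half T c d = verts T"
proof -
  have ba: "{b, a} \<in> edges T" and dc: "{d, c} \<in> edges T" using ab cd by (auto simp: insert_commute)
  have V: "a \<in> verts T" "b \<in> verts T" "c \<in> verts T" "d \<in> verts T" using edge_verts ab cd by auto
  have cd_side: "c \<in> half T a b \<longleftrightarrow> d \<in> half T a b"
    using half_step[of c a b d] half_step[of d a b c] cd dc ne by (auto simp: insert_commute)
  have ab_side: "a \<in> half T c d \<longleftrightarrow> b \<in> half T c d"
    using half_step[of a c d b] half_step[of b c d a] ab ba ne by (auto simp: insert_commute)
  consider "c \<in> half T a b" "a \<notin> half T c d" | "c \<in> half T a b" "a \<in> half T c d"
    | "c \<notin> half T a b" "a \<in> half T c d" | "c \<notin> half T a b" "a \<notin> half T c d" by blast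
  then show ?thesis
  proof cases
    case 1
    then show ?thesis using half_nested[OF ab cd] by blast
  next
    case 2
    then have "half T d c \<subseteq> half T a b"
      using half_nested[OF ab dc] cd_side half_disjoint[OF cd] by blast
    then show ?thesis using half_cover[OF cd] half_subset_verts[OF ab] by blast
  next
    case 3
    then show ?thesis using half_nested[OF cd ab] by blast
  next
    case 4
    then have "half T c d \<subseteq> half T b a"
      using half_nested[OF ba cd] ab_side half_compl[OF ab V(3)] by blast
    then show ?thesis using half_disjoint[OF ab] by blast
  qed
qed

lemma half_eq_imp:
  assumes "{a, b} \<in> edges T" "{c, d} \<in> edges T" "half T a b = half T c d"
  shows "a = c \<and> b = d"
proof -
  have "{b, a} \<in> edges T" using assms by (simp add: insert_commute)
  then show ?thesis
    using half_crossing[OF assms(2), of b a] half_self[of b a] bridge[OF assms(1)] assms(3) by blast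
qed

text \<open>
  The side of \<open>b\<close> of \<open>{a, b}\<close> and its image under \<open>h\<close> may be nested, and then \<open>{a, b}\<close> is shifted,
  or disjoint. They cannot cover the tree, as the axis of \<open>h\<close> meets the side of \<open>a\<close>.
\<close>

lemma shifts_or_disjoint:
  assumes h: "h \<in> carrier G" and cd: "{c, d} \<in> edges T" and s: "shifts h c d"
    and ab: "{a, b} \<in> edges T" and d: "d \<notin> half T a b"
  shows "shifts h a b \<or> shifts h b a \<or> \<phi> h ` half T a b \<inter> half T a b = {}"
proof -
  have ba: "{b, a} \<in> edges T" and dc: "{d, c} \<in> edges T" using ab cd by (auto simp: insert_commute)
  have V: "a \<in> verts T" "b \<in> verts T" "c \<in> verts T" "d \<in> verts T" using edge_verts ab cd by auto
  let ?A = "half T (\<phi> h a) (\<phi> h b)"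
  have A: "\<phi> h ` half T a b = ?A" by (rule half_act[OF h ab])
  have e: "{\<phi> h a, \<phi> h b} \<in> edges T" by (rule edge_act[OF h ab])
  have ne: "?A \<noteq> half T a b"
    using half_eq_imp[OF e ab] shifts_no_fixed_vertex[OF h cd s V(1)] by blast
  have ne': "{a, b} \<noteq> {\<phi> h a, \<phi> h b}"
    using edge_fixed[OF h ab] shifts_no_fixed_vertex[OF h cd s V(1)] by auto
  have hd_n: "\<phi> h d \<notin> ?A" using half_act_iff[OF h ab V(4)] d by simp
  have hdV: "\<phi> h d \<in> verts T" using act_closed h V by blast
  from edge_trichotomy[OF ab e ne'] consider
      "half T a b \<subset> ?A" | "?A \<subset> half T a b" | "half T a b \<inter> ?A = {}" | "half T a b \<union> ?A = verts T"
    using ne by blast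
  then show ?thesis
  proof cases
    case 1
    have "shifts h b a" unfolding shifts_def
    proof -
      have B: "\<phi> h ` half T b a = half T (\<phi> h b) (\<phi> h a)" by (rule half_act[OF h ba])
      have "half T (\<phi> h b) (\<phi> h a) = verts T - ?A"
        using half_cover[OF e] half_disjoint[OF e] by blast
      moreover have "half T b a = verts T - half T a b"
        using half_cover[OF ab] half_disjoint[OF ab] by blast
      moreover have "?A \<subseteq> verts T" using half_subset_verts e by blast
      ultimately show "\<phi> h ` half T b a \<subset> half T b a" using 1 B by blast
    qed
    then show ?thesis by blast
  next
    case 2
    then show ?thesis using A by (simp add: shifts_def)
  next
    case 3
    then show ?thesis using A by blast
  next
    case 4
    \<comment> \<open>Then \<open>d\<close> would lie strictly between \<open>inv h d\<close> and \<open>h d\<close>, both of which are on the side of \<open>b\<close>.\<close>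
    define u where "u = \<phi> (inv h) d"
    have u: "u \<in> verts T" "\<phi> h u = d" using h V act_closed act_inv by (auto simp: u_def)
    have "\<phi> h d \<in> half T a b" using 4 hd_n hdV by blast
    moreover have "u \<in> half T a b" using 4 d V half_act_iff[OF h ab u(1)] u(2) by blast
    moreover have "{c, d} \<in> sep u (\<phi> h d)"
    proof -
      have hcd: "{\<phi> h c, \<phi> h d} \<in> edges T" by (rule edge_act[OF h cd])
      have C: "half T (\<phi> h c) (\<phi> h d) \<subset> half T c d"
        using s half_act[OF h cd] by (simp add: shifts_def)
      have "d \<notin> half T (\<phi> h c) (\<phi> h d)"
      proof
        assume "d \<in> half T (\<phi> h c) (\<phi> h d)"
        moreover have "c \<notin> half T (\<phi> h c) (\<phi> h d)" using C bridge[OF cd] by blast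
        ultimately have "d = \<phi> h d" using half_crossing[OF hcd dc] by simp
        then show False using shifts_no_fixed_vertex[OF h cd s V(4)] by simp
      qed
      then have "u \<notin> half T c d" using half_act_iff[OF h cd u(1)] u(2) by simp
      moreover have "\<phi> h d \<in> half T c d" using C half_self by blast
      ultimately show ?thesis using sep_iff[OF cd u(1) hdV] by simp
    qed
    ultimately have "d \<in> half T a b" using convD[OF conv_half[OF ab]] by blast
    then show ?thesis using d by blast
  qed
qed

text \<open>
  Otherwise the convex hull of the orbit would be an invariant subtree that does not contain the edge.
\<close>

lemma orbit_meets_half:
  assumes A: "subgroup A G" and ab: "{a, b} \<in> edges T" "a \<in> minv A" "b \<in> minv A" and v: "v \<in> verts T"
  shows "\<exists>k \<in> A. \<phi> k v \<in> half T a b"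
proof (rule ccontr)
  assume no: "\<not> (\<exists>k \<in> A. \<phi> k v \<in> half T a b)"
  have AG: "A \<subseteq> carrier G" using A by (rule subgroup.subset)
  have ba: "{b, a} \<in> edges T" using ab by (simp add: insert_commute)
  let ?O = "(\<lambda>k. \<phi> k v) ` A"
  have OV: "?O \<subseteq> verts T" using AG act_closed v by blast
  define Hu where "Hu = \<Inter>{C. conv C \<and> ?O \<subseteq> C}"
  have HuO: "?O \<subseteq> Hu" by (auto simp: Hu_def)
  have "conv Hu" unfolding Hu_def by (rule conv_Inter) (use conv_verts OV in auto)
  moreover have "Hu \<noteq> {}" using HuO subgroup.one_closed[OF A] by blast
  moreover have "\<phi> h ` Hu \<subseteq> Hu" if h: "h \<in> A" for h
  proof -
    have hG: "h \<in> carrier G" using h AG by blast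
    have "\<phi> h ` Hu \<subseteq> C" if C: "conv C" "?O \<subseteq> C" for C
    proof -
      have "?O \<subseteq> \<phi> (inv h) ` C"
      proof
        fix x assume "x \<in> ?O"
        then obtain k where k: "k \<in> A" "x = \<phi> k v" by blast
        then have "h \<otimes> k \<in> A" using h A by (simp add: subgroup.m_closed)
        moreover have "k \<in> carrier G" using k AG by blast
        ultimately have "\<phi> h x \<in> C" using C k act_mult[OF hG _ v, of k] by (metis image_eqI subsetD)
        moreover have "x = \<phi> (inv h) (\<phi> h x)" using k OV act_inv[OF hG] by auto
        ultimately show "x \<in> \<phi> (inv h) ` C" by blast
      qed
      then have "Hu \<subseteq> \<phi> (inv h) ` C" using conv_act[OF inv_closed[OF hG] C(1)] by (auto simp: Hu_def)
      moreover have "\<phi> h ` \<phi> (inv h) ` C = C"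
        using C(1) by (intro act_image_inv[OF hG]) (simp add: conv_def)
      ultimately show ?thesis by blast
    qed
    then show ?thesis by (auto simp: Hu_def)
  qed
  ultimately have "minv A \<subseteq> Hu" by (rule minv_least)
  moreover have "?O \<subseteq> half T b a" using no OV half_compl[OF ab(1)] by blast
  then have "Hu \<subseteq> half T b a" using conv_half[OF ba] by (auto simp: Hu_def)
  ultimately show False using ab bridge[OF ba] by blast
qed

lemma shifts_conj:
  assumes k: "k \<in> carrier G" and h: "h \<in> carrier G" and ab: "{a, b} \<in> edges T" and s: "shifts h a b"
  shows "shifts (k \<otimes> h \<otimes> inv k) (\<phi> k a) (\<phi> k b)"
proof -
  let ?H = "half T a b"
  have V: "?H \<subseteq> verts T" by (rule half_subset_verts[OF ab])
  have "\<phi> (k \<otimes> h \<otimes> inv k) ` \<phi> k ` ?H = \<phi> k ` \<phi> h ` ?H"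
    unfolding image_image using V k h act_closed act_inv
    by (intro image_cong refl) (auto simp: act_mult subset_iff)
  also have "\<dots> \<subset> \<phi> k ` ?H"
    using s V unfolding shifts_def by (rule act_image_psubset[OF k])
  finally show ?thesis by (simp add: shifts_def half_act[OF k ab])
qed

text \<open>
  Every edge of a minimal invariant subtree lies on the axis of some element. Every orbit meets both
  sides of \<open>{a, b}\<close>, so conjugates of \<open>h\<close> shift edges on either side. If the axes of two such
  conjugates \<open>h1\<close> and \<open>h2\<close> do not cross \<open>{a, b}\<close>, then \<open>h1\<close> maps the side of \<open>b\<close> into the side of
  \<open>a\<close>, and \<open>h2\<close> maps the side of \<open>a\<close> into the side of \<open>b\<close>, so their product shifts \<open>{a, b}\<close>.
\<close>

lemma minv_edge_shifted:
  assumes A: "subgroup A G" and h: "h \<in> A" "\<And>v. v \<in> verts T \<Longrightarrow> \<phi> h v \<noteq> v"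
    and ab: "{a, b} \<in> edges T" "a \<in> minv A" "b \<in> minv A"
  shows "\<exists>g \<in> A. shifts g a b"
proof -
  have AG: "A \<subseteq> carrier G" using A by (rule subgroup.subset)
  have hG: "h \<in> carrier G" using h AG by blast
  have ba: "{b, a} \<in> edges T" using ab by (simp add: insert_commute)
  obtain c d where cd: "{c, d} \<in> edges T" "shifts h c d"
    using fixed_point_free_shifts[OF hG h(2)] by blast
  have d: "d \<in> verts T" using edge_verts cd by blast
  have ax: "\<exists>h' \<in> A. \<exists>c' d'. {c', d'} \<in> edges T \<and> shifts h' c' d' \<and> d' \<in> half T x y"
    if xy: "{x, y} \<in> edges T" "x \<in> minv A" "y \<in> minv A" for x y
  proof -
    obtain k where k: "k \<in> A" "\<phi> k d \<in> half T x y" using orbit_meets_half[OF A xy d] by blast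
    have "k \<in> carrier G" using k AG by blast
    moreover have "k \<otimes> h \<otimes> inv k \<in> A"
      using k h A by (simp add: subgroup.m_closed subgroup.m_inv_closed)
    ultimately show ?thesis using shifts_conj[OF _ hG cd] edge_act[OF _ cd(1)] k by blast
  qed
  obtain h1 c1 d1 where 1: "h1 \<in> A" "{c1, d1} \<in> edges T" "shifts h1 c1 d1" "d1 \<in> half T b a"
    using ax[OF ba ab(3,2)] by blast
  obtain h2 c2 d2 where 2: "h2 \<in> A" "{c2, d2} \<in> edges T" "shifts h2 c2 d2" "d2 \<in> half T a b"
    using ax[OF ab] by blast
  have G: "h1 \<in> carrier G" "h2 \<in> carrier G" using 1 2 AG by auto
  have "d1 \<notin> half T a b" "d2 \<notin> half T b a" using 1 2 half_disjoint[OF ab(1)] by blast+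
  then have alt1: "shifts h1 a b \<or> shifts h1 b a \<or> \<phi> h1 ` half T a b \<inter> half T a b = {}"
    and alt2: "shifts h2 b a \<or> shifts h2 a b \<or> \<phi> h2 ` half T b a \<inter> half T b a = {}"
    using shifts_or_disjoint G 1 2 ab ba by blast+
  show ?thesis
  proof (cases "\<exists>g \<in> {h1, h2}. shifts g a b \<or> shifts g b a")
    case True
    then show ?thesis using shifts_inv[OF _ ba] G 1 2 A by (auto intro: subgroup.m_inv_closed)
  next
    case False
    let ?P = "half T a b" and ?N = "half T b a"
    have V: "?P \<subseteq> verts T" "?N \<subseteq> verts T" using half_subset_verts ab ba by blast+
    have 11: "\<phi> h1 ` ?P \<subseteq> ?N"
      using alt1 False V act_closed[OF G(1)] half_compl[OF ab(1)] by blast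
    have 22: "\<phi> h2 ` ?N \<subseteq> ?P"
      using alt2 False V act_closed[OF G(2)] half_compl[OF ab(1)] by blast
    have "\<phi> h1 ` ?P \<noteq> ?N"
    proof
      assume "\<phi> h1 ` ?P = ?N"
      then have "half T (\<phi> h1 a) (\<phi> h1 b) = half T b a" using half_act[OF G(1) ab(1)] by simp
      then have "\<phi> h1 a = b \<and> \<phi> h1 b = a" using half_eq_imp[OF edge_act[OF G(1) ab(1)] ba] by blast
      then show False using no_inversion[OF G(1) ab(1)] by blast
    qed
    then have "\<phi> h2 ` \<phi> h1 ` ?P \<subset> \<phi> h2 ` ?N"
      using 11 V by (intro act_image_psubset[OF G(2)]) auto
    moreover have "\<phi> (h2 \<otimes> h1) ` ?P = \<phi> h2 ` \<phi> h1 ` ?P"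
      unfolding image_image using V G by (intro image_cong refl) (auto simp: act_mult subset_iff)
    ultimately have "shifts (h2 \<otimes> h1) a b" using 22 by (auto simp: shifts_def)
    then show ?thesis using A 1 2 by (auto intro: subgroup.m_closed)
  qed
qed

lemma shifted_edge_in_invariant:
  assumes g: "g \<in> carrier G" and ab: "{a, b} \<in> edges T" and s: "shifts g a b"
    and C: "conv C" "C \<noteq> {}" "\<phi> g ` C \<subseteq> C" "\<phi> (inv g) ` C \<subseteq> C"
  shows "a \<in> C \<and> b \<in> C"
proof -
  obtain v where v: "v \<in> C" using C by blast
  have V: "C \<subseteq> verts T" using C by (simp add: conv_def)
  have ba: "{b, a} \<in> edges T" using ab by (simp add: insert_commute)
  have pow: "\<phi> (h [^] (n::nat)) v \<in> C" if "h \<in> carrier G" "\<phi> h ` C \<subseteq> C" for h n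
  proof (induction n)
    case (Suc n)
    have "v \<in> verts T" using v V by blast
    then show ?case using Suc act_pow_Suc[OF that(1), of v n] that(2) by auto
  qed (use v V act_one in auto)
  obtain m :: nat where m: "\<phi> (g [^] m) v \<in> half T a b"
    using shifts_absorbs[OF g ab s, of v] v V by auto
  obtain n :: nat where n: "\<phi> (inv g [^] n) v \<in> half T b a"
    using shifts_absorbs[OF inv_closed[OF g] ba shifts_inv[OF g ab s], of v] v V by auto
  have "{a, b} \<in> sep (\<phi> (inv g [^] n) v) (\<phi> (g [^] m) v)"
    using m n ab unfolding sep_def by blast
  then show ?thesis using convD[OF C(1)] pow[OF g C(3)] pow[OF inv_closed[OF g] C(4)] by blast
qed

lemma minv_edge_ex:
  assumes A: "subgroup A G" and h: "h \<in> A" "\<And>v. v \<in> verts T \<Longrightarrow> \<phi> h v \<noteq> v"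
  shows "\<exists>a b. {a, b} \<in> edges T \<and> a \<in> minv A \<and> b \<in> minv A"
proof -
  have hG: "h \<in> carrier G" using h subgroup.subset[OF A] by blast
  obtain a b where ab: "{a, b} \<in> edges T" "shifts h a b"
    using fixed_point_free_shifts[OF hG h(2)] by blast
  have "inv h \<in> A" using A h by (simp add: subgroup.m_inv_closed)
  then have "a \<in> minv A \<and> b \<in> minv A"
    using shifted_edge_in_invariant[OF hG ab] h(1) unfolding minv_def by blast
  then show ?thesis using ab by blast
qed

lemma conv_neighbour:
  assumes C: "conv C" and "v \<in> C" "w \<in> C" "v \<noteq> w"
  shows "\<exists>x. {v, x} \<in> edges T \<and> x \<in> C"
proof -
  have V: "v \<in> verts T" "w \<in> verts T" using assms by (auto simp: conv_def)
  obtain x where x: "{v, x} \<in> edges T" "w \<in> half T v x" using first_edge[OF V] assms by blast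
  then have "{v, x} \<in> sep v w" using sep_def half_self by blast
  then show ?thesis using convD[OF C assms(2,3)] x by blast
qed

end

section \<open>Points and stabilizers\<close>

definition supp :: "('v \<Rightarrow> real) \<Rightarrow> 'v set" where
  "supp x = {v. x v \<noteq> 0}"

lemma supp_simplex: "x \<in> points T \<Longrightarrow> supp x \<in> simplices T"
  by (simp add: points_def supp_def)

context stree
begin

lemma simplexE:
  assumes "\<sigma> \<in> simplices T"
  obtains v where "v \<in> verts T" "\<sigma> = {v}" | a b where "{a, b} \<in> edges T" "a \<noteq> b" "\<sigma> = {a, b}"
  using assms unfolding simplices_def by (metis UnE edgeE imageE)

lemma simplex_facts:
  assumes "\<sigma> \<in> simplices T" shows "\<sigma> \<subseteq> verts T" "\<sigma> \<noteq> {}" "finite \<sigma>"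
  using assms edge_verts by (auto elim!: simplexE)

lemma supp_facts:
  assumes "x \<in> points T" shows "supp x \<subseteq> verts T" "supp x \<noteq> {}" "finite (supp x)"
  using simplex_facts supp_simplex[OF assms] by auto

end

context tree_action
begin

lemma simplex_act: "g \<in> carrier G \<Longrightarrow> \<sigma> \<in> simplices T \<Longrightarrow> \<phi> g ` \<sigma> \<in> simplices T"
  using act_closed edge_image by (auto simp: simplices_def)

lemma simplex_fixed:
  assumes g: "g \<in> carrier G" and s: "\<sigma> \<in> simplices T" and im: "\<phi> g ` \<sigma> = \<sigma>" and v: "v \<in> \<sigma>"
  shows "\<phi> g v = v"
  using s
proof (cases rule: simplexE)
  case (2 a b)
  then show ?thesis using edge_fixed[OF g, of a b] im v by auto
qed (use im v in auto)

lemma supp_real_act: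
  assumes g: "g \<in> carrier G" and x: "x \<in> points T"
  shows "supp (real_act G T \<phi> g x) = \<phi> g ` supp x"
proof -
  have S: "supp x \<subseteq> verts T" using supp_facts[OF x] by blast
  have "w \<in> \<phi> g ` supp x" if w: "w \<in> verts T" "\<phi> (inv g) w \<in> supp x" for w
    using act_inv(2)[OF g w(1)] w(2) by (metis imageI)
  moreover have "\<phi> (inv g) (\<phi> g v) \<in> supp x" "\<phi> g v \<in> verts T" if "v \<in> supp x" for v
    using that S act_inv(1)[OF g] act_closed[OF g] by auto
  ultimately show ?thesis
    using x by (auto simp: real_act_def supp_def split: if_splits)
qed

lemma real_act_points:
  assumes g: "g \<in> carrier G" and x: "x \<in> points T"
  shows "real_act G T \<phi> g x \<in> points T"
proof -
  let ?y = "real_act G T \<phi> g x"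
  have S: "supp x \<subseteq> verts T" using supp_facts[OF x] by blast
  have "supp ?y \<in> simplices T"
    using supp_real_act[OF assms] simplex_act[OF g supp_simplex[OF x]] by simp
  moreover have "0 \<le> ?y v" for v using x by (simp add: real_act_def points_def)
  moreover have "(\<Sum>v \<in> supp ?y. ?y v) = 1"
  proof -
    have "(\<Sum>v \<in> supp ?y. ?y v) = (\<Sum>v \<in> supp x. ?y (\<phi> g v))"
      unfolding supp_real_act[OF assms] using inj_on_subset[OF inj_prop[OF g] S]
      by (simp add: sum.reindex)
    also have "\<dots> = (\<Sum>v \<in> supp x. x v)"
      using S x act_inv(1)[OF g] act_closed[OF g] by (intro sum.cong) (auto simp: real_act_def)
    finally show ?thesis using x by (simp add: points_def supp_def)
  qed
  ultimately show ?thesis by (simp add: points_def supp_def)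
qed

lemma real_act_fixes_iff:
  assumes g: "g \<in> carrier G" and x: "x \<in> points T"
  shows "real_act G T \<phi> g x = x \<longleftrightarrow> (\<forall>v \<in> supp x. \<phi> g v = v)"
proof
  assume "real_act G T \<phi> g x = x"
  then show "\<forall>v \<in> supp x. \<phi> g v = v"
    using supp_real_act[OF assms] simplex_fixed[OF g supp_simplex[OF x]] by auto
next
  assume fixed: "\<forall>v \<in> supp x. \<phi> g v = v"
  have S: "supp x \<subseteq> verts T" using supp_facts[OF x] by blast
  have "x (\<phi> (inv g) w) = x w" if w: "w \<in> verts T" for w
  proof (cases "w \<in> supp x")
    case True
    then have "\<phi> (inv g) w = w" using fixed act_inv(1)[OF g w] by simp
    then show ?thesis by simp
  next
    case False
    then have "\<phi> (inv g) w \<notin> supp x" using fixed act_inv(2)[OF g w] by metis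
    then show ?thesis using False by (simp add: supp_def)
  qed
  moreover have "x w = 0" if "w \<notin> verts T" for w using that S by (auto simp: supp_def)
  ultimately show "real_act G T \<phi> g x = x" using x by (auto simp: real_act_def)
qed

lemma acts_trivially_iff:
  assumes "H \<subseteq> carrier G"
  shows "acts_trivially G T \<phi> H \<longleftrightarrow> (\<forall>h \<in> H. \<exists>v \<in> verts T. \<phi> h v = v)"
proof -
  have "(\<exists>x \<in> points T. real_act G T \<phi> h x = x) \<longleftrightarrow> (\<exists>v \<in> verts T. \<phi> h v = v)" if h: "h \<in> carrier G" for h
  proof
    assume "\<exists>x \<in> points T. real_act G T \<phi> h x = x"
    then show "\<exists>v \<in> verts T. \<phi> h v = v"
      using real_act_fixes_iff[OF h] supp_facts by (metis all_not_in_conv in_mono)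
  next
    assume "\<exists>v \<in> verts T. \<phi> h v = v"
    then obtain v where v: "v \<in> verts T" "\<phi> h v = v" by blast
    have "supp (indicator {v}) = {v}" by (auto simp: supp_def indicator_def)
    then show "\<exists>x \<in> points T. real_act G T \<phi> h x = x"
      using real_act_fixes_iff[OF h indicator_points[OF v(1)]] indicator_points[OF v(1)] v by auto
  qed
  then show ?thesis using assms unfolding acts_trivially_def by blast
qed

text \<open>
  Since there are no inversions, these pointwise stabilizers are at the same time the stabilizers
  of points (\<open>point_stab_eq\<close>) and of edges (\<open>edge_stab_eq\<close>).
\<close>

definition fixer where "fixer \<sigma> = {g \<in> carrier G. \<forall>v \<in> \<sigma>. \<phi> g v = v}"

lemma fixer_subset: "fixer \<sigma> \<subseteq> carrier G"
  by (auto simp: fixer_def)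

lemma fixer_mono: "\<sigma> \<subseteq> \<tau> \<Longrightarrow> fixer \<tau> \<subseteq> fixer \<sigma>"
  by (auto simp: fixer_def)

lemma subgroup_fixer: assumes "\<sigma> \<subseteq> verts T" shows "subgroup (fixer \<sigma>) G"
proof
  show "x \<otimes> y \<in> fixer \<sigma>" if "x \<in> fixer \<sigma>" "y \<in> fixer \<sigma>" for x y
    using that assms act_mult by (auto simp: fixer_def subset_iff)
  show "\<one> \<in> fixer \<sigma>" using assms act_one by (auto simp: fixer_def)
  show "inv x \<in> fixer \<sigma>" if "x \<in> fixer \<sigma>" for x
  proof -
    have "\<phi> (inv x) v = v" if "v \<in> \<sigma>" for v
      using act_inv(1)[of x v] \<open>x \<in> fixer \<sigma>\<close> that assms by (auto simp: fixer_def)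
    then show ?thesis using that by (auto simp: fixer_def)
  qed
qed (auto simp: fixer_def)

lemma point_stab_eq: "x \<in> points T \<Longrightarrow> point_stab G T \<phi> x = fixer (supp x)"
  using real_act_fixes_iff by (auto simp: stabilizer_def fixer_def)

lemma edge_stab_eq: "e \<in> edges T \<Longrightarrow> edge_stab G \<phi> e = fixer e"
  using simplex_fixed[of _ e] by (force simp: stabilizer_def fixer_def simplices_def)

lemma fixer_conj:
  assumes g: "g \<in> carrier G" and s: "\<sigma> \<subseteq> verts T" and h: "h \<in> fixer \<sigma>"
  shows "g \<otimes> h \<otimes> inv g \<in> fixer (\<phi> g ` \<sigma>)"
proof -
  have hG: "h \<in> carrier G" using h by (simp add: fixer_def)
  have "\<phi> (g \<otimes> h \<otimes> inv g) (\<phi> g v) = \<phi> g v" if "v \<in> \<sigma>" for v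
    using that s h g hG act_closed act_inv by (auto simp: fixer_def act_mult subset_iff)
  then show ?thesis using g hG by (auto simp: fixer_def)
qed

end

section \<open>Quotients of graphs that are trees\<close>

definition cls :: "('x \<times> 'x) set \<Rightarrow> 'x \<Rightarrow> 'x set" where
  "cls R x = R\<^sup>* `` {x}"

lemma cls_self: "x \<in> cls R x"
  by (simp add: cls_def)

lemma cls_eq_iff: assumes "sym R" shows "cls R x = cls R y \<longleftrightarrow> (x, y) \<in> R\<^sup>*"
proof
  assume "cls R x = cls R y"
  then have "y \<in> cls R x" using cls_self[of y R] by simp
  then show "(x, y) \<in> R\<^sup>*" by (simp add: cls_def)
next
  assume "(x, y) \<in> R\<^sup>*"
  then show "cls R x = cls R y"
    unfolding cls_def using rtrancl_sym_swap[OF assms] by (auto intro: rtrancl_trans)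
qed

lemma invariant_on_cls:
  assumes "\<And>u v. (u, v) \<in> R \<Longrightarrow> s u = s v" "(x, y) \<in> R\<^sup>*" shows "s x = s y"
  using assms(2,1) by (induction rule: rtrancl_induct) auto

definition quot_graph :: "'x set \<Rightarrow> ('x \<times> 'x) set \<Rightarrow> ('x \<times> 'x) set \<Rightarrow> 'x set sgraph" where
  "quot_graph X R D = \<lparr>verts = cls R ` X, edges = {{cls R x, cls R y} | x y. (x, y) \<in> D}\<rparr>"

lemma quot_graph_simps [simp]:
  "verts (quot_graph X R D) = cls R ` X"
  "edges (quot_graph X R D) = {{cls R x, cls R y} | x y. (x, y) \<in> D}"
  by (simp_all add: quot_graph_def)

lemma adj_quot_graph: "sym D \<Longrightarrow> adj (quot_graph X R D) = {(cls R x, cls R y) | x y. (x, y) \<in> D}"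
  by (auto simp: adj_def doubleton_eq_iff dest: symD)

text \<open>
  A connected graph with vertex set \<open>X\<close> has two kinds of edges: the edges in \<open>R\<close> are contracted and
  the edges in \<open>D\<close> are kept. The quotient is a tree if every kept edge becomes a bridge, that is, if
  there is a two-colouring \<open>s\<close> of \<open>X\<close> that only changes across kept edges that are identified with it.
\<close>

locale tree_quotient =
  fixes X :: "'x set" and R D :: "('x \<times> 'x) set"
  assumes nonempty: "X \<noteq> {}" and RX: "R \<subseteq> X \<times> X" and DX: "D \<subseteq> X \<times> X"
    and symR: "sym R" and symD: "sym D"
    and conn: "\<And>x y. x \<in> X \<Longrightarrow> y \<in> X \<Longrightarrow> (x, y) \<in> (R \<union> D)\<^sup>*"
    and side: "\<And>x y. (x, y) \<in> D \<Longrightarrow> \<exists>s. s x \<and> \<not> s y \<and> (\<forall>u v. (u, v) \<in> R \<longrightarrow> s u = s v) \<and>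
      (\<forall>u v. (u, v) \<in> D \<longrightarrow> s u \<noteq> s v \<longrightarrow> {cls R u, cls R v} = {cls R x, cls R y})"
begin

lemma cls_distinct: assumes "(x, y) \<in> D" shows "cls R x \<noteq> cls R y"
proof
  obtain s where s: "s x" "\<not> s y" "\<And>u v. (u, v) \<in> R \<Longrightarrow> s u = s v" using side[OF assms] by blast
  assume "cls R x = cls R y"
  then show False using invariant_on_cls[of R s x y] cls_eq_iff[OF symR] s by blast
qed

lemma simplicial_tree_quot: "simplicial_tree (quot_graph X R D)"
proof (rule simplicial_treeI)
  show "verts (quot_graph X R D) \<noteq> {}" using nonempty by simp
  show "e \<subseteq> verts (quot_graph X R D) \<and> card e = 2" if "e \<in> edges (quot_graph X R D)" for e
    using that DX cls_distinct by auto
  show "(u, v) \<in> (adj (quot_graph X R D))\<^sup>*"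
    if uv: "u \<in> verts (quot_graph X R D)" "v \<in> verts (quot_graph X R D)" for u v
  proof -
    obtain x y where xy: "x \<in> X" "y \<in> X" "u = cls R x" "v = cls R y" using uv by auto
    from conn[OF xy(1,2)] have "(cls R x, cls R y) \<in> (adj (quot_graph X R D))\<^sup>*"
    proof (induction rule: rtrancl_induct)
      case (step y z)
      show ?case
      proof (cases "(y, z) \<in> R")
        case True
        then have "cls R y = cls R z" using cls_eq_iff[OF symR] by blast
        then show ?thesis using step by simp
      next
        case False
        then have "(cls R y, cls R z) \<in> adj (quot_graph X R D)"
          using step adj_quot_graph[OF symD] by blast
        then show ?thesis using step by (meson rtrancl_into_rtrancl)
      qed
    qed simp
    then show ?thesis using xy by simp
  qed
  show "(A, B) \<notin> (adj (quot_graph X R D) - {(A, B), (B, A)})\<^sup>*"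
    if AB: "(A, B) \<in> adj (quot_graph X R D)" for A B
  proof
    assume path: "(A, B) \<in> (adj (quot_graph X R D) - {(A, B), (B, A)})\<^sup>*"
    obtain x y where xy: "(x, y) \<in> D" "A = cls R x" "B = cls R y"
      using AB adj_quot_graph[OF symD] by blast
    obtain s where s: "s x" "\<not> s y" "\<And>u v. (u, v) \<in> R \<Longrightarrow> s u = s v"
      and cross: "\<And>u v. (u, v) \<in> D \<Longrightarrow> s u \<noteq> s v \<Longrightarrow> {cls R u, cls R v} = {A, B}"
      using side[OF xy(1)] xy by blast
    have s_cls: "s u = s v" if "cls R u = cls R v" for u v
      using invariant_on_cls[of R s u v] cls_eq_iff[OF symR] s(3) that by blast
    let ?P = "{cls R u | u. s u}"
    have "A \<in> ?P" "B \<notin> ?P" using xy s s_cls by blast+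
    then obtain A' B' where *: "(A', B') \<in> adj (quot_graph X R D) - {(A, B), (B, A)}" "A' \<in> ?P" "B' \<notin> ?P"
      using rtrancl_crosses[OF path, of ?P] by blast
    have "(A', B') \<in> adj (quot_graph X R D)" using *(1) by blast
    then obtain u v where uv: "(u, v) \<in> D" "A' = cls R u" "B' = cls R v"
      unfolding adj_quot_graph[OF symD] by blast
    then have "s u" "\<not> s v" using *(2,3) s_cls by blast+
    then have "{A', B'} = {A, B}" using cross uv by blast
    then show False using *(1) by (auto simp: doubleton_eq_iff)
  qed
qed

end

text \<open>
  Group actions in the sense of \<open>group_action\<close> are by functions that are undefined outside the
  underlying set, which the given maps \<open>\<psi> g\<close> need not be.
\<close>

lemma group_actionI:
  assumes "group G"
    and closed: "\<And>g x. g \<in> carrier G \<Longrightarrow> x \<in> E \<Longrightarrow> \<psi> g x \<in> E"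
    and mult: "\<And>g h x. g \<in> carrier G \<Longrightarrow> h \<in> carrier G \<Longrightarrow> x \<in> E \<Longrightarrow> \<psi> (g \<otimes>\<^bsub>G\<^esub> h) x = \<psi> g (\<psi> h x)"
    and one: "\<And>x. x \<in> E \<Longrightarrow> \<psi> \<one>\<^bsub>G\<^esub> x = x"
  shows "group_action G E (\<lambda>g. restrict (\<psi> g) E)"
proof -
  interpret group G by fact
  have inv1: "\<psi> (inv\<^bsub>G\<^esub> g) (\<psi> g x) = x" and inv2: "\<psi> g (\<psi> (inv\<^bsub>G\<^esub> g) x) = x"
    if "g \<in> carrier G" "x \<in> E" for g x
    using that mult[of "inv\<^bsub>G\<^esub> g" g x] mult[of g "inv\<^bsub>G\<^esub> g" x] one by auto
  have Bij: "restrict (\<psi> g) E \<in> Bij E" if g: "g \<in> carrier G" for g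
  proof -
    have "bij_betw (\<psi> g) E E"
      by (rule bij_betw_byWitness[where f' = "\<psi> (inv\<^bsub>G\<^esub> g)"]) (use inv1 inv2 closed g in auto)
    then show ?thesis by (simp add: Bij_def bij_betw_restrict_eq)
  qed
  have "restrict (\<psi> (g \<otimes>\<^bsub>G\<^esub> h)) E = compose E (restrict (\<psi> g) E) (restrict (\<psi> h) E)"
    if "g \<in> carrier G" "h \<in> carrier G" for g h
    using that mult closed by (auto simp: compose_def fun_eq_iff)
  then show ?thesis
    unfolding group_action_def group_hom_def group_hom_axioms_def
    using Bij group_BijGroup \<open>group G\<close> by (auto simp: hom_def BijGroup_def)
qed

locale tree_quotient_action = tree_quotient X R D + group G
  for X :: "'x set" and R D and G (structure) +
  fixes \<psi>
  assumes closed: "\<And>g x. g \<in> carrier G \<Longrightarrow> x \<in> X \<Longrightarrow> \<psi> g x \<in> X"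
    and mult: "\<And>g h x. g \<in> carrier G \<Longrightarrow> h \<in> carrier G \<Longrightarrow> x \<in> X \<Longrightarrow> \<psi> (g \<otimes> h) x = \<psi> g (\<psi> h x)"
    and one: "\<And>x. x \<in> X \<Longrightarrow> \<psi> \<one> x = x"
    and R_act: "\<And>g x y. g \<in> carrier G \<Longrightarrow> (x, y) \<in> R \<Longrightarrow> (\<psi> g x, \<psi> g y) \<in> R"
    and D_act: "\<And>g x y. g \<in> carrier G \<Longrightarrow> (x, y) \<in> D \<Longrightarrow> (\<psi> g x, \<psi> g y) \<in> D"
    and no_inv: "\<And>g x y. g \<in> carrier G \<Longrightarrow> (x, y) \<in> D \<Longrightarrow> cls R (\<psi> g x) = cls R y \<Longrightarrow> cls R (\<psi> g y) \<noteq> cls R x"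
begin

definition quot_act where "quot_act g = restrict ((`) (\<psi> g)) (cls R ` X)"

lemma cls_subset: "x \<in> X \<Longrightarrow> cls R x \<subseteq> X"
proof -
  assume x: "x \<in> X"
  have "y \<in> X" if "(x, y) \<in> R\<^sup>*" for y
    using that x RX by (induction rule: rtrancl_induct) auto
  then show ?thesis by (auto simp: cls_def)
qed

lemma rtrancl_act:
  assumes g: "g \<in> carrier G" and "(x, y) \<in> R\<^sup>*" shows "(\<psi> g x, \<psi> g y) \<in> R\<^sup>*"
  using assms(2) by (induction rule: rtrancl_induct) (auto dest: R_act[OF g])

lemma image_cls:
  assumes g: "g \<in> carrier G" and x: "x \<in> X" shows "\<psi> g ` cls R x = cls R (\<psi> g x)"
proof
  show "\<psi> g ` cls R x \<subseteq> cls R (\<psi> g x)" using rtrancl_act[OF g] by (auto simp: cls_def)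
  show "cls R (\<psi> g x) \<subseteq> \<psi> g ` cls R x"
  proof
    fix y assume y: "y \<in> cls R (\<psi> g x)"
    then have "y \<in> X" using cls_subset closed[OF g x] by blast
    then have "\<psi> g (\<psi> (inv g) y) = y" using mult[of g "inv g" y] g one by simp
    moreover have "(\<psi> (inv g) (\<psi> g x), \<psi> (inv g) y) \<in> R\<^sup>*"
      using rtrancl_act[OF inv_closed[OF g]] y by (simp add: cls_def)
    then have "\<psi> (inv g) y \<in> cls R x" using mult[of "inv g" g x] g x one by (simp add: cls_def)
    ultimately show "y \<in> \<psi> g ` cls R x" by (metis imageI)
  qed
qed

lemma quot_act_cls: "g \<in> carrier G \<Longrightarrow> x \<in> X \<Longrightarrow> quot_act g (cls R x) = cls R (\<psi> g x)"
  by (simp add: quot_act_def image_cls)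

lemma tree_action_quot: "tree_action G (quot_graph X R D) quot_act"
proof (intro tree_action.intro tree_action_axioms.intro)
  have "group_action G (cls R ` X) (\<lambda>g. restrict ((`) (\<psi> g)) (cls R ` X))"
  proof (rule group_actionI)
    show "group G" by (rule group_axioms)
    show "\<psi> g ` A \<in> cls R ` X" if "g \<in> carrier G" "A \<in> cls R ` X" for g A
      using that image_cls closed by auto
    show "\<psi> (g \<otimes> h) ` A = \<psi> g ` \<psi> h ` A"
      if "g \<in> carrier G" "h \<in> carrier G" "A \<in> cls R ` X" for g h A
      unfolding image_image using that cls_subset by (intro image_cong refl mult) auto
    show "\<psi> \<one> ` A = A" if "A \<in> cls R ` X" for A
    proof -
      have "\<psi> \<one> ` A = (\<lambda>x. x) ` A" using that cls_subset one by (intro image_cong) auto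
      then show ?thesis by simp
    qed
  qed
  then show "group_action G (verts (quot_graph X R D)) quot_act"
    by (simp add: quot_act_def[abs_def])
  show "simplicial_tree (quot_graph X R D)" by (rule simplicial_tree_quot)
  fix g assume g: "g \<in> carrier G"
  show "quot_act g ` e \<in> edges (quot_graph X R D)" if "e \<in> edges (quot_graph X R D)" for e
  proof -
    obtain x y where xy: "(x, y) \<in> D" "e = {cls R x, cls R y}" using \<open>e \<in> edges _\<close> by auto
    then have "quot_act g ` e = {cls R (\<psi> g x), cls R (\<psi> g y)}" using quot_act_cls[OF g] DX by auto
    then show ?thesis using D_act[OF g xy(1)] by auto
  qed
  show "quot_act g B \<noteq> A" if AB: "{A, B} \<in> edges (quot_graph X R D)" "quot_act g A = B" for A B
  proof -
    have "(A, B) \<in> adj (quot_graph X R D)" using AB by (simp add: adj_def)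
    then obtain x y where xy: "(x, y) \<in> D" "A = cls R x" "B = cls R y"
      using adj_quot_graph[OF symD] by blast
    then show ?thesis using no_inv[OF g xy(1)] AB quot_act_cls[OF g] DX by auto
  qed
qed

end

section \<open>Splittings from shifted edges\<close>

context tree_action
begin

text \<open>
  An edge that is shifted by some element gives a splitting over its stabilizer: collapse all edges
  outside its orbit. The shifting element still has no fixed vertex in the collapsed tree, as the
  two sides of the shifted edge survive the collapse.
\<close>

lemma shifted_edge_splits:
  assumes ab: "{a, b} \<in> edges T" and g: "g \<in> carrier G" and s: "shifts g a b"
  shows "splits_over G (edge_stab G \<phi> {a, b})"
proof -
  define Orb where "Orb = orbit G (\<lambda>g. (`) (\<phi> g)) {a, b}"
  define D where "D = {(u, v). {u, v} \<in> Orb}"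
  define R where "R = adj T - D"
  have OE: "Orb \<subseteq> edges T" using edge_image[OF _ ab] by (auto simp: Orb_def orbit_def simp del: image_insert)
  have ab_O: "{a, b} \<in> Orb"
  proof -
    have "\<phi> \<one> ` {a, b} = {a, b}" using act_one edge_verts[OF ab] by auto
    then show ?thesis unfolding Orb_def orbit_def using one_closed by blast
  qed
  have O_act: "\<phi> h ` e \<in> Orb" if h: "h \<in> carrier G" and e: "e \<in> Orb" for h e
  proof -
    obtain k where k: "k \<in> carrier G" "e = \<phi> k ` {a, b}" using e by (auto simp: Orb_def orbit_def)
    then have "\<phi> h ` e = \<phi> (h \<otimes> k) ` {a, b}" using act_mult[OF h k(1)] edge_verts[OF ab] by auto
    then show ?thesis unfolding Orb_def orbit_def using h k by blast
  qed
  have O_act_iff: "{\<phi> h u, \<phi> h v} \<in> Orb \<longleftrightarrow> {u, v} \<in> Orb"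
    if h: "h \<in> carrier G" and "u \<in> verts T" "v \<in> verts T" for h u v
    using O_act[OF h, of "{u, v}"] O_act[OF inv_closed[OF h], of "{\<phi> h u, \<phi> h v}"] that act_inv(1)[OF h] by auto
  have D_adj: "D \<subseteq> adj T" using OE by (auto simp: D_def adj_def)
  have adj_V: "adj T \<subseteq> verts T \<times> verts T" using edge_verts by (auto simp: adj_def)
  have sR: "u \<in> half T y x \<longleftrightarrow> v \<in> half T y x" if xy: "(x, y) \<in> D" and uv: "(u, v) \<in> R" for x y u v
  proof -
    have yx: "{y, x} \<in> edges T" using xy OE by (auto simp: D_def insert_commute)
    have "{u, v} \<in> edges T" "{v, u} \<in> edges T" "{u, v} \<notin> Orb" "{v, u} \<notin> Orb"
      using uv by (auto simp: R_def adj_def D_def insert_commute)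
    then show ?thesis using half_crossing[OF yx, of u v] half_crossing[OF yx, of v u] xy
      unfolding D_def by blast
  qed
  have sD: "{u, v} = {x, y}" if xy: "(x, y) \<in> D" and uv: "(u, v) \<in> D"
    and "(u \<in> half T y x) \<noteq> (v \<in> half T y x)" for x y u v
  proof -
    have "{y, x} \<in> edges T" "{u, v} \<in> edges T" "{v, u} \<in> edges T"
      using xy uv OE by (auto simp: D_def insert_commute)
    then show ?thesis using half_crossing[of y x u v] half_crossing[of y x v u] that(3) by blast
  qed
  have symD: "sym D" by (auto simp: D_def insert_commute intro!: symI)
  then have symR: "sym R"
    by (auto simp: R_def sym_adj[of _ _ T] intro!: symI elim: symE)
  interpret Q: tree_quotient "verts T" R D
  proof
    show "verts T \<noteq> {}" by (rule verts_nonempty)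
    show "R \<subseteq> verts T \<times> verts T" "D \<subseteq> verts T \<times> verts T" using adj_V D_adj by (auto simp: R_def)
    show "sym D" "sym R" by (rule symD, rule symR)
    show "(x, y) \<in> (R \<union> D)\<^sup>*" if "x \<in> verts T" "y \<in> verts T" for x y
    proof -
      have "adj T = R \<union> D" using D_adj by (auto simp: R_def)
      then show ?thesis using connected that by simp
    qed
    fix x y assume xy: "(x, y) \<in> D"
    have "{y, x} \<in> edges T" using xy OE by (auto simp: D_def insert_commute)
    then have "x \<in> half T y x" "y \<notin> half T y x" using half_self bridge by auto
    moreover have "{cls R u, cls R v} = {cls R x, cls R y}"
      if "(u, v) \<in> D" "(u \<in> half T y x) \<noteq> (v \<in> half T y x)" for u v
      using sD[OF xy that] by (metis image_empty image_insert)
    ultimately show "\<exists>s. s x \<and> \<not> s y \<and> (\<forall>u v. (u, v) \<in> R \<longrightarrow> s u = s v) \<and>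
        (\<forall>u v. (u, v) \<in> D \<longrightarrow> s u \<noteq> s v \<longrightarrow> {cls R u, cls R v} = {cls R x, cls R y})"
      using sR[OF xy] by (intro exI[of _ "\<lambda>v. v \<in> half T y x"]) blast
  qed
  have s_cls: "u \<in> half T y x \<longleftrightarrow> v \<in> half T y x" if "(x, y) \<in> D" "cls R u = cls R v" for x y u v
    using invariant_on_cls[of R "\<lambda>v. v \<in> half T y x" u v] sR[OF that(1)] cls_eq_iff[OF symR] that(2) by blast
  \<comment> \<open>An element that preserves the image of a kept edge preserves the edge: only this edge separates
    the two sides.\<close>
  have edge_eq: "{\<phi> h x, \<phi> h y} = {x, y}"
    if h: "h \<in> carrier G" and xy: "(x, y) \<in> D" and eq: "{cls R (\<phi> h x), cls R (\<phi> h y)} = {cls R x, cls R y}" for h x y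
  proof -
    have E: "{y, x} \<in> edges T" "{x, y} \<in> Orb" using xy OE by (auto simp: D_def insert_commute)
    have "(\<phi> h x, \<phi> h y) \<in> D" using O_act[OF h E(2)] by (simp add: D_def)
    moreover have "(\<phi> h x \<in> half T y x) \<noteq> (\<phi> h y \<in> half T y x)"
    proof -
      have "cls R (\<phi> h x) = cls R x \<and> cls R (\<phi> h y) = cls R y \<or>
          cls R (\<phi> h x) = cls R y \<and> cls R (\<phi> h y) = cls R x"
        using eq by (simp add: doubleton_eq_iff)
      moreover have "x \<in> half T y x" "y \<notin> half T y x" using half_self bridge[OF E(1)] by auto
      ultimately show ?thesis using s_cls[OF xy] by blast
    qed
    ultimately show ?thesis using sD[OF xy] by blast
  qed
  interpret Q: tree_quotient_action "verts T" R D G \<phi>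
  proof
    fix h x y assume h: "h \<in> carrier G"
    show "(\<phi> h x, \<phi> h y) \<in> D" if "(x, y) \<in> D"
      using O_act[OF h, of "{x, y}"] that by (simp add: D_def)
    show "(\<phi> h x, \<phi> h y) \<in> R" if "(x, y) \<in> R"
      using O_act_iff[OF h, of x y] edge_act[OF h, of x y] that adj_V by (auto simp: R_def D_def adj_def)
    show "cls R (\<phi> h y) \<noteq> cls R x" if xy: "(x, y) \<in> D" "cls R (\<phi> h x) = cls R y"
    proof
      assume "cls R (\<phi> h y) = cls R x"
      then have "\<phi> h ` {x, y} = {x, y}" using edge_eq[OF h xy(1)] xy(2) by auto
      moreover have "{x, y} \<in> edges T" using xy(1) OE by (auto simp: D_def)
      ultimately have "\<phi> h x = x" using edge_fixed[OF h] by blast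
      then show False using xy Q.cls_distinct by metis
    qed
  qed (auto simp: act_closed act_mult act_one)
  let ?T = "quot_graph (verts T) R D"
  interpret QT: tree_action G ?T Q.quot_act by (rule Q.tree_action_quot)
  have Dab: "(a, b) \<in> D" "(b, a) \<in> D" using ab_O by (auto simp: D_def insert_commute)
  have V: "a \<in> verts T" "b \<in> verts T" using edge_verts ab by auto
  have ba: "{b, a} \<in> edges T" using ab by (simp add: insert_commute)
  have "Q.quot_act g A \<noteq> A" if A: "A \<in> verts ?T" for A
  proof
    assume fix1: "Q.quot_act g A = A"
    obtain v where v: "v \<in> verts T" "A = cls R v" using A by auto
    have pow: "cls R (\<phi> (h [^] (n::nat)) v) = cls R v"
      if h: "h \<in> carrier G" and "Q.quot_act h A = A" for h n
    proof (induction n)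
      case (Suc n)
      have "cls R (\<phi> (h [^] Suc n) v) = Q.quot_act h (cls R (\<phi> (h [^] n) v))"
        using Q.quot_act_cls[OF h, of "\<phi> (h [^] n) v"] act_pow_Suc[OF h v(1)] act_closed v h by simp
      then show ?case using Suc that(2) v by simp
    qed (simp add: act_one v)
    have fix2: "Q.quot_act (inv g) A = A" using QT.act_inv(1)[OF g A] fix1 by simp
    obtain m :: nat where "\<phi> (g [^] m) v \<in> half T a b" using shifts_absorbs[OF g ab s v(1)] by auto
    then have "v \<in> half T a b" using s_cls[OF Dab(2)] pow[OF g fix1] by blast
    moreover obtain n :: nat where "\<phi> (inv g [^] n) v \<in> half T b a"
      using shifts_absorbs[OF inv_closed[OF g] ba shifts_inv[OF g ab s] v(1)] by auto
    then have "v \<in> half T b a" using s_cls[OF Dab(1)] pow[OF inv_closed[OF g] fix2] by blast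
    ultimately show False using half_disjoint[OF ab] by blast
  qed
  then have nontriv: "\<not> acts_trivially G ?T Q.quot_act (carrier G)"
    using QT.acts_trivially_iff[of "carrier G"] g by blast
  let ?e = "{cls R a, cls R b}"
  have img: "Q.quot_act h ` {cls R u, cls R v} = {cls R (\<phi> h u), cls R (\<phi> h v)}"
    if "h \<in> carrier G" "u \<in> verts T" "v \<in> verts T" for h u v
    using Q.quot_act_cls that by simp
  have orb: "edges ?T = orbit G (\<lambda>g. (`) (Q.quot_act g)) ?e"
  proof -
    have "e \<in> orbit G (\<lambda>g. (`) (Q.quot_act g)) ?e" if "e \<in> edges ?T" for e
    proof -
      obtain u v where uv: "(u, v) \<in> D" "e = {cls R u, cls R v}" using \<open>e \<in> edges ?T\<close> by auto
      then obtain h where h: "h \<in> carrier G" "{u, v} = {\<phi> h a, \<phi> h b}"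
        by (auto simp: D_def Orb_def orbit_def)
      then have "e = cls R ` {\<phi> h a, \<phi> h b}" using uv by (metis image_empty image_insert)
      then have "e = Q.quot_act h ` ?e" using img[OF h(1) V] by simp
      then show ?thesis unfolding orbit_def using h by blast
    qed
    moreover have "Q.quot_act h ` ?e \<in> edges ?T" if h: "h \<in> carrier G" for h
      using QT.edge_image[OF h, of ?e] Dab by auto
    ultimately show ?thesis by (auto simp: orbit_def)
  qed
  have "edge_stab G \<phi> {a, b} = edge_stab G Q.quot_act ?e"
  proof -
    have "\<phi> h ` {a, b} = {a, b} \<longleftrightarrow> Q.quot_act h ` ?e = ?e" if h: "h \<in> carrier G" for h
    proof
      assume "\<phi> h ` {a, b} = {a, b}"
      then have "cls R ` \<phi> h ` {a, b} = cls R ` {a, b}" by simp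
      then show "Q.quot_act h ` ?e = ?e" using img[OF h V] by simp
    next
      assume "Q.quot_act h ` ?e = ?e"
      then show "\<phi> h ` {a, b} = {a, b}" using edge_eq[OF h Dab(1)] img[OF h V] by simp
    qed
    then show ?thesis unfolding stabilizer_def by blast
  qed
  moreover have "?e \<in> edges ?T" using Dab by auto
  ultimately have "splitting G ?T Q.quot_act (edge_stab G \<phi> {a, b})"
    using nontriv orb Q.tree_action_quot by (auto simp: splitting_def simp del: quot_graph_simps)
  then show ?thesis by (rule splits_overI)
qed

end

text \<open>Two powers of \<open>h\<close> are in the same coset; their quotient is the power that is wanted.\<close>

lemma (in group) power_in_finite_index:
  assumes A: "subgroup A G" and K: "subgroup K G" "K \<subseteq> A"
    and fin: "\<not> infinite_index_subgroup G A K" and h: "h \<in> A"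
  shows "\<exists>m::nat. m > 0 \<and> h [^] m \<in> K"
proof -
  have AG: "A \<subseteq> carrier G" using A by (rule subgroup.subset)
  have hG: "h \<in> carrier G" using h AG by blast
  interpret A: group "G\<lparr>carrier := A\<rparr>" using subgroup.subgroup_is_group[OF A] group_axioms by blast
  have "subgroup K (G\<lparr>carrier := A\<rparr>)" using subgroup_incl[OF K(1) A K(2)] .
  then have finite: "finite (rcosets\<^bsub>G\<lparr>carrier := A\<rparr>\<^esub> K)" using fin by (simp add: infinite_index_subgroup_def)
  have powA: "h [^] n \<in> A" for n :: nat
    by (induction n) (use h A in \<open>auto intro: subgroup.m_closed subgroup.one_closed\<close>)
  have "K #> h [^] n \<in> rcosets\<^bsub>G\<lparr>carrier := A\<rparr>\<^esub> K" for n :: nat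
    using powA[of n] by (auto simp: RCOSETS_def r_coset_def)
  then have "\<not> inj (\<lambda>n::nat. K #> h [^] n)"
    using finite finite_imageD[of "\<lambda>n::nat. K #> h [^] n" UNIV] finite_subset[of "range (\<lambda>n::nat. K #> h [^] n)"]
    by (metis image_subsetI infinite_UNIV_nat)
  then obtain i j :: nat where ij: "i < j" "K #> h [^] i = K #> h [^] j"
    unfolding inj_def by (metis nat_neq_iff)
  have "h [^] j \<in> K #> h [^] i"
    using ij rcos_self[of "h [^] j" K] K hG by simp
  then obtain k where k: "k \<in> K" "h [^] j = k \<otimes> h [^] i" by (auto simp: r_coset_def)
  have "h [^] (j - i) \<otimes> h [^] i = h [^] j" using ij hG by (simp add: nat_pow_mult)
  then have "h [^] (j - i) \<otimes> h [^] i = k \<otimes> h [^] i" using k by simp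
  then have "h [^] (j - i) = k"
    using hG k(1) subgroup.mem_carrier[OF K(1)] by simp
  then show ?thesis using ij k by (intro exI[of _ "j - i"]) auto
qed

section \<open>Two trees with the same group\<close>

locale tree_pair =
  t1: tree_action G T1 \<phi>1 + t2: tree_action G T2 \<phi>2
  for G (structure) and T1 :: "'v sgraph" and \<phi>1 and T2 :: "'w sgraph" and \<phi>2 +
  assumes minimal1: "minimal_action G T1 \<phi>1" and minimal2: "minimal_action G T2 \<phi>2"
    and stab1: "\<And>e. e \<in> edges T1 \<Longrightarrow> \<not> acts_trivially G T2 \<phi>2 (edge_stab G \<phi>1 e)"
    and stab2: "\<And>e. e \<in> edges T2 \<Longrightarrow> \<not> acts_trivially G T1 \<phi>1 (edge_stab G \<phi>2 e)"
    and no_split1: "\<And>e H. \<lbrakk>e \<in> edges T1; infinite_index_subgroup G (edge_stab G \<phi>1 e) H\<rbrakk> \<Longrightarrow> \<not> splits_over G H"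
    and no_split2: "\<And>e H. \<lbrakk>e \<in> edges T2; infinite_index_subgroup G (edge_stab G \<phi>2 e) H\<rbrakk> \<Longrightarrow> \<not> splits_over G H"
begin

lemma swap: "tree_pair G T2 \<phi>2 T1 \<phi>1"
  by unfold_locales (fact minimal1 minimal2 stab1 stab2 no_split1 no_split2)+

text \<open>
  \<open>M1 \<tau>\<close> lives in \<open>T1\<close> and \<open>M2 \<sigma>\<close> in \<open>T2\<close>. Both are exchanged by \<open>swap\<close>, which
  is how every statement about \<open>M1\<close> is used for \<open>M2\<close>.
\<close>

definition M1 where "M1 \<tau> = t1.minv (t2.fixer \<tau>)"

definition M2 where "M2 \<sigma> = t2.minv (t1.fixer \<sigma>)"

lemma edges2_nonempty: assumes "edges T1 \<noteq> {}" shows "edges T2 \<noteq> {}"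
proof
  assume no: "edges T2 = {}"
  obtain e where e: "e \<in> edges T1" using assms by blast
  have sub: "edge_stab G \<phi>1 e \<subseteq> carrier G" by (auto simp: stabilizer_def)
  obtain w where w: "w \<in> verts T2" using t2.verts_nonempty by blast
  have "\<phi>2 h w = w" if "h \<in> carrier G" for h
    using t2.sep_nonempty[of "\<phi>2 h w" w] t2.sep_subset no t2.act_closed[OF that w] w by blast
  then show False using stab1[OF e] t2.acts_trivially_iff[OF sub] w sub by blast
qed

lemma M1_conv: "t1.conv (M1 \<tau>)"
  unfolding M1_def by (rule t1.minv_conv[OF t2.fixer_subset])

lemma M1_verts: "M1 \<tau> \<subseteq> verts T1"
  using M1_conv by (simp add: t1.conv_def)

lemma M1_antimono: "\<sigma> \<subseteq> \<tau> \<Longrightarrow> M1 \<tau> \<subseteq> M1 \<sigma>"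
  unfolding M1_def by (intro t1.minv_mono t2.fixer_mono)

lemma M1_no_edges: "edges T1 = {} \<Longrightarrow> M1 \<tau> = verts T1"
  unfolding M1_def by (rule t1.minv_no_edges[OF _ t2.fixer_subset])

lemma M1_act:
  assumes g: "g \<in> carrier G" and t: "\<tau> \<subseteq> verts T2"
  shows "\<phi>1 g ` M1 \<tau> \<subseteq> M1 (\<phi>2 g ` \<tau>)"
  unfolding M1_def by (rule t1.minv_conj[OF g t2.fixer_subset t2.fixer_subset t2.fixer_conj[OF g t]])

lemma fixer_fixed_point_free:
  assumes "edges T2 \<noteq> {}" "\<tau> \<in> simplices T2"
  shows "\<exists>h \<in> t2.fixer \<tau>. \<forall>v \<in> verts T1. \<phi>1 h v \<noteq> v"
proof -
  have edge: ?thesis if "f \<in> edges T2" "\<tau> \<subseteq> f" for f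
    using stab2[OF that(1)] t1.acts_trivially_iff[OF t2.fixer_subset, of f] t2.edge_stab_eq[OF that(1)]
      t2.fixer_mono[OF that(2)] by auto
  from assms(2) show ?thesis
  proof (cases rule: t2.simplexE)
    case (1 w)
    obtain c d where cd: "{c, d} \<in> edges T2" "c \<noteq> d" using assms(1) by (metis all_not_in_conv t2.edgeE)
    then obtain u where "u \<in> verts T2" "w \<noteq> u" using t2.edge_verts by metis
    then obtain x where "{w, x} \<in> edges T2" using t2.first_edge[OF 1(1)] by blast
    then show ?thesis using edge 1 by blast
  next
    case (2 c d)
    then show ?thesis using edge by blast
  qed
qed

lemma M1_nonempty: assumes "\<tau> \<in> simplices T2" shows "M1 \<tau> \<noteq> {}"
proof (cases "edges T2 = {}")
  case True
  then have "edges T1 = {}" using edges2_nonempty by blast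
  then show ?thesis using M1_no_edges t1.verts_nonempty by simp
next
  case False
  then obtain h where "h \<in> t2.fixer \<tau>" "\<And>v. v \<in> verts T1 \<Longrightarrow> \<phi>1 h v \<noteq> v"
    using fixer_fixed_point_free[OF _ assms] by blast
  then show ?thesis
    using t1.minv_edge_ex[OF t2.subgroup_fixer] t2.simplex_facts[OF assms] unfolding M1_def by blast
qed

lemma M1_edge_shifted:
  assumes "\<tau> \<in> simplices T2" and ab: "{a, b} \<in> edges T1" "{a, b} \<subseteq> M1 \<tau>"
  shows "\<exists>g \<in> t2.fixer \<tau>. t1.shifts g a b"
proof -
  interpret S: tree_pair G T2 \<phi>2 T1 \<phi>1 by (rule swap)
  have "edges T2 \<noteq> {}" using edges2_nonempty ab by blast
  then obtain h where "h \<in> t2.fixer \<tau>" "\<And>v. v \<in> verts T1 \<Longrightarrow> \<phi>1 h v \<noteq> v"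
    using fixer_fixed_point_free[OF _ assms(1)] by blast
  then show ?thesis
    using t1.minv_edge_shifted[OF t2.subgroup_fixer _ _ ab(1)] t2.simplex_facts[OF assms(1)] ab(2)
    unfolding M1_def by blast
qed

lemma M1_vertex_on_edge:
  assumes "edges T2 \<noteq> {}" "\<tau> \<in> simplices T2" and v: "v \<in> M1 \<tau>"
  shows "\<exists>x. {v, x} \<in> edges T1 \<and> x \<in> M1 \<tau>"
proof -
  obtain h where "h \<in> t2.fixer \<tau>" "\<And>v. v \<in> verts T1 \<Longrightarrow> \<phi>1 h v \<noteq> v"
    using fixer_fixed_point_free[OF assms(1,2)] by blast
  then obtain a b where "{a, b} \<in> edges T1" "a \<in> M1 \<tau>" "b \<in> M1 \<tau>"
    using t1.minv_edge_ex[OF t2.subgroup_fixer] t2.simplex_facts[OF assms(2)] unfolding M1_def by blast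
  then show ?thesis using t1.conv_neighbour[OF M1_conv v] t1.edge_verts by metis
qed

text \<open>
  \<open>lk \<sigma>\<close> is the subgraph of \<open>T2\<close> whose simplices are the \<open>\<tau>\<close> with \<open>\<sigma> \<subseteq> M1 \<tau>\<close>; what
  has to be shown is that it contains \<open>M2 \<sigma>\<close>.
\<close>

definition lk where "lk \<sigma> = {(w, w'). {w, w'} \<in> edges T2 \<and> \<sigma> \<subseteq> M1 {w, w'}}"

lemma sym_lk: "sym (lk \<sigma>)"
  by (auto simp: lk_def insert_commute intro!: symI)

lemma lk_adj: "lk \<sigma> \<subseteq> adj T2"
  by (auto simp: lk_def adj_def)

lemma lk_cls_verts: assumes "w \<in> verts T2" shows "cls (lk \<sigma>) w \<subseteq> verts T2"
proof -
  have "v \<in> verts T2" if "(w, v) \<in> (lk \<sigma>)\<^sup>*" for v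
    using that assms t2.edge_verts by (induction rule: rtrancl_induct) (auto simp: lk_def)
  then show ?thesis by (auto simp: cls_def)
qed

lemma lk_cls_conv: assumes "w \<in> verts T2" shows "t2.conv (cls (lk \<sigma>) w)"
proof (rule t2.rtrancl_conv[OF lk_cls_verts[OF assms]])
  let ?r = "lk \<sigma> \<inter> cls (lk \<sigma>) w \<times> cls (lk \<sigma>) w"
  show "?r \<subseteq> adj T2 \<inter> cls (lk \<sigma>) w \<times> cls (lk \<sigma>) w" using lk_adj by blast
  have 1: "(w, v) \<in> ?r\<^sup>*" if "(w, v) \<in> (lk \<sigma>)\<^sup>*" for v
    using that
  proof (induction rule: rtrancl_induct)
    case (step y z)
    then have "(y, z) \<in> ?r" by (auto simp: cls_def intro: rtrancl_into_rtrancl)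
    with step show ?case by (meson rtrancl_into_rtrancl)
  qed simp
  have "sym ?r" using sym_lk by (auto simp: sym_def)
  then show "(u, v) \<in> ?r\<^sup>*" if "u \<in> cls (lk \<sigma>) w" "v \<in> cls (lk \<sigma>) w" for u v
    using 1 that unfolding cls_def by (meson Image_singleton_iff rtrancl_sym_swap rtrancl_trans)
qed

lemma lk_cls_eq: "w' \<in> cls (lk \<sigma>) w \<longleftrightarrow> cls (lk \<sigma>) w' = cls (lk \<sigma>) w"
  using cls_eq_iff[OF sym_lk] unfolding cls_def by (metis Image_singleton_iff cls_def)

text \<open>In a tree, a connected subgraph contains every edge with both ends in it.\<close>

lemma lk_cls_edge:
  assumes "u \<in> cls (lk \<sigma>) w" "v \<in> cls (lk \<sigma>) w" and uv: "{u, v} \<in> edges T2"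
  shows "\<sigma> \<subseteq> M1 {u, v}"
proof -
  have "(u, v) \<in> (lk \<sigma>)\<^sup>*" using assms lk_cls_eq cls_eq_iff[OF sym_lk] by metis
  then have "(u, v) \<in> lk \<sigma> \<or> (v, u) \<in> lk \<sigma>"
    using t2.connected_one_side[OF uv lk_adj, of \<sigma> u v] t2.bridge[OF uv] t2.half_self[of v u] by blast
  then show ?thesis by (auto simp: lk_def insert_commute)
qed

lemma lk_cls_leave:
  assumes "u \<in> cls (lk \<sigma>) w" "v \<notin> cls (lk \<sigma>) w" and uv: "{u, v} \<in> edges T2"
  shows "\<not> \<sigma> \<subseteq> M1 {u, v}"
proof
  assume "\<sigma> \<subseteq> M1 {u, v}"
  then have "(u, v) \<in> lk \<sigma>" using uv by (simp add: lk_def)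
  then show False using assms by (auto simp: cls_def intro: rtrancl_into_rtrancl)
qed

lemma lk_cls_M1:
  assumes "\<sigma> \<subseteq> M1 {w}" "v \<in> cls (lk \<sigma>) w" shows "\<sigma> \<subseteq> M1 {v}"
proof -
  have "(w, v) \<in> (lk \<sigma>)\<^sup>*" using assms by (simp add: cls_def)
  then show ?thesis
  proof (induction rule: rtrancl_induct)
    case (step y z)
    then show ?case using M1_antimono[of "{z}" "{y, z}"] by (auto simp: lk_def)
  qed (rule assms)
qed

lemma lk_act:
  assumes g: "g \<in> t1.fixer \<sigma>" and "(w, w') \<in> (lk \<sigma>)\<^sup>*" shows "(\<phi>2 g w, \<phi>2 g w') \<in> (lk \<sigma>)\<^sup>*"
  using assms(2)
proof (induction rule: rtrancl_induct)
  case (step y z)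
  have gG: "g \<in> carrier G" using g t1.fixer_subset by blast
  have yz: "{y, z} \<in> edges T2" "\<sigma> \<subseteq> M1 {y, z}" using step by (auto simp: lk_def)
  have "\<sigma> \<subseteq> \<phi>1 g ` M1 {y, z}" using yz(2) g by (force simp: t1.fixer_def)
  also have "\<dots> \<subseteq> M1 (\<phi>2 g ` {y, z})" using t2.edge_verts[OF yz(1)] by (intro M1_act[OF gG]) auto
  finally have "(\<phi>2 g y, \<phi>2 g z) \<in> lk \<sigma>" using t2.edge_act[OF gG yz(1)] by (simp add: lk_def)
  with step show ?case by (meson rtrancl_into_rtrancl)
qed simp

lemma lk_cls_invariant:
  assumes g: "g \<in> t1.fixer \<sigma>" and w: "w \<in> verts T2" and gw: "\<phi>2 g w \<in> cls (lk \<sigma>) w" and s: "\<sigma> \<subseteq> verts T1"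
  shows "\<phi>2 g ` cls (lk \<sigma>) w \<subseteq> cls (lk \<sigma>) w" "\<phi>2 (inv g) ` cls (lk \<sigma>) w \<subseteq> cls (lk \<sigma>) w"
proof -
  have gG: "g \<in> carrier G" using g t1.fixer_subset by blast
  have g': "inv g \<in> t1.fixer \<sigma>" using subgroup.m_inv_closed[OF t1.subgroup_fixer[OF s] g] .
  have 1: "(w, \<phi>2 g w) \<in> (lk \<sigma>)\<^sup>*" using gw by (simp add: cls_def)
  show "\<phi>2 g ` cls (lk \<sigma>) w \<subseteq> cls (lk \<sigma>) w"
    using rtrancl_trans[OF 1 lk_act[OF g]] by (auto simp: cls_def)
  have "(\<phi>2 (inv g) w, w) \<in> (lk \<sigma>)\<^sup>*" using lk_act[OF g' 1] t2.act_inv(1)[OF gG w] by simp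
  then have 2: "(w, \<phi>2 (inv g) w) \<in> (lk \<sigma>)\<^sup>*" by (rule rtrancl_sym_swap[OF sym_lk])
  show "\<phi>2 (inv g) ` cls (lk \<sigma>) w \<subseteq> cls (lk \<sigma>) w"
    using rtrancl_trans[OF 2 lk_act[OF g']] by (auto simp: cls_def)
qed

text \<open>
  Every edge of \<open>M2 \<sigma>\<close> is shifted by some \<open>h\<close> in the stabilizer of \<open>\<sigma>\<close>, hence also by its positive
  powers; and a convex set contains all edges that are shifted by an element that preserves it.
\<close>

lemma M2_subset_lk_cls:
  assumes s: "\<sigma> \<in> simplices T1" and w: "w \<in> verts T2" "edges T2 \<noteq> {}"
    and pow: "\<And>h. h \<in> t1.fixer \<sigma> \<Longrightarrow> \<exists>m::nat. m > 0 \<and> \<phi>2 (h [^] m) w \<in> cls (lk \<sigma>) w"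
  shows "M2 \<sigma> \<subseteq> cls (lk \<sigma>) w"
proof
  interpret S: tree_pair G T2 \<phi>2 T1 \<phi>1 by (rule swap)
  have M2: "S.M1 \<sigma> = M2 \<sigma>" by (simp add: S.M1_def M2_def)
  have sV: "\<sigma> \<subseteq> verts T1" using t1.simplex_facts[OF s] by blast
  fix v assume v: "v \<in> M2 \<sigma>"
  have E1: "edges T1 \<noteq> {}" using S.edges2_nonempty[OF w(2)] .
  obtain x where x: "{v, x} \<in> edges T2" "x \<in> M2 \<sigma>"
    using S.M1_vertex_on_edge[OF E1 s] v M2 by auto
  obtain h where h: "h \<in> t1.fixer \<sigma>" "t2.shifts h v x"
    using S.M1_edge_shifted[OF s x(1)] x v M2 by auto
  have hG: "h \<in> carrier G" using h t1.fixer_subset by blast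
  obtain m where m: "m > 0" "\<phi>2 (h [^] (m::nat)) w \<in> cls (lk \<sigma>) w" using pow[OF h(1)] by blast
  obtain n where n: "m = Suc n" using m(1) gr0_implies_Suc by blast
  have hm: "h [^] m \<in> t1.fixer \<sigma>" "h [^] m \<in> carrier G"
  proof -
    show "h [^] m \<in> carrier G" using hG by simp
    then show "h [^] m \<in> t1.fixer \<sigma>"
      using t1.pow_fixes[OF hG] h(1) sV unfolding t1.fixer_def by blast
  qed
  have "t2.shifts (h [^] m) v x" unfolding n by (rule t2.shifts_pow[OF hG x(1) h(2)])
  then show "v \<in> cls (lk \<sigma>) w"
    using t2.shifted_edge_in_invariant[OF hm(2) x(1) _ lk_cls_conv[OF w(1)] _ lk_cls_invariant[OF hm(1) w(1) m(2) sV]]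
      cls_self[of w "lk \<sigma>"] by blast
qed

subsection \<open>The tree of components\<close>

text \<open>
  The complex of the cells \<open>\<sigma> \<times> \<tau>\<close> with \<open>\<sigma> \<subseteq> M1 \<tau>\<close> enters through its 1-skeleton, with vertex
  set \<open>X\<close>, vertical edges \<open>R\<close> and horizontal edges \<open>D\<close>. Contracting the vertical edges collapses
  every component of every fiber over a vertex of \<open>T1\<close>, and identifies two horizontal edges above
  the same edge \<open>e\<close> if they are in the same component of the fiber over \<open>e\<close>.
\<close>

definition X where "X = {(y, w). w \<in> verts T2 \<and> y \<in> M1 {w}}"

definition R where "R = {((y, w), (y', w')). y' = y \<and> {w, w'} \<in> edges T2 \<and> y \<in> M1 {w, w'}}"

definition D where "D = {((y, w), (y', w')). w' = w \<and> w \<in> verts T2 \<and> {y, y'} \<in> edges T1 \<and> y \<in> M1 {w} \<and> y' \<in> M1 {w}}"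

lemma vertex_simplex: "w \<in> verts T2 \<Longrightarrow> {w} \<in> simplices T2"
  by (simp add: simplices_def)

lemma edge_simplex: "e \<in> edges T2 \<Longrightarrow> e \<in> simplices T2"
  by (simp add: simplices_def)

lemma RX: "R \<subseteq> X \<times> X"
proof -
  have "(y, w) \<in> X \<and> (y, w') \<in> X" if "{w, w'} \<in> edges T2" "y \<in> M1 {w, w'}" for y w w'
    using that M1_antimono[of "{w}" "{w, w'}"] M1_antimono[of "{w'}" "{w, w'}"] t2.edge_verts
    by (auto simp: X_def)
  then show ?thesis by (auto simp: R_def)
qed

lemma DX: "D \<subseteq> X \<times> X"
  by (auto simp: D_def X_def)

lemma symR: "sym R" by (auto simp: R_def insert_commute intro!: symI)

lemma symD: "sym D" by (auto simp: D_def insert_commute intro!: symI)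

lemma R_rtrancl: "((y, w), (y', w')) \<in> R\<^sup>* \<longleftrightarrow> y' = y \<and> (w, w') \<in> (lk {y})\<^sup>*"
proof
  assume "((y, w), (y', w')) \<in> R\<^sup>*"
  then show "y' = y \<and> (w, w') \<in> (lk {y})\<^sup>*"
  proof (induction rule: rtrancl_induct2)
    case (step a b c d)
    then have "(b, d) \<in> lk {y}" "c = y" by (auto simp: R_def lk_def)
    with step show ?case by (meson rtrancl_into_rtrancl)
  qed simp
next
  assume "y' = y \<and> (w, w') \<in> (lk {y})\<^sup>*"
  then have "(w, w') \<in> (lk {y})\<^sup>*" "y' = y" by auto
  then show "((y, w), (y', w')) \<in> R\<^sup>*"
  proof (induction rule: rtrancl_induct)
    case (step u v)
    then have "((y, u), (y, v)) \<in> R" by (auto simp: R_def lk_def)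
    with step show ?case by (meson rtrancl_into_rtrancl)
  qed simp
qed

lemma cls_R_eq_iff: "cls R (y, w) = cls R (y', w') \<longleftrightarrow> y' = y \<and> (w, w') \<in> (lk {y})\<^sup>*"
  using cls_eq_iff[OF symR] R_rtrancl by metis

lemma lk_mono: "\<sigma> \<subseteq> \<tau> \<Longrightarrow> (lk \<tau>)\<^sup>* \<subseteq> (lk \<sigma>)\<^sup>*"
  by (intro rtrancl_mono) (auto simp: lk_def)

lemma X_connected:
  assumes x: "x \<in> X" and x': "x' \<in> X" shows "(x, x') \<in> (R \<union> D)\<^sup>*"
proof -
  have hor: "((y, w), (y', w)) \<in> (R \<union> D)\<^sup>*" if w: "w \<in> verts T2" and y: "y \<in> M1 {w}" "y' \<in> M1 {w}" for y y' w
  proof -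
    from t1.conv_connected[OF M1_conv y] show ?thesis
    proof (induction rule: rtrancl_induct)
      case (step u v)
      then have "((u, w), (v, w)) \<in> R \<union> D" using w by (auto simp: D_def adj_def)
      with step show ?case by (meson rtrancl_into_rtrancl)
    qed simp
  qed
  obtain y w y' w' where xx: "x = (y, w)" "x' = (y', w')" by (metis surj_pair)
  then have w: "w \<in> verts T2" "w' \<in> verts T2" and y: "y \<in> M1 {w}" "y' \<in> M1 {w'}"
    using x x' by (auto simp: X_def)
  have "\<forall>z \<in> M1 {w'}. ((y, w), (z, w')) \<in> (R \<union> D)\<^sup>*"
    using t2.connected[OF w]
  proof (induction rule: rtrancl_induct)
    case base
    then show ?case using hor[OF w(1) y(1)] by blast
  next
    case (step u v)
    have uv: "{u, v} \<in> edges T2" using step by (simp add: adj_def)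
    then have V: "v \<in> verts T2" using t2.edge_verts by blast
    obtain z where z: "z \<in> M1 {u, v}" using M1_nonempty[OF edge_simplex[OF uv]] by blast
    then have "z \<in> M1 {u}" "z \<in> M1 {v}" using M1_antimono[of "{u}" "{u, v}"] M1_antimono[of "{v}" "{u, v}"] by auto
    moreover have "((z, u), (z, v)) \<in> R \<union> D" using uv z by (auto simp: R_def)
    ultimately have "((y, w), (z, v)) \<in> (R \<union> D)\<^sup>*" using step by (meson rtrancl_into_rtrancl)
    then show ?case using hor[OF V \<open>z \<in> M1 {v}\<close>] by (meson rtrancl_trans)
  qed
  then show ?thesis using y xx by blast
qed

text \<open>
  The side of the wall \<open>e \<times> K\<close>, where \<open>e = {a, b}\<close> and \<open>K\<close> is a component of \<open>lk e\<close>, that contains a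
  given vertex, with \<open>True\<close> for the side of \<open>a\<close>. Above \<open>K\<close>, it is read off in \<open>T1\<close>. Every other vertex
  \<open>w\<close> of \<open>T2\<close> is separated from \<open>K\<close> by a unique edge \<open>{u, v}\<close> with just one end in \<open>K\<close>. The tree
  \<open>M1 {u, v}\<close> does not contain \<open>e\<close>, so it is on one side of \<open>e\<close>, and everything beyond is put on
  that side.
\<close>

definition side where
  "side a b K = (\<lambda>(y, w). if w \<in> K then y \<in> half T1 b a else
     (\<exists>u \<in> K. \<exists>v. v \<notin> K \<and> {u, v} \<in> edges T2 \<and> w \<in> half T2 u v \<and> M1 {u, v} \<subseteq> half T1 b a))"

lemma exit_unique:
  assumes K: "t2.conv K" and uv: "{u, v} \<in> edges T2" "u \<in> K" "v \<notin> K"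
    and uv': "{u', v'} \<in> edges T2" "u' \<in> K" "v' \<notin> K" and w: "w \<in> half T2 u v" "w \<in> half T2 u' v'"
  shows "u' = u \<and> v' = v"
proof (rule ccontr)
  assume ne: "\<not> (u' = u \<and> v' = v)"
  have vu: "{v, u} \<in> edges T2" "{v', u'} \<in> edges T2" using uv uv' by (auto simp: insert_commute)
  have sub: "K \<subseteq> half T2 v u" "K \<subseteq> half T2 v' u'"
    using t2.conv_one_side[OF K vu(1)] t2.conv_one_side[OF K vu(2)] uv uv' t2.half_self by blast+
  have "v \<notin> half T2 u' v'"
  proof
    assume v: "v \<in> half T2 u' v'"
    have "u \<notin> half T2 u' v'" using sub uv t2.half_disjoint[OF uv'(1)] by blast
    then show False using t2.half_crossing[OF uv'(1) vu(1) v] ne by blast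
  qed
  then have "half T2 u' v' \<subseteq> half T2 v u"
    using t2.half_nested[OF vu(1) uv'(1)] sub uv' by blast
  then show False using w t2.half_disjoint[OF uv(1)] by blast
qed

lemma side_R:
  assumes ab: "{a, b} \<in> edges T1" and w0: "w0 \<in> verts T2" and K: "K = cls (lk {a, b}) w0"
    and xx: "(x, x') \<in> R"
  shows "side a b K x = side a b K x'"
proof -
  have ba: "{b, a} \<in> edges T1" using ab by (simp add: insert_commute)
  have Kc: "t2.conv K" unfolding K by (rule lk_cls_conv[OF w0])
  have one: "side a b K (y, w) = side a b K (y, w')"
    if ww: "{w, w'} \<in> edges T2" "y \<in> M1 {w, w'}" and in_out: "w \<in> K" "w' \<notin> K" for y w w'
  proof -
    have nsub: "\<not> {a, b} \<subseteq> M1 {w, w'}" using lk_cls_leave ww(1) in_out unfolding K by blast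
    then have "z \<in> half T1 b a \<longleftrightarrow> y \<in> half T1 b a" if "z \<in> M1 {w, w'}" for z
      using t1.conv_one_side[OF M1_conv ba _ that ww(2)] by blast
    then have "M1 {w, w'} \<subseteq> half T1 b a \<longleftrightarrow> y \<in> half T1 b a" using ww(2) by blast
    moreover have "side a b K (y, w') \<longleftrightarrow> M1 {w, w'} \<subseteq> half T1 b a"
      using exit_unique[OF Kc ww(1) in_out] t2.half_self[of w' w] ww(1) in_out unfolding side_def by auto
    ultimately show ?thesis using in_out by (simp add: side_def)
  qed
  obtain y w w' where eq: "x = (y, w)" "x' = (y, w')" and ww: "{w, w'} \<in> edges T2" "y \<in> M1 {w, w'}"
    using xx by (auto simp: R_def)
  have ww': "{w', w} \<in> edges T2" "y \<in> M1 {w', w}" using ww by (auto simp: insert_commute)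
  consider "w \<in> K" "w' \<in> K" | "w \<in> K" "w' \<notin> K" | "w \<notin> K" "w' \<in> K" | "w \<notin> K" "w' \<notin> K" by blast
  then show ?thesis
  proof cases
    case 1
    then show ?thesis by (simp add: side_def eq)
  next
    case 2
    then show ?thesis using one[OF ww] eq by simp
  next
    case 3
    then show ?thesis using one[OF ww'] eq by simp
  next
    case 4
    have "w \<in> half T2 u v \<longleftrightarrow> w' \<in> half T2 u v" if "{u, v} \<in> edges T2" "u \<in> K" for u v
      using t2.half_crossing[OF that(1) ww(1)] t2.half_crossing[OF that(1) ww'(1)] that(2) 4 by blast
    then show ?thesis using 4 unfolding eq side_def by auto
  qed
qed

lemma side_D:
  assumes ab: "{a, b} \<in> edges T1" and "((y, w), (y', w)) \<in> D" and ne: "side a b K (y, w) \<noteq> side a b K (y', w)"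
  shows "w \<in> K \<and> {y, y'} = {a, b}"
proof -
  have ba: "{b, a} \<in> edges T1" using ab by (simp add: insert_commute)
  have yy: "{y, y'} \<in> edges T1" "{y', y} \<in> edges T1" using assms(2) by (auto simp: D_def insert_commute)
  have "w \<in> K" using ne by (auto simp: side_def split: if_splits)
  then have "(y \<in> half T1 b a) \<noteq> (y' \<in> half T1 b a)" using ne by (simp add: side_def)
  then show ?thesis using t1.half_crossing[OF ba yy(1)] t1.half_crossing[OF ba yy(2)] \<open>w \<in> K\<close> by blast
qed

lemma edge_cls_eq:
  assumes "a' = a" "b' = b" "w' \<in> cls (lk {a, b}) w"
  shows "cls R (a', w') = cls R (a, w)" "cls R (b', w') = cls R (b, w)"
proof -
  have "(w', w) \<in> (lk {a, b})\<^sup>*" using assms(3) rtrancl_sym_swap[OF sym_lk] by (simp add: cls_def)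
  then have "(w', w) \<in> (lk {a})\<^sup>*" "(w', w) \<in> (lk {b})\<^sup>*" using lk_mono[of "{_}" "{a, b}"] by blast+
  then show "cls R (a', w') = cls R (a, w)" "cls R (b', w') = cls R (b, w)"
    using assms cls_R_eq_iff by auto
qed

sublocale Q: tree_quotient X R D
proof
  obtain w where w: "w \<in> verts T2" using t2.verts_nonempty by blast
  then show "X \<noteq> {}" using M1_nonempty[OF vertex_simplex[OF w]] by (auto simp: X_def)
  show "R \<subseteq> X \<times> X" "D \<subseteq> X \<times> X" "sym R" "sym D" by (rule RX DX symR symD)+
  show "(x, y) \<in> (R \<union> D)\<^sup>*" if "x \<in> X" "y \<in> X" for x y by (rule X_connected[OF that])
  fix x x' assume xx: "(x, x') \<in> D"
  then obtain a b w where eq: "x = (a, w)" "x' = (b, w)" and ab: "{a, b} \<in> edges T1" and w: "w \<in> verts T2"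
    by (auto simp: D_def)
  have ba: "{b, a} \<in> edges T1" using ab by (simp add: insert_commute)
  let ?K = "cls (lk {a, b}) w"
  let ?s = "side a b ?K"
  have "?s x" "\<not> ?s x'"
    using t1.half_self t1.bridge[OF ba] cls_self[of w] by (simp_all add: eq side_def)
  moreover have "?s u = ?s v" if "(u, v) \<in> R" for u v by (rule side_R[OF ab w refl that])
  moreover have "{cls R u, cls R v} = {cls R x, cls R x'}" if uv: "(u, v) \<in> D" "?s u \<noteq> ?s v" for u v
  proof -
    obtain y y' w' where uv': "u = (y, w')" "v = (y', w')" using uv(1) by (auto simp: D_def)
    have 1: "w' \<in> ?K" "{y, y'} = {a, b}" using side_D[OF ab, of y w' y'] uv unfolding uv' by blast+
    then have "y = a \<and> y' = b \<or> y = b \<and> y' = a" by (auto simp: doubleton_eq_iff)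
    then show ?thesis using edge_cls_eq[OF refl refl 1(1)] unfolding uv' eq by auto
  qed
  ultimately show "\<exists>s. s x \<and> \<not> s x' \<and> (\<forall>u v. (u, v) \<in> R \<longrightarrow> s u = s v) \<and>
      (\<forall>u v. (u, v) \<in> D \<longrightarrow> s u \<noteq> s v \<longrightarrow> {cls R u, cls R v} = {cls R x, cls R x'})"
    by (intro exI[of _ ?s]) blast
qed

text \<open>
  Conversely, an edge of the quotient determines the component of \<open>lk e\<close> that it comes from: the wall
  above that component separates \<open>(a, w')\<close> from \<open>(b, w')\<close> only if \<open>w'\<close> is in the component.
\<close>

lemma edge_cls_eqD:
  assumes ab: "((a, w), (b, w)) \<in> D" and w': "w' \<in> verts T2"
    and eq: "cls R (a, w') = cls R (a, w)" "cls R (b, w') = cls R (b, w)"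
  shows "w' \<in> cls (lk {a, b}) w"
proof -
  let ?K = "cls (lk {a, b}) w"
  let ?s = "side a b ?K"
  have E: "{a, b} \<in> edges T1" "{b, a} \<in> edges T1" "w \<in> verts T2" using ab by (auto simp: D_def insert_commute)
  have "?s (a, w)" "\<not> ?s (b, w)"
    using t1.half_self t1.bridge[OF E(2)] cls_self[of w] by (simp_all add: side_def)
  moreover have "?s (a, w') = ?s (a, w)" "?s (b, w') = ?s (b, w)"
    using invariant_on_cls[of R ?s] side_R[OF E(1,3) refl] eq cls_eq_iff[OF symR] by blast+
  ultimately have "?s (a, w') \<noteq> ?s (b, w')" by simp
  then show ?thesis by (auto simp: side_def split: if_splits)
qed

definition pact where "pact g = (\<lambda>(y, w). (\<phi>1 g y, \<phi>2 g w))"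

sublocale Q: tree_quotient_action X R D G pact
proof
  fix g assume g: "g \<in> carrier G"
  have M1g: "\<phi>1 g y \<in> M1 (\<phi>2 g ` \<tau>)" if "y \<in> M1 \<tau>" "\<tau> \<subseteq> verts T2" for y \<tau>
    using M1_act[OF g that(2)] that(1) by blast
  show "pact g x \<in> X" if "x \<in> X" for x
    using that M1g[of _ "{_}"] t2.act_closed[OF g] by (auto simp: X_def pact_def)
  show "(pact g x, pact g y) \<in> R" if xy: "(x, y) \<in> R" for x y
  proof -
    obtain a w w' where eq: "x = (a, w)" "y = (a, w')" "{w, w'} \<in> edges T2" "a \<in> M1 {w, w'}"
      using xy by (auto simp: R_def)
    then show ?thesis using M1g[of a "{w, w'}"] t2.edge_act[OF g] t2.edge_verts by (simp add: R_def pact_def)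
  qed
  show "(pact g x, pact g y) \<in> D" if "(x, y) \<in> D" for x y
    using that M1g[of _ "{_}"] t2.act_closed[OF g] t1.edge_act[OF g] by (auto simp: D_def pact_def)
  show "cls R (pact g y) \<noteq> cls R x" if xy: "(x, y) \<in> D" and gx: "cls R (pact g x) = cls R y" for x y
  proof
    assume gy: "cls R (pact g y) = cls R x"
    obtain a b w where eq: "x = (a, w)" "y = (b, w)" and ab: "{a, b} \<in> edges T1"
      using xy by (auto simp: D_def)
    have "\<phi>1 g a = b" "\<phi>1 g b = a"
      using gx gy unfolding eq pact_def prod.case cls_R_eq_iff by auto
    then show False using t1.no_inversion[OF g ab] by blast
  qed
qed (auto simp: pact_def X_def t1.act_mult t2.act_mult t1.act_one t2.act_one subsetD[OF M1_verts])

sublocale QT: tree_action G "quot_graph X R D" Q.quot_act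
  by (rule Q.tree_action_quot)

text \<open>The map to \<open>T1\<close>. Contracted edges are vertical, so any representative of the class will do.\<close>

definition pr where "pr A = fst (SOME x. x \<in> A)"

lemma pr_cls: "pr (cls R (y, w)) = y"
proof -
  have "(SOME x. x \<in> cls R (y, w)) \<in> cls R (y, w)" by (rule someI) (rule cls_self)
  then show ?thesis unfolding pr_def cls_def by (metis Image_singleton_iff R_rtrancl prod.collapse)
qed

abbreviation QG where "QG \<equiv> quot_graph X R D"

lemma QG_vertexE:
  assumes "A \<in> verts QG" obtains w where "A = cls R (pr A, w)" "w \<in> verts T2" "pr A \<in> M1 {w}" "pr A \<in> verts T1"
proof -
  obtain y w where "A = cls R (y, w)" "w \<in> verts T2" "y \<in> M1 {w}" using assms by (auto simp: X_def)
  then show ?thesis using that[of w] M1_verts pr_cls by auto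
qed

lemma QG_edgeE:
  assumes "{A, B} \<in> edges QG"
  obtains w where "A = cls R (pr A, w)" "B = cls R (pr B, w)" "((pr A, w), (pr B, w)) \<in> D"
proof -
  have "(A, B) \<in> adj QG" using assms by (simp add: adj_def)
  then obtain a b w where "A = cls R (a, w)" "B = cls R (b, w)" "((a, w), (b, w)) \<in> D"
    unfolding adj_quot_graph[OF symD] by (auto simp: D_def)
  then show ?thesis using that pr_cls by metis
qed

lemma pr_edge: "{A, B} \<in> edges QG \<Longrightarrow> {pr A, pr B} \<in> edges T1"
  by (erule QG_edgeE) (simp add: D_def)

lemma pr_act: assumes g: "g \<in> carrier G" and A: "A \<in> verts QG" shows "pr (Q.quot_act g A) = \<phi>1 g (pr A)"
proof -
  obtain w where w: "A = cls R (pr A, w)" "w \<in> verts T2" "pr A \<in> M1 {w}"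
    by (rule QG_vertexE[OF A]) (rule that)
  then have "(pr A, w) \<in> X" by (simp add: X_def)
  from Q.quot_act_cls[OF g this] have "Q.quot_act g A = cls R (\<phi>1 g (pr A), \<phi>2 g w)"
    using w(1) by (simp add: pact_def)
  then show ?thesis by (simp add: pr_cls)
qed

definition Mq where "Mq = QT.minv (carrier G)"

lemma Mq_conv: "QT.conv Mq"
  unfolding Mq_def by (rule QT.minv_conv) simp

lemma Mq_verts: "Mq \<subseteq> verts QG"
  using Mq_conv unfolding QT.conv_def by blast

lemma ex_fixed_point_free:
  assumes "edges T1 \<noteq> {}" shows "\<exists>h \<in> carrier G. \<forall>A \<in> verts QG. Q.quot_act h A \<noteq> A"
proof -
  have E2: "edges T2 \<noteq> {}" by (rule edges2_nonempty[OF assms])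
  then obtain f where f: "f \<in> edges T2" by blast
  obtain h where h: "h \<in> t2.fixer f" "\<And>v. v \<in> verts T1 \<Longrightarrow> \<phi>1 h v \<noteq> v"
    using fixer_fixed_point_free[OF E2 edge_simplex[OF f]] by blast
  have hG: "h \<in> carrier G" using h t2.fixer_subset by blast
  have "Q.quot_act h A \<noteq> A" if A: "A \<in> verts QG" for A
  proof
    assume "Q.quot_act h A = A"
    then have "\<phi>1 h (pr A) = pr A" using pr_act[OF hG A] by simp
    then show False using h(2) QG_vertexE[OF A] by metis
  qed
  then show ?thesis using hG by blast
qed

lemma Mq_nonempty: assumes "edges T1 \<noteq> {}" shows "Mq \<noteq> {}"
  using ex_fixed_point_free[OF assms] QT.minv_edge_ex[OF t1.subgroup_self] unfolding Mq_def by blast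

text \<open>
  Each edge of \<open>Mq\<close> is shifted by some element, so \<open>G\<close> splits over its stabilizer, which therefore has
  finite index in the stabilizer of the edge \<open>e\<close> of \<open>T1\<close> below it. So every element of the latter has
  a power that preserves the component of \<open>lk e\<close> in question.
\<close>

lemma Mq_edge:
  assumes AB: "{A, B} \<in> edges QG" "A \<in> Mq" "B \<in> Mq" and w: "A = cls R (a, w)" "B = cls R (b, w)" "((a, w), (b, w)) \<in> D"
  shows "M2 {a, b} \<subseteq> cls (lk {a, b}) w"
proof (rule M2_subset_lk_cls)
  have ab: "{a, b} \<in> edges T1" and wV: "w \<in> verts T2" using w(3) by (auto simp: D_def)
  then have E1: "edges T1 \<noteq> {}" by blast
  then show "edges T2 \<noteq> {}" by (rule edges2_nonempty)
  show "{a, b} \<in> simplices T1" using ab by (simp add: simplices_def)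
  show "w \<in> verts T2" by fact
  fix h assume h: "h \<in> t1.fixer {a, b}"
  obtain k where k: "k \<in> carrier G" "\<And>A. A \<in> verts QG \<Longrightarrow> Q.quot_act k A \<noteq> A"
    using ex_fixed_point_free[OF E1] by blast
  obtain g where g: "g \<in> carrier G" "QT.shifts g A B"
    using QT.minv_edge_shifted[OF t1.subgroup_self k AB(1)] AB unfolding Mq_def by blast
  have "splits_over G (edge_stab G Q.quot_act {A, B})" by (rule QT.shifted_edge_splits[OF AB(1) g])
  then have fin: "\<not> infinite_index_subgroup G (edge_stab G \<phi>1 {a, b}) (edge_stab G Q.quot_act {A, B})"
    using no_split1[OF ab] by blast
  have stabs: "edge_stab G \<phi>1 {a, b} = t1.fixer {a, b}" "edge_stab G Q.quot_act {A, B} = QT.fixer {A, B}"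
    using t1.edge_stab_eq[OF ab] QT.edge_stab_eq[OF AB(1)] by auto
  have V: "A \<in> verts QG" "B \<in> verts QG" "a \<in> verts T1" "b \<in> verts T1"
    using QT.edge_verts[OF AB(1)] t1.edge_verts[OF ab] by auto
  have AB_fix: "\<phi>1 g a = a \<and> \<phi>1 g b = b \<and> cls R (a, \<phi>2 g w) = cls R (a, w) \<and> cls R (b, \<phi>2 g w) = cls R (b, w)"
    if g: "g \<in> QT.fixer {A, B}" for g
  proof -
    have gG: "g \<in> carrier G" using g QT.fixer_subset by blast
    have "Q.quot_act g A = A" "Q.quot_act g B = B" using g by (auto simp: QT.fixer_def)
    then have "cls R (\<phi>1 g a, \<phi>2 g w) = cls R (a, w)" "cls R (\<phi>1 g b, \<phi>2 g w) = cls R (b, w)"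
      using Q.quot_act_cls[OF gG, of "(a, w)"] Q.quot_act_cls[OF gG, of "(b, w)"] w DX by (auto simp: pact_def)
    then show ?thesis using cls_R_eq_iff by metis
  qed
  have "subgroup (t1.fixer {a, b}) G" using t1.subgroup_fixer V by simp
  moreover have "subgroup (QT.fixer {A, B}) G" using QT.subgroup_fixer V by simp
  moreover have "QT.fixer {A, B} \<subseteq> t1.fixer {a, b}"
    using AB_fix subsetD[OF QT.fixer_subset] by (auto simp: t1.fixer_def)
  ultimately obtain m :: nat where m: "m > 0" "h [^] m \<in> QT.fixer {A, B}"
    using t1.power_in_finite_index[OF _ _ _ _ h] fin unfolding stabs by blast
  have "h [^] m \<in> carrier G" using m QT.fixer_subset by blast
  then have "\<phi>2 (h [^] m) w \<in> cls (lk {a, b}) w"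
    using edge_cls_eqD[OF w(3)] AB_fix[OF m(2)] t2.act_closed[OF _ wV] by blast
  then show "\<exists>m>0. \<phi>2 (h [^] (m::nat)) w \<in> cls (lk {a, b}) w" using m by blast
qed

lemma M2_nonempty: assumes "\<sigma> \<in> simplices T1" shows "M2 \<sigma> \<noteq> {}"
proof -
  interpret S: tree_pair G T2 \<phi>2 T1 \<phi>1 by (rule swap)
  show ?thesis using S.M1_nonempty[OF assms] by (simp add: S.M1_def M2_def)
qed

lemma Mq_edge_unique:
  assumes "{A, B} \<in> edges QG" "A \<in> Mq" "B \<in> Mq" and "{A', B'} \<in> edges QG" "A' \<in> Mq" "B' \<in> Mq"
    and pr: "pr A' = pr A" "pr B' = pr B"
  shows "A' = A \<and> B' = B"
proof -
  let ?e = "{pr A, pr B}"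
  obtain w where w: "A = cls R (pr A, w)" "B = cls R (pr B, w)" "((pr A, w), (pr B, w)) \<in> D"
    using QG_edgeE[OF assms(1)] by blast
  obtain w' where w': "A' = cls R (pr A, w')" "B' = cls R (pr B, w')" "((pr A, w'), (pr B, w')) \<in> D"
    using QG_edgeE[OF assms(4)] pr by metis
  have "?e \<in> simplices T1" using pr_edge[OF assms(1)] by (simp add: simplices_def)
  then obtain u where "u \<in> M2 ?e" using M2_nonempty by blast
  then have "u \<in> cls (lk ?e) w" "u \<in> cls (lk ?e) w'"
    using Mq_edge[OF assms(1-3) w] Mq_edge[OF assms(4-6) w'] by blast+
  then have "w' \<in> cls (lk ?e) w" using lk_cls_eq cls_self by metis
  then show ?thesis using edge_cls_eq[OF refl refl] w w' by metis
qed

text \<open>So \<open>Mq\<close> maps injectively to \<open>T1\<close>: an edge that separates two of its vertices separates their images.\<close>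

lemma Mq_pr_inj:
  assumes A: "A \<in> Mq" and A': "A' \<in> Mq" and pr: "pr A = pr A'"
  shows "A = A'"
proof (rule ccontr)
  assume ne: "A \<noteq> A'"
  obtain B where B: "{A, B} \<in> edges QG" "A' \<in> half QG A B"
    using QT.first_edge[of A A'] Mq_verts A A' ne by blast
  then have "{A, B} \<in> QT.sep A A'" unfolding QT.sep_def using QT.half_self by blast
  then have BM: "B \<in> Mq" using QT.convD[OF Mq_conv A A'] by blast
  let ?a = "pr A" and ?b = "pr B"
  have ab: "{?a, ?b} \<in> edges T1" by (rule pr_edge[OF B(1)])
  have "(C \<in> half QG A B \<longleftrightarrow> pr C \<in> half T1 ?a ?b) \<longleftrightarrow> (C' \<in> half QG A B \<longleftrightarrow> pr C' \<in> half T1 ?a ?b)"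
    if CC: "{C, C'} \<in> edges QG" "C \<in> Mq" "C' \<in> Mq" for C C'
  proof -
    have CC': "{C', C} \<in> edges QG" using CC by (simp add: insert_commute)
    have p: "{pr C, pr C'} \<in> edges T1" "{pr C', pr C} \<in> edges T1" using pr_edge CC CC' by auto
    have "(C \<in> half QG A B) \<noteq> (C' \<in> half QG A B) \<longleftrightarrow> {C, C'} = {A, B}"
      using QT.half_crossing[OF B(1) CC(1)] QT.half_crossing[OF B(1) CC'] QT.half_self QT.bridge[OF B(1)]
      by (auto simp: doubleton_eq_iff)
    moreover have "(pr C \<in> half T1 ?a ?b) \<noteq> (pr C' \<in> half T1 ?a ?b) \<longleftrightarrow> {pr C, pr C'} = {?a, ?b}"
      using t1.half_crossing[OF ab p(1)] t1.half_crossing[OF ab p(2)] t1.half_self t1.bridge[OF ab]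
      by (auto simp: doubleton_eq_iff)
    moreover have "{C, C'} = {A, B}" if "{pr C, pr C'} = {?a, ?b}"
    proof -
      have "pr C = ?a \<and> pr C' = ?b \<or> pr C' = ?a \<and> pr C = ?b" using that by (auto simp: doubleton_eq_iff)
      then show ?thesis
        using Mq_edge_unique[OF B(1) A BM CC] Mq_edge_unique[OF B(1) A BM CC' CC(3,2)] by blast
    qed
    moreover have "{pr C, pr C'} = {?a, ?b}" if "{C, C'} = {A, B}" using that by (auto simp: doubleton_eq_iff)
    ultimately show ?thesis by blast
  qed
  then have "(A \<in> half QG A B \<longleftrightarrow> pr A \<in> half T1 ?a ?b) \<longleftrightarrow> (A' \<in> half QG A B \<longleftrightarrow> pr A' \<in> half T1 ?a ?b)"
    using invariant_on_cls[of "adj QG \<inter> Mq \<times> Mq" "\<lambda>C. C \<in> half QG A B \<longleftrightarrow> pr C \<in> half T1 ?a ?b" A A']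
      QT.conv_connected[OF Mq_conv A A'] by (auto simp: adj_def simp del: quot_graph_simps)
  then show False using B QT.bridge[OF B(1)] pr by simp
qed

text \<open>
  Some element shifts \<open>{a, b}\<close>; its powers take a vertex of \<open>Mq\<close> to both sides of this edge, so a
  walk in the connected set \<open>Mq\<close> has to cross the edge.
\<close>

lemma Mq_pr_surj:
  assumes ab: "{a, b} \<in> edges T1"
  shows "\<exists>A B. {A, B} \<in> edges QG \<and> A \<in> Mq \<and> B \<in> Mq \<and> pr A = a \<and> pr B = b"
proof -
  have E1: "edges T1 \<noteq> {}" using ab by blast
  have ba: "{b, a} \<in> edges T1" using ab by (simp add: insert_commute)
  obtain f where f: "f \<in> edges T2" using edges2_nonempty[OF E1] by blast
  obtain h where h: "h \<in> t2.fixer f" "\<And>v. v \<in> verts T1 \<Longrightarrow> \<phi>1 h v \<noteq> v"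
    using fixer_fixed_point_free[OF edges2_nonempty[OF E1] edge_simplex[OF f]] by blast
  have hG: "h \<in> carrier G" using h t2.fixer_subset by blast
  obtain g where g: "g \<in> carrier G" "t1.shifts g a b"
    using t1.minv_edge_shifted[OF t1.subgroup_self hG h(2) ab] t1.minimal_action_minv[OF minimal1]
      t1.edge_verts[OF ab] by auto
  obtain A0 where A0: "A0 \<in> Mq" using Mq_nonempty[OF E1] by blast
  have pV: "pr A0 \<in> verts T1" using A0 Mq_verts QG_vertexE by blast
  have orb: "\<exists>A \<in> Mq. pr A = \<phi>1 k (pr A0)" if k: "k \<in> carrier G" for k
    using QT.minv_invariant[of k "carrier G"] k A0 pr_act[OF k, of A0] Mq_verts unfolding Mq_def by blast
  obtain m :: nat where "\<phi>1 (g [^] m) (pr A0) \<in> half T1 a b"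
    using t1.shifts_absorbs[OF g(1) ab g(2) pV] by blast
  then obtain A' where A': "A' \<in> Mq" "pr A' \<in> half T1 a b" using orb[of "g [^] m"] g by auto
  obtain n :: nat where "\<phi>1 (inv g [^] n) (pr A0) \<in> half T1 b a"
    using t1.shifts_absorbs[OF t1.inv_closed[OF g(1)] ba t1.shifts_inv[OF g(1) ab g(2)] pV] by blast
  then obtain A where A: "A \<in> Mq" "pr A \<in> half T1 b a" using orb[of "inv g [^] n"] g by auto
  let ?P = "{C. pr C \<in> half T1 b a}"
  have "A' \<notin> ?P" using A' t1.half_disjoint[OF ab] by blast
  then obtain C C' where "(C, C') \<in> adj QG \<inter> Mq \<times> Mq" "C \<in> ?P" "C' \<notin> ?P"
    using rtrancl_crosses[OF QT.conv_connected[OF Mq_conv A(1) A'(1)], of ?P] A(2) by blast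
  then have C: "{C, C'} \<in> edges QG" "C \<in> Mq" "C' \<in> Mq" "pr C \<in> half T1 b a" "pr C' \<notin> half T1 b a"
    by (auto simp: adj_def simp del: quot_graph_simps)
  then have "pr C = a \<and> pr C' = b" using t1.half_crossing[OF ba pr_edge[OF C(1)]] by blast
  then show ?thesis using C by blast
qed

text \<open>
  For an edge, take any component that occurs in \<open>Mq\<close>. For a vertex, the component is given by the
  vertex of \<open>Mq\<close> above it; being unique, this is fixed by the whole stabilizer.
\<close>

lemma M2_subset_lk:
  assumes s: "\<sigma> \<in> simplices T1" and "edges T1 \<noteq> {}"
  shows "\<exists>w. w \<in> verts T2 \<and> \<sigma> \<subseteq> M1 {w} \<and> M2 \<sigma> \<subseteq> cls (lk \<sigma>) w"
  using s
proof (cases rule: t1.simplexE)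
  case (2 a b)
  obtain A B where AB: "{A, B} \<in> edges QG" "A \<in> Mq" "B \<in> Mq" "pr A = a" "pr B = b"
    using Mq_pr_surj[OF 2(1)] by blast
  obtain w where w: "A = cls R (a, w)" "B = cls R (b, w)" "((a, w), (b, w)) \<in> D"
    using QG_edgeE[OF AB(1)] AB(4,5) by metis
  then show ?thesis using Mq_edge[OF AB(1-3) w] 2 by (auto simp: D_def)
next
  case (1 v)
  obtain c d where cd: "{c, d} \<in> edges T1" "c \<noteq> d" using assms(2) by (metis all_not_in_conv t1.edgeE)
  then obtain u where "u \<in> verts T1" "v \<noteq> u" using t1.edge_verts by metis
  then obtain x where x: "{v, x} \<in> edges T1" using t1.first_edge[OF 1(1)] by blast
  obtain A where A: "A \<in> Mq" "pr A = v" using Mq_pr_surj[OF x] by blast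
  obtain w where w: "A = cls R (v, w)" "w \<in> verts T2" "v \<in> M1 {w}"
    by (rule QG_vertexE[OF subsetD[OF Mq_verts A(1)]]) (use A(2) in blast)
  have "M2 {v} \<subseteq> cls (lk {v}) w"
  proof (rule M2_subset_lk_cls)
    show "{v} \<in> simplices T1" using s 1 by simp
    show "w \<in> verts T2" "edges T2 \<noteq> {}" using w edges2_nonempty[OF assms(2)] by auto
    fix h assume h: "h \<in> t1.fixer {v}"
    then have hG: "h \<in> carrier G" "\<phi>1 h v = v" by (auto simp: t1.fixer_def)
    have AV: "A \<in> verts QG" using A Mq_verts by blast
    have "Q.quot_act h A \<in> Mq" using QT.minv_invariant[of h "carrier G"] hG A unfolding Mq_def by blast
    moreover have "pr (Q.quot_act h A) = pr A" using pr_act[OF hG(1) AV] A hG by simp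
    ultimately have "Q.quot_act h A = A" using Mq_pr_inj A by blast
    then have "cls R (v, \<phi>2 h w) = cls R (v, w)"
      using Q.quot_act_cls[OF hG(1), of "(v, w)"] w hG by (simp add: pact_def X_def)
    then have "(w, \<phi>2 h w) \<in> (lk {v})\<^sup>*" using cls_R_eq_iff by metis
    then have "\<phi>2 (h [^] Suc 0) w \<in> cls (lk {v}) w" using hG by (simp add: cls_def)
    then show "\<exists>m>0. \<phi>2 (h [^] (m::nat)) w \<in> cls (lk {v}) w" by blast
  qed
  then show ?thesis using w 1 by auto
qed

lemma M2_imp_M1:
  assumes s: "\<sigma> \<in> simplices T1" and t: "\<tau> \<in> simplices T2" and sub: "\<tau> \<subseteq> M2 \<sigma>"
  shows "\<sigma> \<subseteq> M1 \<tau>"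
proof (cases "edges T1 = {}")
  case True
  then show ?thesis using M1_no_edges t1.simplex_facts[OF s] by simp
next
  case False
  obtain w where w: "w \<in> verts T2" "\<sigma> \<subseteq> M1 {w}" "M2 \<sigma> \<subseteq> cls (lk \<sigma>) w"
    using M2_subset_lk[OF s False] by blast
  from t show ?thesis
  proof (cases rule: t2.simplexE)
    case (1 v)
    then show ?thesis using lk_cls_M1[OF w(2)] sub w(3) by auto
  next
    case (2 c d)
    then show ?thesis using lk_cls_edge[of c \<sigma> w d] sub w(3) by auto
  qed
qed

end

lemma (in tree_pair) M1_iff_M2:
  assumes s: "\<sigma> \<in> simplices T1" and t: "\<tau> \<in> simplices T2"
  shows "\<sigma> \<subseteq> M1 \<tau> \<longleftrightarrow> \<tau> \<subseteq> M2 \<sigma>"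
proof -
  interpret S: tree_pair G T2 \<phi>2 T1 \<phi>1 by (rule swap)
  have "S.M1 \<sigma> = M2 \<sigma>" "S.M2 \<tau> = M1 \<tau>" by (simp_all add: S.M1_def S.M2_def M1_def M2_def)
  then show ?thesis using M2_imp_M1[OF s t] S.M2_imp_M1[OF t s] by auto
qed

section \<open>The realization of a tree\<close>

context stree
begin

interpretation M: Metric_space "points T" "tree_dist T"
  by (rule Metric_space_tree[OF tree])

lemma topspace_tree_top: "topspace (tree_top T) = points T"
  by (simp add: tree_top_def)

lemma tree_dist_le_chain: assumes "chain T x l y" shows "tree_dist T x y \<le> l"
proof -
  have "bdd_below {l. chain T x l y}"
    using chain_nonneg by (intro bdd_belowI[of _ 0]) auto
  then show ?thesis
    using assms chain_points[OF assms] by (auto simp: tree_dist_def intro: cInf_lower)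
qed

lemma tree_dist_ge:
  assumes "x \<in> points T" "y \<in> points T" "\<And>l. chain T x l y \<Longrightarrow> c \<le> l"
  shows "c \<le> tree_dist T x y"
  using chain_exists[OF tree assms(1,2)] assms by (auto simp: tree_dist_def intro!: cInf_greatest)

lemma sum_over_simplex:
  assumes x: "x \<in> points T" and s: "\<sigma> \<in> simplices T" "supp x \<subseteq> \<sigma>"
  shows "(\<Sum>v \<in> supp x. x v * f v) = (\<Sum>v \<in> \<sigma>. x v * f v)" "(\<Sum>v \<in> \<sigma>. x v) = 1"
proof -
  have fin: "finite \<sigma>" by (rule simplex_facts[OF s(1)])
  show "(\<Sum>v \<in> supp x. x v * f v) = (\<Sum>v \<in> \<sigma>. x v * f v)"
    by (rule sum.mono_neutral_left[OF fin s(2)]) (auto simp: supp_def)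
  have "(\<Sum>v \<in> supp x. x v) = (\<Sum>v \<in> \<sigma>. x v)"
    by (rule sum.mono_neutral_left[OF fin s(2)]) (auto simp: supp_def)
  then show "(\<Sum>v \<in> \<sigma>. x v) = 1" using x by (simp add: points_def supp_def)
qed

text \<open>The affine extension to the realization of a function on the vertices.\<close>

definition aff :: "('v \<Rightarrow> real) \<Rightarrow> ('v \<Rightarrow> real) \<Rightarrow> real" where
  "aff f x = (\<Sum>v \<in> supp x. x v * f v)"

lemma aff_diff:
  assumes x: "x \<in> points T" "supp x \<subseteq> \<sigma>" and y: "y \<in> points T" "supp y \<subseteq> \<sigma>" and s: "\<sigma> \<in> simplices T"
    and f: "\<And>u v. {u, v} \<in> edges T \<Longrightarrow> \<bar>f u - f v\<bar> \<le> 1"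
  shows "\<bar>aff f x - aff f y\<bar> \<le> (SUP v. \<bar>x v - y v\<bar>)"
  using s
proof (cases rule: simplexE)
  case (1 v)
  have "aff f x = aff f y"
    using sum_over_simplex[OF x(1) s x(2)] sum_over_simplex[OF y(1) s y(2)] 1 by (simp add: aff_def)
  moreover have "\<bar>x v - y v\<bar> \<le> (SUP v. \<bar>x v - y v\<bar>)"
    by (rule cSUP_upper[OF UNIV_I bdd_coord_diff[OF x(1) y(1)]])
  ultimately show ?thesis by linarith
next
  case (2 a b)
  have "aff f x = x a * f a + x b * f b" "aff f y = y a * f a + y b * f b" "x a + x b = 1" "y a + y b = 1"
    using sum_over_simplex[OF x(1) s x(2)] sum_over_simplex[OF y(1) s y(2)] 2 by (simp_all add: aff_def)
  moreover from this have "x b = 1 - x a" "y b = 1 - y a" by auto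
  ultimately have "aff f x - aff f y = (x a - y a) * (f a - f b)" by (simp add: algebra_simps)
  then have "\<bar>aff f x - aff f y\<bar> = \<bar>x a - y a\<bar> * \<bar>f a - f b\<bar>" by (simp add: abs_mult)
  also have "\<dots> \<le> \<bar>x a - y a\<bar>" using f[OF 2(1)] by (simp add: mult_left_le)
  also have "\<dots> \<le> (SUP v. \<bar>x v - y v\<bar>)"
    by (rule cSUP_upper[OF UNIV_I bdd_coord_diff[OF x(1) y(1)]])
  finally show ?thesis .
qed

lemma aff_lipschitz:
  assumes f: "\<And>u v. {u, v} \<in> edges T \<Longrightarrow> \<bar>f u - f v\<bar> \<le> 1" and "x \<in> points T" "y \<in> points T"
  shows "\<bar>aff f x - aff f y\<bar> \<le> tree_dist T x y"
proof (rule tree_dist_ge[OF assms(2,3)])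
  fix l assume "chain T x l y"
  then show "\<bar>aff f x - aff f y\<bar> \<le> l"
  proof (induction rule: chain.induct)
    case (chain_step x l y z \<sigma>)
    have "supp y \<subseteq> \<sigma>" "supp z \<subseteq> \<sigma>" using chain_step by (auto simp: supp_def)
    then have "\<bar>aff f y - aff f z\<bar> \<le> (SUP v. \<bar>y v - z v\<bar>)"
      using chain_step chain_points[OF chain_step.hyps(1)] by (intro aff_diff[of y \<sigma> z] f) auto
    then show ?case using chain_step.IH by linarith
  qed simp
qed

lemma openin_aff_gt:
  assumes f: "\<And>u v. {u, v} \<in> edges T \<Longrightarrow> \<bar>f u - f v\<bar> \<le> 1"
  shows "openin (tree_top T) {x \<in> points T. t < aff f x}"
  unfolding tree_top_def M.openin_mtopology
proof (intro conjI allI impI)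
  fix x assume x: "x \<in> {x \<in> points T. t < aff f x}"
  have "M.mball x (aff f x - t) \<subseteq> {x \<in> points T. t < aff f x}"
  proof
    fix y assume "y \<in> M.mball x (aff f x - t)"
    then have y: "y \<in> points T" "tree_dist T x y < aff f x - t" by (auto simp: M.in_mball)
    then show "y \<in> {x \<in> points T. t < aff f x}"
      using aff_lipschitz[of f x y] f x by fastforce
  qed
  then show "\<exists>r>0. M.mball x r \<subseteq> {x \<in> points T. t < aff f x}"
    using x by (intro exI[of _ "aff f x - t"]) auto
qed auto

lemma aff_uminus: "aff (\<lambda>v. - f v) x = - aff f x"
  by (simp add: aff_def sum_negf)

lemma openin_aff_less:
  assumes f: "\<And>u v. {u, v} \<in> edges T \<Longrightarrow> \<bar>f u - f v\<bar> \<le> 1"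
  shows "openin (tree_top T) {x \<in> points T. aff f x < t}"
  using openin_aff_gt[of "\<lambda>v. - f v" "- t"] f by (simp add: aff_uminus abs_minus_commute)

lemma chain_simplex:
  assumes "x \<in> points T" "y \<in> points T" "\<sigma> \<in> simplices T" "supp x \<subseteq> \<sigma>" "supp y \<subseteq> \<sigma>"
  shows "chain T x (SUP v. \<bar>x v - y v\<bar>) y"
  using chain.chain_step[OF chain.chain_refl[OF assms(1)] assms(2,3)] assms(4,5) by (auto simp: supp_def)

lemma sup_diff_le_1:
  assumes "x \<in> points T" "y \<in> points T" shows "(SUP v. \<bar>x v - y v\<bar>) \<le> 1"
proof (rule cSUP_least)
  show "\<bar>x v - y v\<bar> \<le> 1" for v
    using points_le_1[OF assms(1), of v] points_le_1[OF assms(2), of v] by (simp add: abs_le_iff)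
qed simp

lemma tree_dist_simplex:
  assumes "x \<in> points T" "y \<in> points T" "\<sigma> \<in> simplices T" "supp x \<subseteq> \<sigma>" "supp y \<subseteq> \<sigma>"
  shows "tree_dist T x y \<le> 1"
  using tree_dist_le_chain[OF chain_simplex[OF assms]] sup_diff_le_1[OF assms(1,2)] by linarith

lemma supp_indicator: "supp (indicator {v} :: 'v \<Rightarrow> real) = {v}"
  by (auto simp: supp_def indicator_def)

lemma tree_dist_vertices:
  assumes v: "v \<in> verts T" shows "u \<in> verts T \<Longrightarrow> tree_dist T (indicator {u}) (indicator {v}) \<le> tdist u v"
proof (induction "tdist u v" arbitrary: u)
  case 0
  then have "u = v" using v sep_nonempty[of u v] finite_sep[of u v] by (auto simp: tdist_def)
  then show ?case using M.mdist_zero[OF indicator_points[OF v]] by simp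
next
  case (Suc n)
  then have "u \<noteq> v" using v tdist_self by force
  then obtain x where x: "{u, x} \<in> edges T" "v \<in> half T u x" using first_edge Suc v by blast
  then have xV: "x \<in> verts T" using edge_verts by blast
  have d: "tdist u v = Suc (tdist x v)" by (rule tdist_first_edge[OF x])
  have "tree_dist T (indicator {u}) (indicator {x}) \<le> 1"
    using x(1) by (intro tree_dist_simplex[where \<sigma> = "{u, x}"] indicator_points Suc xV)
      (auto simp: supp_indicator simplices_def)
  moreover have "tree_dist T (indicator {x}) (indicator {v}) \<le> tdist x v" using Suc d xV by simp
  moreover have "tree_dist T (indicator {u}) (indicator {v}) \<le>
      tree_dist T (indicator {u}) (indicator {x}) + tree_dist T (indicator {x}) (indicator {v})"
    by (intro M.triangle indicator_points Suc xV v)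
  ultimately show ?case using d by simp
qed

text \<open>
  Up to an error of 2, distances are counted by edges. This is all that is needed to decide whether
  a sequence of distances is unbounded.
\<close>

lemma tree_dist_le_tdist:
  assumes x: "x \<in> points T" "u \<in> supp x" and y: "y \<in> points T" "v \<in> supp y"
  shows "tree_dist T x y \<le> tdist u v + 2"
proof -
  have V: "u \<in> verts T" "v \<in> verts T" using supp_facts x y by blast+
  have "tree_dist T x (indicator {u}) \<le> 1"
    using x by (intro tree_dist_simplex[OF _ indicator_points[OF V(1)] supp_simplex[OF x(1)]]) (auto simp: supp_indicator)
  moreover have "tree_dist T (indicator {v}) y \<le> 1"
    using y by (intro tree_dist_simplex[OF indicator_points[OF V(2)] _ supp_simplex[OF y(1)]]) (auto simp: supp_indicator)
  moreover have "tree_dist T x y \<le> tree_dist T x (indicator {u}) + tree_dist T (indicator {u}) y"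
    "tree_dist T (indicator {u}) y \<le> tree_dist T (indicator {u}) (indicator {v}) + tree_dist T (indicator {v}) y"
    using M.triangle[OF x(1) indicator_points[OF V(1)] y(1)]
      M.triangle[OF indicator_points[OF V(1)] indicator_points[OF V(2)] y(1)] by auto
  ultimately show ?thesis using tree_dist_vertices[OF V(2,1)] by linarith
qed

lemma tree_dist_ge_tdist:
  assumes x: "x \<in> points T" "u \<in> supp x" and y: "y \<in> points T" "v \<in> supp y"
  shows "tdist u v \<le> tree_dist T x y + 2"
proof -
  have V: "u \<in> verts T" "v \<in> verts T" using supp_facts x y by blast+
  define f where "f w = real (tdist w v)" for w
  have f: "\<bar>f a - f b\<bar> \<le> 1" if "{a, b} \<in> edges T" for a b
  proof -
    have ab: "a \<in> verts T" "b \<in> verts T" using edge_verts that by auto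
    have "tdist a b = 1" "tdist b a = 1" using tdist_edge that by (auto simp: insert_commute)
    then show ?thesis
      using tdist_triangle[OF ab V(2)] tdist_triangle[OF ab(2,1) V(2)] by (simp add: f_def)
  qed
  have near: "\<bar>aff f z - f w\<bar> \<le> 1" if z: "z \<in> points T" "w \<in> supp z" for z w
  proof -
    have wV: "w \<in> verts T" using supp_facts z by blast
    have "aff f (indicator {w}) = f w" by (simp add: aff_def supp_indicator)
    moreover have "\<bar>aff f z - aff f (indicator {w})\<bar> \<le> tree_dist T z (indicator {w})"
      by (rule aff_lipschitz[OF f z(1) indicator_points[OF wV]])
    moreover have "tree_dist T z (indicator {w}) \<le> 1"
      using z by (intro tree_dist_simplex[OF _ indicator_points[OF wV] supp_simplex[OF z(1)]]) (auto simp: supp_indicator)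
    ultimately show ?thesis by linarith
  qed
  have "\<bar>aff f x - aff f y\<bar> \<le> tree_dist T x y" by (rule aff_lipschitz[OF f x(1) y(1)])
  moreover have "f v = 0" using tdist_self V by (simp add: f_def)
  moreover have "f u = tdist u v" by (simp add: f_def)
  ultimately show ?thesis using near[OF x] near[OF y] by linarith
qed

subsection \<open>Segments and directions\<close>

definition seg :: "('v \<Rightarrow> real) \<Rightarrow> ('v \<Rightarrow> real) \<Rightarrow> real \<Rightarrow> 'v \<Rightarrow> real" where
  "seg x z s = (\<lambda>v. (1 - s) * x v + s * z v)"

lemma seg_points:
  assumes x: "x \<in> points T" "supp x \<subseteq> \<sigma>" and z: "z \<in> points T" "supp z \<subseteq> \<sigma>" and s: "\<sigma> \<in> simplices T"
    and t: "0 \<le> t" "t \<le> 1"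
  shows "seg x z t \<in> points T \<and> supp (seg x z t) \<subseteq> \<sigma>"
proof -
  have sub: "supp (seg x z t) \<subseteq> \<sigma>"
  proof
    fix v assume "v \<in> supp (seg x z t)"
    then have "x v \<noteq> 0 \<or> z v \<noteq> 0" by (auto simp: supp_def seg_def)
    then show "v \<in> \<sigma>" using x z by (auto simp: supp_def)
  qed
  have nonneg: "0 \<le> seg x z t v" for v using x z t by (simp add: seg_def points_def)
  have sum1: "(\<Sum>v \<in> \<sigma>. seg x z t v) = 1"
    using sum_over_simplex(2)[OF x(1) s x(2)] sum_over_simplex(2)[OF z(1) s z(2)]
    by (simp add: seg_def sum.distrib flip: sum_distrib_left)
  have "(\<Sum>v \<in> supp (seg x z t). seg x z t v) = (\<Sum>v \<in> \<sigma>. seg x z t v)"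
    by (rule sum.mono_neutral_left[OF simplex_facts(3)[OF s] sub]) (auto simp: supp_def)
  then have sum: "(\<Sum>v \<in> supp (seg x z t). seg x z t v) = 1" using sum1 by simp
  moreover have "supp (seg x z t) \<in> simplices T"
    using s
  proof (cases rule: simplexE)
    case (1 v)
    have "supp (seg x z t) \<noteq> {}" using sum by auto
    then show ?thesis using sub 1 s by (simp add: subset_singleton_iff)
  next
    case (2 a b)
    have "supp (seg x z t) \<noteq> {}" using sum by auto
    then have "supp (seg x z t) = {a} \<or> supp (seg x z t) = {b} \<or> supp (seg x z t) = {a, b}"
      using sub 2 by auto
    then show ?thesis using s 2 edge_verts[OF 2(1)] by (auto simp: simplices_def)
  qed
  ultimately show ?thesis using sub nonneg by (simp add: points_def supp_def)
qed

lemma continuous_seg: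
  assumes x: "x \<in> points T" "supp x \<subseteq> \<sigma>" and z: "z \<in> points T" "supp z \<subseteq> \<sigma>" and s: "\<sigma> \<in> simplices T"
  shows "continuous_map (top_of_set {0..1}) (tree_top T) (seg x z)"
  unfolding tree_top_def M.continuous_map_to_metric
proof (intro ballI allI impI)
  fix t e :: real assume t: "t \<in> topspace (top_of_set {0..1})" and e: "0 < e"
  have t01: "0 \<le> t" "t \<le> 1" using t by auto
  have close: "tree_dist T (seg x z t) (seg x z r) \<le> \<bar>t - r\<bar>" if r: "0 \<le> r" "r \<le> 1" for r
  proof -
    have "tree_dist T (seg x z t) (seg x z r) \<le> (SUP v. \<bar>seg x z t v - seg x z r v\<bar>)"
      using seg_points[OF assms t01] seg_points[OF assms r] s
      by (intro tree_dist_le_chain chain_simplex[where \<sigma> = \<sigma>]) auto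
    also have "\<dots> \<le> \<bar>t - r\<bar>"
    proof (rule cSUP_least)
      fix v
      have "\<bar>seg x z t v - seg x z r v\<bar> = \<bar>(t - r) * (z v - x v)\<bar>"
        by (simp add: seg_def algebra_simps)
      also have "\<dots> \<le> \<bar>t - r\<bar>"
        using points_le_1[OF x(1), of v] points_le_1[OF z(1), of v]
        by (simp add: abs_mult mult_left_le)
      finally show "\<bar>seg x z t v - seg x z r v\<bar> \<le> \<bar>t - r\<bar>" .
    qed simp
    finally show ?thesis .
  qed
  have "seg x z r \<in> M.mball (seg x z t) e" if "r \<in> {0..1} \<inter> ball t e" for r
    using that close[of r] seg_points[OF assms t01] seg_points[OF assms, of r]
    by (auto simp: M.in_mball dist_real_def)
  moreover have "openin (top_of_set {0..1}) ({0..1} \<inter> ball t e)" by (simp add: openin_open_Int)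
  ultimately show "\<exists>U. openin (top_of_set {0..1}) U \<and> t \<in> U \<and> (\<forall>y\<in>U. seg x z y \<in> M.mball (seg x z t) e)"
    using t e by (intro exI[of _ "{0..1} \<inter> ball t e"]) auto
qed

text \<open>
  Some coordinate \<open>c\<close> in which the segment never agrees with \<open>p\<close> witnesses that it avoids \<open>p\<close>.
\<close>

lemma segment_component:
  assumes x: "x \<in> points T" "supp x \<subseteq> \<sigma>" and z: "z \<in> points T" "supp z \<subseteq> \<sigma>" and s: "\<sigma> \<in> simplices T"
    and avoid: "\<And>t. 0 \<le> t \<Longrightarrow> t \<le> 1 \<Longrightarrow> seg x z t c \<noteq> p c"
  shows "connected_component_of (subtopology (tree_top T) (points T - {p})) x z"
proof -
  let ?S = "seg x z ` {0..1}"
  have "connectedin (tree_top T) ?S"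
    by (rule connectedin_continuous_map_image[OF continuous_seg[OF x z s]]) (simp add: connectedin_subtopology)
  moreover have "?S \<subseteq> points T - {p}" using seg_points[OF x z s] avoid by force
  ultimately have "connectedin (subtopology (tree_top T) (points T - {p})) ?S"
    by (simp add: connectedin_subtopology)
  moreover have "seg x z 0 = x" "seg x z 1 = z" by (auto simp: seg_def)
  then have "x \<in> ?S" "z \<in> ?S" by (metis atLeastAtMost_iff imageI order_refl zero_le_one)+
  ultimately show ?thesis unfolding connected_component_of_def by blast
qed

text \<open>
  Let \<open>p\<close> be the base point of the direction. As \<open>x\<close> and \<open>p\<close> have total mass 1, some vertex \<open>u\<close> has
  more mass in \<open>x\<close> than in \<open>p\<close>, so the segment from \<open>x\<close> to \<open>u\<close> avoids \<open>p\<close>. The half-tree starts with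
  the first edge from another vertex \<open>a\<close> of the carrier of \<open>p\<close> towards \<open>u\<close>; \<open>p\<close> is not in it,
  having mass at \<open>a\<close>.
\<close>

lemma direction_contains_half:
  assumes d: "\<delta> \<in> directions T" and x: "x \<in> \<delta>"
  shows "\<exists>a b. {a, b} \<in> edges T \<and> supp x \<inter> half T a b \<noteq> {} \<and> {y \<in> points T. supp y \<subseteq> half T a b} \<subseteq> \<delta>"
proof -
  obtain p where p: "p \<in> points T" "\<delta> \<in> connected_components_of (subtopology (tree_top T) (points T - {p}))"
    using d by (auto simp: directions_def)
  let ?X = "subtopology (tree_top T) (points T - {p})"
  have \<delta>: "\<delta> = connected_component_of_set ?X x"
    using p(2) x unfolding connected_components_of_def by (auto simp: connected_component_of_equiv)
  have "x \<in> topspace ?X" using x unfolding \<delta> by (simp add: connected_component_of_refl)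
  then have xp: "x \<in> points T" "x \<noteq> p" by (auto simp: topspace_tree_top)
  have "\<exists>u. p u < x u"
  proof (rule ccontr)
    assume "\<not> (\<exists>u. p u < x u)"
    then have le: "x u \<le> p u" for u by (simp add: not_less)
    have "supp x \<subseteq> supp p"
    proof
      fix v assume "v \<in> supp x"
      then have "0 < x v" using points_le_1(1)[OF xp(1), of v] by (simp add: supp_def less_le)
      then show "v \<in> supp p" using le[of v] by (simp add: supp_def)
    qed
    then have eq: "(\<Sum>v \<in> supp p. x v) = (\<Sum>v \<in> supp p. p v)"
      using sum_over_simplex(2)[OF xp(1) supp_simplex[OF p(1)]] sum_over_simplex(2)[OF p(1) supp_simplex[OF p(1)]] by simp
    have "x v = p v" for v
    proof (cases "v \<in> supp p")
      case True
      then show ?thesis using sum_mono_inv[OF eq le] supp_facts[OF p(1)] by blast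
    next
      case False
      then show ?thesis using \<open>supp x \<subseteq> supp p\<close> by (auto simp: supp_def)
    qed
    then show False using xp by auto
  qed
  then obtain u where u: "p u < x u" by blast
  have "u \<in> supp x" using u points_le_1(1)[OF p(1), of u] by (auto simp: supp_def)
  then have uV: "u \<in> verts T" using supp_facts[OF xp(1)] by blast
  have "\<exists>a \<in> supp p. a \<noteq> u"
  proof (rule ccontr)
    assume "\<not> (\<exists>a \<in> supp p. a \<noteq> u)"
    then have "supp p = {u}" using supp_facts(2)[OF p(1)] by auto
    then have "p u = 1" using p(1) by (simp add: points_def supp_def)
    then show False using u points_le_1(2)[OF xp(1), of u] by simp
  qed
  then obtain a where a: "a \<in> supp p" "a \<noteq> u" by blast
  then have aV: "a \<in> verts T" using supp_facts[OF p(1)] by blast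
  obtain b where ab: "{a, b} \<in> edges T" "u \<in> half T a b" using first_edge[OF aV uV] a by blast
  have pa: "p a > 0" using a points_le_1(1)[OF p(1), of a] by (simp add: supp_def less_le)
  have inH: "connected_component_of ?X y z"
    if y: "y \<in> points T" and z: "z \<in> points T" and s: "supp y \<subseteq> \<sigma>" "supp z \<subseteq> \<sigma>" "\<sigma> \<in> simplices T"
      and H: "supp y \<subseteq> half T a b" "supp z \<subseteq> half T a b" for y z \<sigma>
  proof (rule segment_component[OF y s(1) z s(2,3), of a])
    have "y a = 0" "z a = 0" using H bridge[OF ab(1)] by (auto simp: supp_def)
    then show "seg y z t a \<noteq> p a" for t using pa by (simp add: seg_def)
  qed
  have xu: "connected_component_of ?X x (indicator {u})"
  proof (rule segment_component[OF xp(1) order_refl indicator_points[OF uV] _ supp_simplex[OF xp(1)], of u])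
    show "supp (indicator {u} :: 'v \<Rightarrow> real) \<subseteq> supp x" using \<open>u \<in> supp x\<close> by (simp add: supp_indicator)
    fix t :: real assume t: "0 \<le> t" "t \<le> 1"
    have "seg x (indicator {u}) t u = x u + t * (1 - x u)" by (simp add: seg_def algebra_simps)
    also have "\<dots> \<ge> x u" using t points_le_1(2)[OF xp(1), of u] by simp
    finally show "seg x (indicator {u}) t u \<noteq> p u" using u by simp
  qed
  have vert: "connected_component_of ?X (indicator {u}) (indicator {v})" if v: "v \<in> half T a b" for v
    using conv_connected[OF conv_half[OF ab(1)] ab(2) v]
  proof (induction rule: rtrancl_induct)
    case base
    show ?case using inH[of "indicator {u}" "indicator {u}" "{u}"] indicator_points[OF uV] ab(2) uV
      by (simp add: supp_indicator simplices_def)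
  next
    case (step y z)
    have yz: "{y, z} \<in> edges T" "y \<in> half T a b" "z \<in> half T a b" using step by (auto simp: adj_def)
    then have "connected_component_of ?X (indicator {y}) (indicator {z})"
      using edge_verts[OF yz(1)] inH[of "indicator {y}" "indicator {z}" "{y, z}"] yz
      by (simp add: supp_indicator simplices_def indicator_points)
    with step show ?case by (meson connected_component_of_trans)
  qed
  have "y \<in> \<delta>" if y: "y \<in> points T" "supp y \<subseteq> half T a b" for y
  proof -
    obtain v where v: "v \<in> supp y" using supp_facts[OF y(1)] by blast
    then have vV: "v \<in> verts T" using supp_facts[OF y(1)] by blast
    have "connected_component_of ?X (indicator {v}) y"
      using y v by (intro inH[OF indicator_points[OF vV] y(1) _ order_refl supp_simplex[OF y(1)]]) (auto simp: supp_indicator)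
    then show ?thesis unfolding \<delta> using vert[of v] xu v y(2) by (auto intro: connected_component_of_trans)
  qed
  then show ?thesis using ab \<open>u \<in> supp x\<close> by blast
qed

lemma mass_lipschitz: "\<bar>indicator S u - indicator S v\<bar> \<le> (1::real)"
  by (auto simp: indicator_def)

text \<open>
  Take a base point inside the edge \<open>{a, b}\<close>. The mass on the side of \<open>b\<close> is continuous and agrees with
  its value at the base point only there, so it exceeds that value throughout a direction
  or is smaller throughout. The base point is chosen with so little mass at \<open>b\<close> that \<open>x\<close> has more.
\<close>

lemma small_direction:
  assumes ab: "{a, b} \<in> edges T" and x: "x \<in> points T" and meets: "supp x \<inter> half T a b \<noteq> {}"
  shows "\<exists>\<delta> \<in> directions T. x \<in> \<delta> \<and> (\<forall>y \<in> \<delta>. y \<in> points T \<and> supp y \<inter> half T a b \<noteq> {})"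
proof -
  let ?m = "aff (indicator (half T a b))"
  have ne: "a \<noteq> b" using edge_verts ab by blast
  have m_eq: "?m y = (\<Sum>v \<in> supp y \<inter> half T a b. y v)" if y: "y \<in> points T" for y
  proof -
    have "?m y = (\<Sum>v \<in> supp y. if v \<in> half T a b then y v else 0)"
      unfolding aff_def by (intro sum.cong) (auto simp: indicator_def)
    then show ?thesis using supp_facts(3)[OF y] by (simp add: sum.inter_restrict)
  qed
  have m_pos: "0 < ?m x"
  proof -
    obtain v where v: "v \<in> supp x \<inter> half T a b" using meets by blast
    have "0 < x v" using v points_le_1(1)[OF x, of v] by (simp add: supp_def less_le)
    also have "x v \<le> ?m x"
      unfolding m_eq[OF x] using v supp_facts(3)[OF x] points_le_1(1)[OF x] by (intro member_le_sum) auto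
    finally show ?thesis .
  qed
  define t where "t = min (?m x / 2) (1 / 2)"
  have t: "0 < t" "t < 1" "t < ?m x" using m_pos by (auto simp: t_def)
  define p where "p v = (if v = b then t else if v = a then 1 - t else 0)" for v
  have supp_p: "supp p = {a, b}" using t by (auto simp: supp_def p_def)
  have "(\<Sum>v \<in> {a, b}. p v) = 1" using ne by (simp add: p_def)
  moreover have "0 \<le> p v" for v using t by (simp add: p_def)
  ultimately have p: "p \<in> points T" using supp_p ab unfolding points_def by (simp add: supp_def simplices_def)
  have m_p: "y = p" if y: "y \<in> points T" "?m y = t" for y
  proof -
    have 1: "supp y \<inter> half T a b \<noteq> {}" using y t m_eq[OF y(1)] by (metis less_irrefl sum.empty)
    have "\<not> supp y \<subseteq> half T a b"
    proof
      assume "supp y \<subseteq> half T a b"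
      then have "?m y = (\<Sum>v \<in> supp y. y v)" using m_eq[OF y(1)] by (simp add: Int_absorb2)
      then show False using y t by (simp add: points_def supp_def)
    qed
    then obtain u v where uv: "u \<in> supp y" "u \<in> half T a b" "v \<in> supp y" "v \<notin> half T a b" using 1 by blast
    then have sy: "supp y = {u, v}" "{u, v} \<in> edges T"
      using supp_simplex[OF y(1)] by (auto elim!: simplexE simp: insert_commute)
    have "u = b" "v = a" using half_crossing[OF ab sy(2) uv(2,4)] by auto
    then have s: "supp y = {b, a}" using sy(1) by simp
    have "?m y = y b" using m_eq[OF y(1)] s half_self[of b a] bridge[OF ab] by simp
    then have "y b = t" using y by simp
    moreover have "y b + y a = 1" using y(1) s ne by (simp add: points_def flip: supp_def)
    moreover have "y w = 0" if "w \<noteq> a" "w \<noteq> b" for w using s that by (auto simp: supp_def)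
    ultimately show ?thesis by (auto simp: p_def fun_eq_iff)
  qed
  have m_p': "?m p = t" using m_eq[OF p] supp_p half_self[of b a] bridge[OF ab] by (simp add: p_def)
  let ?X = "subtopology (tree_top T) (points T - {p})"
  let ?d = "connected_component_of_set ?X x"
  have xX: "x \<in> topspace ?X" using x m_p' t by (auto simp: topspace_tree_top)
  then have d: "?d \<in> directions T" "x \<in> ?d"
    using p by (auto simp: directions_def connected_components_of_def connected_component_of_refl)
  have "t < ?m y \<and> y \<in> points T" if y_in: "y \<in> ?d" for y
  proof (rule ccontr)
    assume n: "\<not> (t < ?m y \<and> y \<in> points T)"
    obtain S where "connectedin ?X S" and S: "x \<in> S" "y \<in> S"
      using y_in by (auto simp: connected_component_of_def)
    then have con: "connectedin (tree_top T) S" "S \<subseteq> points T - {p}" by (auto simp: connectedin_subtopology)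
    then have yp: "y \<in> points T" "y \<noteq> p" using S by auto
    let ?U = "{z \<in> points T. t < ?m z}" and ?L = "{z \<in> points T. ?m z < t}"
    have "openin (tree_top T) ?U" "openin (tree_top T) ?L"
      by (rule openin_aff_gt openin_aff_less, rule mass_lipschitz)+
    moreover have "S \<subseteq> ?U \<union> ?L" using con(2) m_p by force
    moreover have "?U \<inter> ?L \<inter> S = {}" by auto
    moreover have "?U \<inter> S \<noteq> {}" using x t S by blast
    moreover have "?L \<inter> S \<noteq> {}" using yp n m_p[OF yp(1)] S by force
    ultimately show False using con(1) unfolding connectedin by blast
  qed
  moreover have "supp y \<inter> half T a b \<noteq> {}" if "y \<in> points T" "t < ?m y" for y
    using that t m_eq[OF that(1)] by (metis less_asym sum.empty)
  ultimately show ?thesis using d by blast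
qed

lemma points_induced: assumes "C \<subseteq> verts T" shows "points (induced C) = {x \<in> points T. supp x \<subseteq> C}"
proof -
  have "simplices (induced C) = {s \<in> simplices T. s \<subseteq> C}" using assms by (auto simp: simplices_def)
  then show ?thesis by (auto simp: points_def supp_def)
qed

end

section \<open>The core\<close>

context tree_pair
begin

lemma M1_neighbours_meet:
  assumes "{w, w'} \<in> edges T2" shows "M1 {w} \<inter> M1 {w'} \<noteq> {}"
  using M1_nonempty[OF edge_simplex[OF assms]] M1_antimono[of "{w}" "{w, w'}"] M1_antimono[of "{w'}" "{w, w'}"]
  by blast

text \<open>
  Over a convex part of \<open>T2\<close>, the trees \<open>M1 {w}\<close> form a connected family. If none of them
  contains \<open>e\<close>, then they are all on the same side of \<open>e\<close>.
\<close>

lemma M1_one_side: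
  assumes C: "t2.conv C" and ab: "{a, b} \<in> edges T1" and no: "\<And>w. w \<in> C \<Longrightarrow> \<not> {a, b} \<subseteq> M1 {w}"
    and w0: "w0 \<in> C" "z \<in> M1 {w0}" "z \<in> half T1 a b"
  shows "\<forall>w \<in> C. M1 {w} \<subseteq> half T1 a b"
proof -
  have side: "M1 {w} \<subseteq> half T1 a b" if w: "w \<in> C" "y \<in> M1 {w}" "y \<in> half T1 a b" for w y
    using t1.conv_one_side[OF M1_conv ab _ w(2)] no[OF w(1)] w(3) by blast
  have "M1 {w} \<subseteq> half T1 a b" if "(w0, w) \<in> (adj T2 \<inter> C \<times> C)\<^sup>*" for w
    using that
  proof (induction rule: rtrancl_induct)
    case base
    then show ?case by (rule side[OF w0])
  next
    case (step u v)
    then have "{u, v} \<in> edges T2" "v \<in> C" by (auto simp: adj_def)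
    then show ?case using M1_neighbours_meet[of u v] step side[of v] by blast
  qed
  then show ?thesis using t2.conv_connected[OF C w0(1)] by blast
qed

text \<open>
  A point outside the asymmetric core lies in a product of half-trees that misses it. Choose the
  second half-tree disjoint from \<open>M2 \<sigma>\<close>; the projection to \<open>T1\<close> of the part of the asymmetric core
  above it is connected and does not contain \<open>\<sigma>\<close>, so it is separated from some vertex of \<open>\<sigma>\<close>.
\<close>

lemma separating_halves:
  assumes s: "\<sigma> \<in> simplices T1" and t: "\<tau> \<in> simplices T2" and out: "\<not> \<tau> \<subseteq> M2 \<sigma>"
  shows "\<exists>a b c d. {a, b} \<in> edges T1 \<and> {c, d} \<in> edges T2 \<and> \<sigma> \<inter> half T1 a b \<noteq> {} \<and> \<tau> \<inter> half T2 c d \<noteq> {} \<and>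
    (\<forall>w \<in> half T2 c d. M1 {w} \<inter> half T1 a b = {})"
proof -
  obtain u where u: "u \<in> \<tau>" "u \<notin> M2 \<sigma>" using out by blast
  have uV: "u \<in> verts T2" using u t2.simplex_facts[OF t] by blast
  have M2c: "t2.conv (M2 \<sigma>)" unfolding M2_def by (rule t2.minv_conv[OF t1.fixer_subset])
  obtain c d where cd: "{c, d} \<in> edges T2" "M2 \<sigma> \<subseteq> half T2 d c" "u \<in> half T2 c d"
    using t2.conv_separate[OF M2c M2_nonempty[OF s] uV u(2)] by blast
  let ?C = "half T2 c d"
  have C: "t2.conv ?C" by (rule t2.conv_half[OF cd(1)])
  have CV: "?C \<subseteq> verts T2" by (rule t2.half_subset_verts[OF cd(1)])
  have no: "\<not> \<sigma> \<subseteq> M1 {w}" if w: "w \<in> ?C" for w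
    using M1_iff_M2[OF s vertex_simplex, of w] w CV cd(2) t2.half_disjoint[OF cd(1)] by blast
  have d: "d \<in> ?C" by (rule t2.half_self)
  obtain z where z: "z \<in> M1 {d}" using M1_nonempty[OF vertex_simplex] d CV by blast
  have zV: "z \<in> verts T1" using z M1_verts by blast
  have "\<exists>p q. {p, q} \<in> edges T1 \<and> p \<in> \<sigma> \<and> (\<forall>w \<in> ?C. M1 {w} \<subseteq> half T1 p q)"
    using s
  proof (cases rule: t1.simplexE)
    case (1 v)
    have "v \<noteq> z" using no[OF d] z 1 by blast
    then obtain x where x: "{v, x} \<in> edges T1" "z \<in> half T1 v x" using t1.first_edge[OF 1(1) zV] by blast
    have "\<not> {v, x} \<subseteq> M1 {w}" if "w \<in> ?C" for w using no[OF that] 1 by simp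
    then show ?thesis using M1_one_side[OF C x(1) _ d z x(2)] x(1) 1 by blast
  next
    case (2 p q)
    have qp: "{q, p} \<in> edges T1" using 2 by (simp add: insert_commute)
    have no': "\<not> {p, q} \<subseteq> M1 {w}" "\<not> {q, p} \<subseteq> M1 {w}" if "w \<in> ?C" for w using no[OF that] 2 by auto
    show ?thesis
    proof (cases "z \<in> half T1 p q")
      case True
      then show ?thesis using M1_one_side[OF C 2(1) no'(1) d z] 2 by blast
    next
      case False
      then have "z \<in> half T1 q p" using t1.half_compl[OF 2(1) zV] by blast
      then show ?thesis using M1_one_side[OF C qp no'(2) d z] qp 2 by blast
    qed
  qed
  then obtain p q where pq: "{p, q} \<in> edges T1" "p \<in> \<sigma>" "\<forall>w \<in> ?C. M1 {w} \<subseteq> half T1 p q" by blast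
  have "{q, p} \<in> edges T1" using pq by (simp add: insert_commute)
  moreover have "p \<in> half T1 q p" by (rule t1.half_self)
  moreover have "M1 {w} \<inter> half T1 q p = {}" if "w \<in> ?C" for w
    using pq(3) that t1.half_disjoint[OF pq(1)] by blast
  ultimately show ?thesis using cd u pq(2) by blast
qed

text \<open>
  Inside the asymmetric core, orbit points go to infinity in every product of half-trees around a
  simplex \<open>\<sigma> \<times> \<tau>\<close>. Some \<open>h\<close> that fixes \<open>\<sigma>\<close> shifts an edge into the second half-tree. If \<open>h\<close> has a
  power that fixes the edge \<open>e\<close> bounding the first half-tree, start far inside the first half-tree
  and apply powers of it. Otherwise the translates of \<open>e\<close> by powers of \<open>h\<close> are distinct, and only
  finitely many of them separate a given vertex from \<open>\<sigma>\<close>.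
\<close>

lemma far_orbit_points:
  assumes s: "\<sigma> \<in> simplices T1" and t: "\<tau> \<in> simplices T2" and sub: "\<tau> \<subseteq> M2 \<sigma>"
    and ab: "{a, b} \<in> edges T1" "\<sigma> \<inter> half T1 a b \<noteq> {}" and cd: "{c, d} \<in> edges T2" "\<tau> \<inter> half T2 c d \<noteq> {}"
    and v: "v \<in> verts T1" "v' \<in> verts T1" and w: "w \<in> verts T2" "w' \<in> verts T2"
  shows "\<exists>g \<in> carrier G. \<phi>1 g v \<in> half T1 a b \<and> k \<le> t1.tdist (\<phi>1 g v) v' \<and>
    \<phi>2 g w \<in> half T2 c d \<and> l \<le> t2.tdist (\<phi>2 g w) w'"
proof -
  interpret S: tree_pair G T2 \<phi>2 T1 \<phi>1 by (rule swap)
  have M2: "S.M1 \<sigma> = M2 \<sigma>" by (simp add: S.M1_def M2_def)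
  have M2c: "t2.conv (M2 \<sigma>)" unfolding M2_def by (rule t2.minv_conv[OF t1.fixer_subset])
  obtain z where z: "z \<in> \<sigma>" "z \<in> half T1 a b" using ab by blast
  have zV: "z \<in> verts T1" using z t1.simplex_facts[OF s] by blast
  obtain u where u: "u \<in> M2 \<sigma>" "u \<in> half T2 c d" using cd sub by blast
  have E1: "edges T1 \<noteq> {}" using ab by blast
  have "\<exists>p q. {p, q} \<in> edges T2 \<and> {p, q} \<subseteq> M2 \<sigma> \<and> half T2 p q \<subseteq> half T2 c d"
  proof (cases "{c, d} \<subseteq> M2 \<sigma>")
    case True
    then show ?thesis using cd by blast
  next
    case False
    then have M2sub: "M2 \<sigma> \<subseteq> half T2 c d" using t2.conv_one_side[OF M2c cd(1) _ u(1)] u(2) by blast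
    obtain p where p: "{u, p} \<in> edges T2" "p \<in> M2 \<sigma>" using S.M1_vertex_on_edge[OF E1 s] u M2 by auto
    have pu: "{p, u} \<in> edges T2" using p by (simp add: insert_commute)
    have "c \<notin> half T2 u p \<or> c \<notin> half T2 p u" using t2.half_disjoint[OF p(1)] by blast
    then have "half T2 u p \<subseteq> half T2 c d \<or> half T2 p u \<subseteq> half T2 c d"
      using t2.half_nested[OF cd(1) p(1)] t2.half_nested[OF cd(1) pu] M2sub u p by blast
    then show ?thesis using p pu u by blast
  qed
  then obtain p q where pq: "{p, q} \<in> edges T2" "{p, q} \<subseteq> M2 \<sigma>" "half T2 p q \<subseteq> half T2 c d" by blast
  obtain h where h: "h \<in> t1.fixer \<sigma>" "t2.shifts h p q" using S.M1_edge_shifted[OF s pq(1)] pq(2) M2 by auto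
  have hG: "h \<in> carrier G" using h t1.fixer_subset by blast
  have hz: "\<phi>1 h z = z" using h z by (simp add: t1.fixer_def)
  obtain f where f: "f \<in> edges T2" using cd by blast
  obtain g0 where g0: "g0 \<in> carrier G" "t1.shifts g0 a b"
  proof -
    obtain h0 where h0: "h0 \<in> t2.fixer f" "\<And>v. v \<in> verts T1 \<Longrightarrow> \<phi>1 h0 v \<noteq> v"
      using fixer_fixed_point_free[OF edges2_nonempty[OF E1] edge_simplex[OF f]] by blast
    have "h0 \<in> carrier G" using h0 t2.fixer_subset by blast
    then show ?thesis
      using that t1.minv_edge_shifted[OF t1.subgroup_self _ h0(2) ab(1)] t1.minimal_action_minv[OF minimal1]
        t1.edge_verts[OF ab(1)] by auto
  qed
  obtain i :: nat where i: "\<phi>1 (g0 [^] i) v \<in> half T1 a b" "k + t1.tdist z v' \<le> t1.tdist (\<phi>1 (g0 [^] i) v) z"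
    using t1.shifts_far[OF g0(1) ab(1) g0(2) v(1) zV] by blast
  define g where "g = g0 [^] i"
  have g: "g \<in> carrier G" using g0 by (simp add: g_def)
  define v1 where "v1 = \<phi>1 g v"
  have v1: "v1 \<in> verts T1" "v1 \<in> half T1 a b" using i v g t1.act_closed by (auto simp: v1_def g_def)
  define w1 where "w1 = \<phi>2 g w"
  have w1: "w1 \<in> verts T2" using w g t2.act_closed by (auto simp: w1_def)
  have "\<exists>r. r \<in> carrier G \<and> \<phi>1 r z = z \<and> t2.shifts r p q \<and> (\<exists>N. \<forall>n\<ge>N. \<phi>1 (r [^] (n::nat)) v1 \<in> half T1 a b)"
  proof (cases "\<exists>m. \<phi>1 (h [^] Suc m) ` {a, b} = {a, b}")
    case True
    then obtain m where m: "\<phi>1 (h [^] Suc m) ` {a, b} = {a, b}" by blast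
    define r where "r = h [^] Suc m"
    have r: "r \<in> carrier G" using hG by (simp add: r_def)
    have "\<phi>1 r a = a \<and> \<phi>1 r b = b" using t1.edge_fixed[OF r ab(1)] m by (simp add: r_def)
    then have "\<phi>1 r ` half T1 a b = half T1 a b" using t1.half_act[OF r ab(1)] by simp
    then have step: "\<phi>1 r x \<in> half T1 a b" if "x \<in> half T1 a b" for x using that by blast
    have "\<phi>1 (r [^] (n::nat)) v1 \<in> half T1 a b" for n
    proof (induction n)
      case (Suc n)
      then show ?case using step t1.act_pow_Suc[OF r v1(1)] by simp
    qed (simp add: t1.act_one v1)
    moreover have "\<phi>1 r z = z" unfolding r_def by (rule t1.pow_fixes[OF hG zV hz])
    moreover have "t2.shifts r p q" unfolding r_def by (rule t2.shifts_pow[OF hG pq(1) h(2)])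
    ultimately show ?thesis using r by blast
  next
    case False
    have "\<phi>1 (h [^] n) z \<in> half T1 a b" for n :: nat using t1.pow_fixes[OF hG zV hz] z by simp
    then show ?thesis
      using t1.eventually_in_half[OF hG ab(1) _ zV _ v1(1)] False hG hz h(2) by blast
  qed
  then obtain r N where r: "r \<in> carrier G" "\<phi>1 r z = z" "t2.shifts r p q"
    and N: "\<And>n. n \<ge> N \<Longrightarrow> \<phi>1 (r [^] (n::nat)) v1 \<in> half T1 a b" by blast
  obtain N' where N': "\<And>n. n \<ge> N' \<Longrightarrow> \<phi>2 (r [^] (n::nat)) w1 \<in> half T2 p q \<and> l \<le> t2.tdist (\<phi>2 (r [^] n) w1) w'"
    using t2.shifts_far[OF r(1) pq(1) r(3) w1 w(2)] by blast
  define n where "n = max N N'"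
  have rn: "r [^] n \<in> carrier G" using r by simp
  let ?g = "r [^] n \<otimes> g"
  have 1: "\<phi>1 ?g v = \<phi>1 (r [^] n) v1" "\<phi>2 ?g w = \<phi>2 (r [^] n) w1"
    using t1.act_mult[OF rn g v(1)] t2.act_mult[OF rn g w(1)] by (auto simp: v1_def w1_def)
  have V: "\<phi>1 (r [^] n) v1 \<in> verts T1" using t1.act_closed[OF rn v1(1)] .
  have "t1.tdist (\<phi>1 (r [^] n) v1) z = t1.tdist v1 z"
    using t1.tdist_act[OF rn v1(1) zV] t1.pow_fixes[OF r(1) zV r(2), of n] by simp
  moreover have "t1.tdist (\<phi>1 (r [^] n) v1) z \<le> t1.tdist (\<phi>1 (r [^] n) v1) v' + t1.tdist v' z"
    by (rule t1.tdist_triangle[OF V v(2) zV])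
  moreover have "t1.tdist v' z = t1.tdist z v'" by (rule t1.tdist_sym[OF v(2) zV])
  ultimately have "k \<le> t1.tdist (\<phi>1 (r [^] n) v1) v'" using i(2) by (simp add: v1_def g_def)
  moreover have "\<phi>1 (r [^] n) v1 \<in> half T1 a b" using N by (simp add: n_def)
  moreover have "\<phi>2 (r [^] n) w1 \<in> half T2 c d \<and> l \<le> t2.tdist (\<phi>2 (r [^] n) w1) w'"
    using N'[of n] pq(3) by (auto simp: n_def)
  moreover have "?g \<in> carrier G" using rn g by simp
  ultimately show ?thesis using 1 by metis
qed

end

context tree_action
begin

lemma far_orbit_point_in_half:
  assumes g: "g \<in> carrier G" and x: "x \<in> points T" "v \<in> supp x" and ab: "{a, b} \<in> edges T"
    and gv: "\<phi> g v \<in> half T a b" "k + 2 + tdist v a \<le> tdist (\<phi> g v) a"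
  shows "supp (real_act G T \<phi> g x) \<subseteq> half T a b" "k \<le> tree_dist T (real_act G T \<phi> g x) x"
proof -
  have V: "v \<in> verts T" "a \<in> verts T" "\<phi> g v \<in> verts T"
    using x supp_facts[OF x(1)] edge_verts[OF ab] act_closed[OF g] by auto
  show "supp (real_act G T \<phi> g x) \<subseteq> half T a b"
    unfolding supp_real_act[OF g x(1)]
  proof
    fix y assume "y \<in> \<phi> g ` supp x"
    then obtain w where w: "w \<in> supp x" "y = \<phi> g w" by blast
    show "y \<in> half T a b"
    proof (rule ccontr)
      assume n: "y \<notin> half T a b"
      then have "v \<noteq> w" using gv w by blast
      then have "{v, w} \<in> edges T" using supp_simplex[OF x(1)] x(2) w(1)
        by (auto elim!: simplexE simp: insert_commute)
      then have "\<phi> g v = b" using half_crossing[OF ab edge_act[OF g]] gv(1) n w by blast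
      moreover have "tdist b a = 1" using tdist_edge ab by (simp add: insert_commute)
      ultimately show False using gv(2) by simp
    qed
  qed
  have "tdist (\<phi> g v) a \<le> tdist (\<phi> g v) v + tdist v a" by (rule tdist_triangle[OF V(3,1,2)])
  moreover have "\<phi> g v \<in> supp (real_act G T \<phi> g x)" using supp_real_act[OF g x(1)] x(2) by blast
  then have "tdist (\<phi> g v) v \<le> tree_dist T (real_act G T \<phi> g x) x + 2"
    by (rule tree_dist_ge_tdist[OF real_act_points[OF g x(1)] _ x])
  ultimately show "k \<le> tree_dist T (real_act G T \<phi> g x) x" using gv(2) by linarith
qed

lemma tdist_half_boundary:
  assumes ab: "{a, b} \<in> edges T" and u: "u \<in> half T a b" and c: "c \<in> verts T" "c \<notin> half T a b"
  shows "tdist u b \<le> tdist u c"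
proof -
  have V: "u \<in> verts T" "b \<in> verts T" using half_subset_verts[OF ab] u edge_verts[OF ab] by auto
  have sep_ab: "{a, b} \<in> sep u c" using sep_iff[OF ab V(1) c(1)] u c by blast
  have "sep u b \<subseteq> sep u c"
  proof
    fix e assume e: "e \<in> sep u b"
    then obtain p q where pq: "e = {p, q}" "{p, q} \<in> edges T" "u \<in> half T q p" "b \<in> half T p q"
      by (auto simp: sep_def)
    have qp: "{q, p} \<in> edges T" using pq by (simp add: insert_commute)
    have "c \<notin> half T q p"
    proof
      assume "c \<in> half T q p"
      then have "b \<in> half T q p" using convD[OF conv_half[OF qp] pq(3) _ sep_ab] by blast
      then show False using pq half_disjoint[OF pq(2)] by blast
    qed
    then have "c \<in> half T p q" using half_compl[OF pq(2) c(1)] by blast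
    then show "e \<in> sep u c" using pq by (auto simp: sep_def)
  qed
  then show ?thesis unfolding tdist_def using finite_sep[OF V(1) c(1)] by (rule card_mono[rotated])
qed

text \<open>
  Two orbit points move in parallel, so while one of them is in a half-tree and the other is not,
  both are close to its boundary.
\<close>

lemma orbit_point_near_boundary:
  assumes x: "x \<in> points T" and c: "c \<in> verts T" and ab: "{a, b} \<in> edges T"
  shows "\<exists>B. \<forall>g \<in> carrier G. supp (real_act G T \<phi> g x) \<inter> half T a b \<noteq> {} \<longrightarrow> \<phi> g c \<notin> half T a b \<longrightarrow>
    tree_dist T (real_act G T \<phi> g x) x \<le> B"
proof -
  obtain v where v: "v \<in> supp x" using supp_facts[OF x] by blast
  have V: "v \<in> verts T" "b \<in> verts T" using v supp_facts[OF x] edge_verts[OF ab] by auto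
  let ?B = "tree_dist T x (indicator {c}) + 2 + tdist b v + 2"
  have "tree_dist T (real_act G T \<phi> g x) x \<le> ?B"
    if g: "g \<in> carrier G" and meets: "supp (real_act G T \<phi> g x) \<inter> half T a b \<noteq> {}" and gc: "\<phi> g c \<notin> half T a b" for g
  proof -
    obtain u where u: "u \<in> supp x" "\<phi> g u \<in> half T a b"
      using meets unfolding supp_real_act[OF g x] by blast
    have uV: "u \<in> verts T" "\<phi> g u \<in> verts T" "\<phi> g c \<in> verts T"
      using u supp_facts[OF x] c act_closed[OF g] by auto
    have "\<phi> g u \<in> supp (real_act G T \<phi> g x)" using supp_real_act[OF g x] u by blast
    then have "tree_dist T (real_act G T \<phi> g x) x \<le> tdist (\<phi> g u) v + 2"
      by (rule tree_dist_le_tdist[OF real_act_points[OF g x] _ x v])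
    moreover have "tdist (\<phi> g u) v \<le> tdist (\<phi> g u) b + tdist b v" by (rule tdist_triangle[OF uV(2) V(2,1)])
    moreover have "tdist (\<phi> g u) b \<le> tdist (\<phi> g u) (\<phi> g c)" by (rule tdist_half_boundary[OF ab u(2) uV(3) gc])
    moreover have "tdist (\<phi> g u) (\<phi> g c) = tdist u c" by (rule tdist_act[OF g uV(1) c])
    moreover have "tdist u c \<le> tree_dist T x (indicator {c}) + 2"
      by (rule tree_dist_ge_tdist[OF x u(1) indicator_points[OF c]]) (simp add: supp_indicator)
    ultimately show ?thesis by linarith
  qed
  then show ?thesis by blast
qed

end

context tree_pair
begin

text \<open>
  The orbit of a vertex of the core never enters the product of the half-trees. So at each time one of
  the coordinates of the orbit of the base point is close to the boundary of its half-tree.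
\<close>

lemma light_if_halves_miss_core:
  assumes ab: "{a, b} \<in> edges T1" and cd: "{c, d} \<in> edges T2"
    and miss: "\<forall>w \<in> half T2 c d. M1 {w} \<inter> half T1 a b = {}"
    and d1: "\<forall>y \<in> \<delta>1. supp y \<inter> half T1 a b \<noteq> {}" and d2: "\<forall>y \<in> \<delta>2. supp y \<inter> half T2 c d \<noteq> {}"
    and b1: "b1 \<in> points T1" and b2: "b2 \<in> points T2"
  shows "\<not> heavy G T1 \<phi>1 T2 \<phi>2 b1 b2 (\<delta>1 \<times> \<delta>2)"
proof
  assume "heavy G T1 \<phi>1 T2 \<phi>2 b1 b2 (\<delta>1 \<times> \<delta>2)"
  then obtain \<gamma> where \<gamma>: "\<And>k. \<gamma> k \<in> carrier G"
      "\<And>k. real_act G T1 \<phi>1 (\<gamma> k) b1 \<in> \<delta>1" "\<And>k. real_act G T2 \<phi>2 (\<gamma> k) b2 \<in> \<delta>2"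
    and lim: "filterlim (\<lambda>k. tree_dist T1 (real_act G T1 \<phi>1 (\<gamma> k) b1) b1) at_top sequentially"
      "filterlim (\<lambda>k. tree_dist T2 (real_act G T2 \<phi>2 (\<gamma> k) b2) b2) at_top sequentially"
    unfolding heavy_def by auto
  obtain w where w: "w \<in> verts T2" using t2.verts_nonempty by blast
  then obtain v where v: "v \<in> M1 {w}" using M1_nonempty[OF vertex_simplex] by blast
  then have vV: "v \<in> verts T1" using M1_verts by blast
  obtain B1 where B1: "\<And>g. g \<in> carrier G \<Longrightarrow> supp (real_act G T1 \<phi>1 g b1) \<inter> half T1 a b \<noteq> {} \<Longrightarrow>
      \<phi>1 g v \<notin> half T1 a b \<Longrightarrow> tree_dist T1 (real_act G T1 \<phi>1 g b1) b1 \<le> B1"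
    using t1.orbit_point_near_boundary[OF b1 vV ab] by blast
  obtain B2 where B2: "\<And>g. g \<in> carrier G \<Longrightarrow> supp (real_act G T2 \<phi>2 g b2) \<inter> half T2 c d \<noteq> {} \<Longrightarrow>
      \<phi>2 g w \<notin> half T2 c d \<Longrightarrow> tree_dist T2 (real_act G T2 \<phi>2 g b2) b2 \<le> B2"
    using t2.orbit_point_near_boundary[OF b2 w cd] by blast
  have "\<forall>\<^sub>F k in sequentially. B1 < tree_dist T1 (real_act G T1 \<phi>1 (\<gamma> k) b1) b1 \<and>
      B2 < tree_dist T2 (real_act G T2 \<phi>2 (\<gamma> k) b2) b2"
    using lim by (auto simp: filterlim_at_top_dense intro: eventually_conj)
  then obtain k where k: "B1 < tree_dist T1 (real_act G T1 \<phi>1 (\<gamma> k) b1) b1"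
      "B2 < tree_dist T2 (real_act G T2 \<phi>2 (\<gamma> k) b2) b2"
    using eventually_happens'[OF sequentially_bot] by blast
  have "\<phi>1 (\<gamma> k) v \<in> half T1 a b" using B1[OF \<gamma>(1)[of k]] d1 \<gamma>(2)[of k] k(1) by force
  moreover have "\<phi>2 (\<gamma> k) w \<in> half T2 c d" using B2[OF \<gamma>(1)[of k]] d2 \<gamma>(3)[of k] k(2) by force
  moreover have "\<phi>1 (\<gamma> k) v \<in> M1 {\<phi>2 (\<gamma> k) w}"
    using M1_act[OF \<gamma>(1), of "{w}" k] v w by auto
  ultimately show False using miss by blast
qed

lemma heavy_if_meets_core:
  assumes x1: "x1 \<in> points T1" and x2: "x2 \<in> points T2" and sub: "supp x2 \<subseteq> M2 (supp x1)"
    and d1: "\<delta>1 \<in> directions T1" "x1 \<in> \<delta>1" and d2: "\<delta>2 \<in> directions T2" "x2 \<in> \<delta>2"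
    and b1: "b1 \<in> points T1" and b2: "b2 \<in> points T2"
  shows "heavy G T1 \<phi>1 T2 \<phi>2 b1 b2 (\<delta>1 \<times> \<delta>2)"
proof -
  obtain a b where ab: "{a, b} \<in> edges T1" "supp x1 \<inter> half T1 a b \<noteq> {}"
      "{y \<in> points T1. supp y \<subseteq> half T1 a b} \<subseteq> \<delta>1"
    using t1.direction_contains_half[OF d1] by blast
  obtain c d where cd: "{c, d} \<in> edges T2" "supp x2 \<inter> half T2 c d \<noteq> {}"
      "{y \<in> points T2. supp y \<subseteq> half T2 c d} \<subseteq> \<delta>2"
    using t2.direction_contains_half[OF d2] by blast
  obtain v where v: "v \<in> supp b1" using t1.supp_facts[OF b1] by blast
  obtain w where w: "w \<in> supp b2" using t2.supp_facts[OF b2] by blast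
  have V: "v \<in> verts T1" "a \<in> verts T1" "w \<in> verts T2" "c \<in> verts T2"
    using v w t1.supp_facts[OF b1] t2.supp_facts[OF b2] t1.edge_verts[OF ab(1)] t2.edge_verts[OF cd(1)] by auto
  have "\<exists>g \<in> carrier G. \<phi>1 g v \<in> half T1 a b \<and> k + 2 + t1.tdist v a \<le> t1.tdist (\<phi>1 g v) a \<and>
      \<phi>2 g w \<in> half T2 c d \<and> k + 2 + t2.tdist w c \<le> t2.tdist (\<phi>2 g w) c" for k
    by (rule far_orbit_points[OF supp_simplex[OF x1] supp_simplex[OF x2] sub ab(1,2) cd(1,2) V])
  then obtain \<gamma> where \<gamma>: "\<And>k. \<gamma> k \<in> carrier G"
      "\<And>k. \<phi>1 (\<gamma> k) v \<in> half T1 a b" "\<And>k. k + 2 + t1.tdist v a \<le> t1.tdist (\<phi>1 (\<gamma> k) v) a"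
      "\<And>k. \<phi>2 (\<gamma> k) w \<in> half T2 c d" "\<And>k. k + 2 + t2.tdist w c \<le> t2.tdist (\<phi>2 (\<gamma> k) w) c"
    by metis
  note far1 = t1.far_orbit_point_in_half[OF \<gamma>(1) b1 v ab(1) \<gamma>(2,3)]
  note far2 = t2.far_orbit_point_in_half[OF \<gamma>(1) b2 w cd(1) \<gamma>(4,5)]
  have "filterlim (\<lambda>k. tree_dist T1 (real_act G T1 \<phi>1 (\<gamma> k) b1) b1) at_top sequentially"
    "filterlim (\<lambda>k. tree_dist T2 (real_act G T2 \<phi>2 (\<gamma> k) b2) b2) at_top sequentially"
    by (rule filterlim_at_top_mono[OF filterlim_real_sequentially], use far1(2) far2(2) in simp)+
  moreover have "real_act G T1 \<phi>1 (\<gamma> k) b1 \<in> \<delta>1" "real_act G T2 \<phi>2 (\<gamma> k) b2 \<in> \<delta>2" for k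
    using far1(1) far2(1) ab(3) cd(3) t1.real_act_points[OF \<gamma>(1) b1] t2.real_act_points[OF \<gamma>(1) b2] by blast+
  ultimately show ?thesis unfolding heavy_def using \<gamma>(1) by blast
qed

text \<open>
  The union of the open cells \<open>\<sigma> \<times> \<tau>\<close> with \<open>\<tau> \<subseteq> M2 \<sigma>\<close>, in terms of the points in them.
\<close>

definition common_core where
  "common_core = {(x1, x2). x1 \<in> points T1 \<and> x2 \<in> points T2 \<and> supp x2 \<subseteq> M2 (supp x1)}"

lemma core_eq:
  assumes b1: "b1 \<in> points T1" and b2: "b2 \<in> points T2"
  shows "core G T1 \<phi>1 T2 \<phi>2 b1 b2 = common_core"
proof (intro equalityI subsetI)
  fix x assume x: "x \<in> core G T1 \<phi>1 T2 \<phi>2 b1 b2"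
  obtain x1 x2 where eq: "x = (x1, x2)" by (meson surj_pair)
  have P: "x1 \<in> points T1" "x2 \<in> points T2" using x by (auto simp: core_def eq)
  have "supp x2 \<subseteq> M2 (supp x1)"
  proof (rule ccontr)
    assume n: "\<not> supp x2 \<subseteq> M2 (supp x1)"
    obtain a b c d where h: "{a, b} \<in> edges T1" "{c, d} \<in> edges T2" "supp x1 \<inter> half T1 a b \<noteq> {}"
        "supp x2 \<inter> half T2 c d \<noteq> {}" "\<forall>w \<in> half T2 c d. M1 {w} \<inter> half T1 a b = {}"
      using separating_halves[OF supp_simplex[OF P(1)] supp_simplex[OF P(2)] n] by blast
    obtain \<delta>1 where d1: "\<delta>1 \<in> directions T1" "x1 \<in> \<delta>1" "\<forall>y \<in> \<delta>1. y \<in> points T1 \<and> supp y \<inter> half T1 a b \<noteq> {}"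
      using t1.small_direction[OF h(1) P(1) h(3)] by blast
    obtain \<delta>2 where d2: "\<delta>2 \<in> directions T2" "x2 \<in> \<delta>2" "\<forall>y \<in> \<delta>2. y \<in> points T2 \<and> supp y \<inter> half T2 c d \<noteq> {}"
      using t2.small_direction[OF h(2) P(2) h(4)] by blast
    have "\<not> heavy G T1 \<phi>1 T2 \<phi>2 b1 b2 (\<delta>1 \<times> \<delta>2)"
      using light_if_halves_miss_core[OF h(1,2,5) _ _ b1 b2] d1 d2 by blast
    moreover have "\<delta>1 \<times> \<delta>2 \<in> quadrants T1 T2" using d1 d2 by (auto simp: quadrants_def)
    ultimately show False using x d1 d2 by (auto simp: core_def eq)
  qed
  then show "x \<in> common_core" using P by (simp add: common_core_def eq)
next
  fix x assume "x \<in> common_core"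
  then obtain x1 x2 where eq: "x = (x1, x2)" and P: "x1 \<in> points T1" "x2 \<in> points T2" "supp x2 \<subseteq> M2 (supp x1)"
    by (auto simp: common_core_def)
  then show "x \<in> core G T1 \<phi>1 T2 \<phi>2 b1 b2"
    using heavy_if_meets_core[OF P _ _ _ _ b1 b2] by (auto simp: core_def quadrants_def)
qed

lemma minimal_subtree_points:
  assumes "\<sigma> \<in> simplices T1"
  shows "points (minimal_subtree T2 \<phi>2 (t1.fixer \<sigma>)) = {x \<in> points T2. supp x \<subseteq> M2 \<sigma>}"
proof -
  have s: "\<sigma> \<subseteq> verts T1" using t1.simplex_facts[OF assms] by blast
  have "minimal_subtree T2 \<phi>2 (t1.fixer \<sigma>) = t2.induced (M2 \<sigma>)"
    unfolding M2_def
    using M2_nonempty[OF assms] subgroup.m_inv_closed[OF t1.subgroup_fixer[OF s]]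
    by (intro t2.minimal_subtree_eq t1.fixer_subset) (auto simp: M2_def)
  moreover have "M2 \<sigma> \<subseteq> verts T2" unfolding M2_def by (rule t2.minv_verts[OF t1.fixer_subset])
  ultimately show ?thesis by (simp add: t2.points_induced)
qed

lemma asym_core1_eq: "asym_core1 G T1 \<phi>1 T2 \<phi>2 = common_core"
  by (auto simp: asym_core1_def common_core_def t1.point_stab_eq minimal_subtree_points supp_simplex)

lemma asym_core2_eq: "asym_core2 G T1 \<phi>1 T2 \<phi>2 = common_core"
proof -
  interpret S: tree_pair G T2 \<phi>2 T1 \<phi>1 by (rule swap)
  have "S.M2 \<tau> = M1 \<tau>" for \<tau> by (simp add: S.M2_def M1_def)
  then have "asym_core2 G T1 \<phi>1 T2 \<phi>2 = {(x1, x2). x1 \<in> points T1 \<and> x2 \<in> points T2 \<and> supp x1 \<subseteq> M1 (supp x2)}"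
    by (auto simp: asym_core2_def t2.point_stab_eq S.minimal_subtree_points supp_simplex)
  also have "\<dots> = common_core" using M1_iff_M2[OF supp_simplex supp_simplex] by (auto simp: common_core_def)
  finally show ?thesis .
qed

end

section \<open>Countability\<close>

text \<open>
  Exhaust the generated subgroup by sets that contain all products of two members of the preceding set.
\<close>

lemma countable_generate:
  assumes "countable S" shows "countable (generate G S)"
proof -
  define A where "A = rec_nat ({\<one>\<^bsub>G\<^esub>} \<union> S \<union> m_inv G ` S) (\<lambda>_ B. B \<union> (\<lambda>(x, y). x \<otimes>\<^bsub>G\<^esub> y) ` (B \<times> B))"
  have A0: "A 0 = {\<one>\<^bsub>G\<^esub>} \<union> S \<union> m_inv G ` S"
    and AS: "A (Suc n) = A n \<union> (\<lambda>(x, y). x \<otimes>\<^bsub>G\<^esub> y) ` (A n \<times> A n)" for n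
    by (simp_all add: A_def)
  have "countable (A n)" for n
    by (induction n) (use assms in \<open>auto simp: A0 AS\<close>)
  then have "countable (\<Union>n. A n)" by simp
  moreover have mono: "A m \<subseteq> A n" if "m \<le> n" for m n
    using that by (rule lift_Suc_mono_le[rotated]) (auto simp: AS)
  have "x \<in> (\<Union>n. A n)" if "x \<in> generate G S" for x
    using that
  proof (induction rule: generate.induct)
    case one
    have "\<one>\<^bsub>G\<^esub> \<in> A 0" by (simp add: A0)
    then show ?case by blast
  next
    case (incl h)
    then have "h \<in> A 0" by (simp add: A0)
    then show ?case by blast
  next
    case (inv h)
    then have "inv\<^bsub>G\<^esub> h \<in> A 0" by (simp add: A0)
    then show ?case by blast
  next
    case (eng g h)
    then obtain m n where "g \<in> A m" "h \<in> A n" by blast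
    then have "g \<in> A (max m n)" "h \<in> A (max m n)" using mono[of m "max m n"] mono[of n "max m n"] by auto
    then have "g \<otimes>\<^bsub>G\<^esub> h \<in> A (Suc (max m n))" unfolding AS by force
    then show ?case by blast
  qed
  ultimately show ?thesis by (meson countable_subset subsetI)
qed

definition (in stree) spanned where
  "spanned S = S \<union> (\<Union>(x, y) \<in> S \<times> S. \<Union>(sep x y))"

lemma (in stree) conv_spanned:
  assumes "S \<subseteq> verts T" shows "conv (spanned S)" (is "conv ?C")
proof -
  have CV: "?C \<subseteq> verts T" using assms sep_subset edge_subset unfolding spanned_def by blast
  have ex: "\<exists>x \<in> S. x \<in> half T p q" if u: "u \<in> ?C" "u \<in> half T p q" and pq: "{p, q} \<in> edges T" for u p q
  proof (rule ccontr)
    assume no: "\<not> (\<exists>x \<in> S. x \<in> half T p q)"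
    have qp: "{q, p} \<in> edges T" using pq by (simp add: insert_commute)
    have S: "S \<subseteq> half T q p" using no assms half_compl[OF pq] by blast
    have "u \<notin> S" using no u by blast
    then obtain x y e where "x \<in> S" "y \<in> S" "e \<in> sep x y" "u \<in> e" using u unfolding spanned_def by blast
    then have "u \<in> half T q p" using S conv_half[OF qp] unfolding conv_def by blast
    then show False using u half_disjoint[OF pq] by blast
  qed
  have "\<Union>(sep u u') \<subseteq> ?C" if uu: "u \<in> ?C" "u' \<in> ?C" for u u'
  proof (rule Union_least)
    fix e assume "e \<in> sep u u'"
    then obtain p q where pq: "e = {p, q}" "{p, q} \<in> edges T" "u \<in> half T q p" "u' \<in> half T p q"
      by (auto simp: sep_def)
    then have "{q, p} \<in> edges T" by (simp add: insert_commute)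
    then obtain x y where xy: "x \<in> S" "x \<in> half T q p" "y \<in> S" "y \<in> half T p q"
      using ex[OF uu(1) pq(3)] ex[OF uu(2) pq(4,2)] by blast
    then have "e \<in> sep x y" using pq by (auto simp: sep_def)
    then show "e \<subseteq> ?C" using xy unfolding spanned_def by blast
  qed
  then show ?thesis using CV by (simp add: conv_def)
qed

text \<open>
  The subtree spanned by an orbit is invariant, so it is the whole tree; and it is a countable union
  of finite paths.
\<close>

lemma (in tree_action) countable_edges:
  assumes min: "minimal_action G T \<phi>" and G: "countable (carrier G)"
  shows "countable (edges T)"
proof -
  obtain v where v: "v \<in> verts T" using verts_nonempty by blast
  define S where "S = (\<lambda>g. \<phi> g v) ` carrier G"
  have S: "S \<subseteq> verts T" using act_closed v by (auto simp: S_def)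
  have "countable S" using G by (simp add: S_def)
  have S_act: "\<phi> h x \<in> S" if h: "h \<in> carrier G" and x: "x \<in> S" for h x
  proof -
    obtain g where g: "g \<in> carrier G" "x = \<phi> g v" using x by (auto simp: S_def)
    then have "\<phi> h x = \<phi> (h \<otimes> g) v" using act_mult[OF h g(1) v] by simp
    then show ?thesis using h g by (simp add: S_def)
  qed
  have "\<phi> h u \<in> spanned S" if h: "h \<in> carrier G" and u: "u \<in> spanned S" for h u
  proof (cases "u \<in> S")
    case True
    then show ?thesis using S_act[OF h] by (simp add: spanned_def)
  next
    case False
    then obtain x y e where xy: "x \<in> S" "y \<in> S" "e \<in> sep x y" "u \<in> e" using u by (auto simp: spanned_def)
    then have "\<phi> h ` e \<in> sep (\<phi> h x) (\<phi> h y)" using sep_act[OF h, of x y] S by blast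
    then have "\<phi> h u \<in> \<Union>(sep (\<phi> h x) (\<phi> h y))" using xy(4) by blast
    then show ?thesis using S_act[OF h xy(1)] S_act[OF h xy(2)] unfolding spanned_def by blast
  qed
  moreover have "spanned S \<noteq> {}" by (auto simp: spanned_def S_def)
  ultimately have "minv (carrier G) \<subseteq> spanned S" by (intro minv_least[OF conv_spanned[OF S]]) auto
  then have V: "verts T \<subseteq> spanned S" using minimal_action_minv[OF min] by simp
  have "countable (\<Union>(sep x y))" if "x \<in> S" "y \<in> S" for x y
  proof -
    have "finite e" if "e \<in> sep x y" for e using that sep_subset by (metis edgeE finite.emptyI finite_insert in_mono)
    then have "finite (\<Union>(sep x y))" using finite_sep[of x y] that S by blast
    then show ?thesis by (rule countable_finite)
  qed
  then have "countable (spanned S)" using \<open>countable S\<close> unfolding spanned_def by auto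
  then have "countable (verts T)" by (rule countable_subset[OF V])
  then have "countable ((\<lambda>(x, y). {x, y}) ` (verts T \<times> verts T))" by simp
  moreover have "edges T \<subseteq> (\<lambda>(x, y). {x, y}) ` (verts T \<times> verts T)"
  proof
    fix e assume "e \<in> edges T"
    then obtain x y where "e = {x, y}" "x \<in> verts T" "y \<in> verts T" using edge_verts by (metis edgeE)
    then show "e \<in> (\<lambda>(x, y). {x, y}) ` (verts T \<times> verts T)" by (intro image_eqI[of _ _ "(x, y)"]) auto
  qed
  ultimately show ?thesis using countable_subset by blast
qed

lemma second_countable_open_cover:
  assumes "countable \<U>" and U: "\<And>U. U \<in> \<U> \<Longrightarrow> openin X U \<and> second_countable (subtopology X U)"
    and cover: "topspace X \<subseteq> \<Union>\<U>"
  shows "second_countable X"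
proof -
  define basis where "basis U \<B> \<longleftrightarrow> countable \<B> \<and> (\<forall>V \<in> \<B>. openin (subtopology X U) V) \<and>
      (\<forall>W x. openin (subtopology X U) W \<and> x \<in> W \<longrightarrow> (\<exists>V \<in> \<B>. x \<in> V \<and> V \<subseteq> W))" for U \<B>
  have "\<forall>U \<in> \<U>. \<exists>\<B>. basis U \<B>" using U unfolding basis_def second_countable_def by blast
  then obtain \<B> where "\<forall>U \<in> \<U>. basis U (\<B> U)" by metis
  then have B: "countable (\<B> U)" "V \<in> \<B> U \<Longrightarrow> openin (subtopology X U) V"
      "openin (subtopology X U) W \<Longrightarrow> x \<in> W \<Longrightarrow> \<exists>V \<in> \<B> U. x \<in> V \<and> V \<subseteq> W" if "U \<in> \<U>" for U V W x
    using that unfolding basis_def by blast+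
  show ?thesis
    unfolding second_countable_def
  proof (intro exI[of _ "\<Union>U \<in> \<U>. \<B> U"] conjI ballI allI impI)
    show "countable (\<Union>U \<in> \<U>. \<B> U)" using assms(1) B(1) by blast
    show "openin X V" if "V \<in> (\<Union>U \<in> \<U>. \<B> U)" for V
      using that B(2) U openin_trans_full by blast
    fix W x assume W: "openin X W \<and> x \<in> W"
    then have "x \<in> topspace X" using openin_subset by blast
    then obtain U1 where U1: "U1 \<in> \<U>" "x \<in> U1" using cover by blast
    have "openin (subtopology X U1) (W \<inter> U1)" using W by (simp add: openin_subtopology_Int)
    then obtain V where "V \<in> \<B> U1" "x \<in> V" "V \<subseteq> W \<inter> U1" using B(3)[OF U1(1)] U1(2) W by blast
    then show "\<exists>V \<in> (\<Union>U \<in> \<U>. \<B> U). x \<in> V \<and> V \<subseteq> W" using U1 by blast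
  qed
qed

lemma second_countable_euclidean: "second_countable (euclidean :: 'a::second_countable_topology topology)"
proof -
  obtain \<B> :: "'a set set" where "countable \<B>" "\<And>C. C \<in> \<B> \<Longrightarrow> open C" "\<And>S. open S \<Longrightarrow> \<exists>U. U \<subseteq> \<B> \<and> S = \<Union>U"
    by (rule univ_second_countable) blast
  moreover from this(3) have "\<exists>V \<in> \<B>. x \<in> V \<and> V \<subseteq> U" if "open U" "x \<in> U" for U x using that by fast
  ultimately show ?thesis unfolding second_countable_def by (intro exI[of _ \<B>]) simp
qed

section \<open>The surface\<close>

lemma isometric_image_homeomorphic:
  fixes f :: "real \<Rightarrow> 'a"
  assumes M: "Metric_space M d" and "f ` I = S" "S \<subseteq> M"
    and iso: "\<And>s t. s \<in> I \<Longrightarrow> t \<in> I \<Longrightarrow> d (f s) (f t) = \<bar>s - t\<bar>"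
  shows "subtopology (Metric_space.mtopology M d) S homeomorphic_space top_of_set I"
proof -
  interpret M: Submetric M d S using M assms(3) by (simp add: Submetric_def Submetric_axioms_def)
  interpret I: Submetric "UNIV :: real set" dist I
    by (simp add: Submetric_def Submetric_axioms_def Met_TC.Metric_space_axioms)
  interpret IS: Metric_space12 I dist S d
    by (simp add: Metric_space12_def I.sub.Metric_space_axioms M.sub.Metric_space_axioms)
  have "homeomorphic_map I.sub.mtopology M.sub.mtopology f"
    by (rule IS.isometry_imp_homeomorphic_map) (use assms(2) iso in \<open>auto simp: dist_real_def\<close>)
  then have "I.sub.mtopology homeomorphic_space M.sub.mtopology"
    by (rule homeomorphic_map_imp_homeomorphic_space)
  then have "top_of_set I homeomorphic_space subtopology M.mtopology S"
    by (simp add: M.mtopology_submetric I.mtopology_submetric)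
  then show ?thesis by (subst homeomorphic_space_sym)
qed

context stree
begin

interpretation M: Metric_space "points T" "tree_dist T"
  by (rule Metric_space_tree[OF tree])

definition open_edge :: "'v set \<Rightarrow> ('v \<Rightarrow> real) set" where
  "open_edge e = {x \<in> points T. supp x = e}"

lemma openin_open_edge: assumes "e \<in> edges T" shows "openin (tree_top T) (open_edge e)"
proof -
  obtain a b where ab: "e = {a, b}" "a \<noteq> b" using edgeE[OF assms] by blast
  have coord: "aff (indicator {v}) x = x v" if x: "x \<in> points T" for v x
  proof -
    have "aff (indicator {v}) x = (\<Sum>w \<in> supp x. if w = v then x w else 0)"
      unfolding aff_def by (intro sum.cong) (auto simp: indicator_def)
    then show ?thesis using supp_facts(3)[OF x] by (simp add: sum.delta supp_def)
  qed
  let ?O = "\<lambda>v. {x \<in> points T. 0 < aff (indicator {v}) x}"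
  have "x \<in> open_edge e \<longleftrightarrow> x \<in> ?O a \<inter> ?O b" for x
  proof
    assume "x \<in> open_edge e"
    then have "x \<in> points T" "x a \<noteq> 0" "x b \<noteq> 0" using ab by (auto simp: open_edge_def supp_def)
    then show "x \<in> ?O a \<inter> ?O b" using coord[of x] points_le_1(1)[of x T] by (auto simp: less_le)
  next
    assume "x \<in> ?O a \<inter> ?O b"
    then have x: "x \<in> points T" "a \<in> supp x" "b \<in> supp x" using coord[of x] by (auto simp: supp_def)
    then show "x \<in> open_edge e" using supp_simplex[OF x(1)] ab by (auto simp: open_edge_def elim!: simplexE)
  qed
  then have "open_edge e = ?O a \<inter> ?O b" by blast
  moreover have "openin (tree_top T) (?O v)" for v by (rule openin_aff_gt) (rule mass_lipschitz)
  ultimately show ?thesis by (simp add: openin_Int)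
qed

lemma open_edge_homeomorphic:
  assumes "e \<in> edges T"
  shows "subtopology (tree_top T) (open_edge e) homeomorphic_space top_of_set {0<..<1::real}"
proof -
  obtain a b where ab: "e = {a, b}" "a \<noteq> b" using edgeE[OF assms] by blast
  have V: "a \<in> verts T" "b \<in> verts T" using edge_verts assms ab by auto
  have s: "e \<in> simplices T" using assms by (simp add: simplices_def)
  let ?f = "seg (indicator {a}) (indicator {b})"
  note sp = seg_points[OF indicator_points[OF V(1)] _ indicator_points[OF V(2)] _ s]
  have sub: "supp (indicator {a} :: 'v \<Rightarrow> real) \<subseteq> e" "supp (indicator {b} :: 'v \<Rightarrow> real) \<subseteq> e"
    using ab by (auto simp: supp_indicator)
  have f_pts: "?f t \<in> points T" "supp (?f t) \<subseteq> e" if "0 < t" "t < 1" for t using sp[OF sub] that by auto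
  have f_coord: "?f t = (\<lambda>v. if v = a then 1 - t else if v = b then t else 0)" for t
    using ab by (auto simp: seg_def indicator_def fun_eq_iff)
  have "?f ` {0<..<1} = open_edge e"
  proof
    show "?f ` {0<..<1} \<subseteq> open_edge e"
      using f_pts ab by (auto simp: open_edge_def f_coord supp_def)
    show "open_edge e \<subseteq> ?f ` {0<..<1}"
    proof
      fix x assume "x \<in> open_edge e"
      then have x: "x \<in> points T" "supp x = {a, b}" using ab by (auto simp: open_edge_def)
      then have "a \<in> supp x" "b \<in> supp x" by auto
      then have "0 < x a" "0 < x b"
        using points_le_1(1)[OF x(1), of a] points_le_1(1)[OF x(1), of b] by (auto simp: supp_def less_le)
      moreover have "x a + x b = 1" using x ab(2) by (simp add: points_def flip: supp_def)
      moreover from this have "x = ?f (x b)" using x(2) unfolding f_coord by (auto simp: supp_def fun_eq_iff)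
      ultimately show "x \<in> ?f ` {0<..<1}" by (intro image_eqI[of x ?f "x b"]) auto
    qed
  qed
  moreover have "tree_dist T (?f r) (?f t) = \<bar>r - t\<bar>" if "r \<in> {0<..<1}" "t \<in> {0<..<1}" for r t
  proof (rule antisym)
    have P: "?f r \<in> points T" "supp (?f r) \<subseteq> e" "?f t \<in> points T" "supp (?f t) \<subseteq> e" using f_pts that by auto
    have "tree_dist T (?f r) (?f t) \<le> (SUP v. \<bar>?f r v - ?f t v\<bar>)"
      by (rule tree_dist_le_chain[OF chain_simplex[OF P(1,3) s P(2,4)]])
    also have "\<dots> \<le> \<bar>r - t\<bar>" by (rule cSUP_least) (auto simp: f_coord)
    finally show "tree_dist T (?f r) (?f t) \<le> \<bar>r - t\<bar>" .
    show "\<bar>r - t\<bar> \<le> tree_dist T (?f r) (?f t)"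
    proof (rule tree_dist_ge[OF P(1,3)])
      fix l assume "chain T (?f r) l (?f t)"
      from chain_ge_coord[OF this, of b] show "\<bar>r - t\<bar> \<le> l" using ab(2) by (simp add: f_coord)
    qed
  qed
  moreover have "open_edge e \<subseteq> points T" by (auto simp: open_edge_def)
  ultimately show ?thesis
    unfolding tree_top_def by (intro isometric_image_homeomorphic[OF M.Metric_space_axioms]) auto
qed

lemma line_homeomorphic:
  assumes "is_line (tree_dist T) Y" "Y \<subseteq> points T"
  shows "subtopology (tree_top T) Y homeomorphic_space (euclidean :: real topology)"
proof -
  obtain f :: "real \<Rightarrow> 'v \<Rightarrow> real" where "range f = Y" "\<And>s t. tree_dist T (f s) (f t) = \<bar>s - t\<bar>"
    using assms(1) by (auto simp: is_line_def)
  then have "subtopology (tree_top T) Y homeomorphic_space top_of_set (UNIV :: real set)"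
    unfolding tree_top_def using assms(2) by (intro isometric_image_homeomorphic[OF M.Metric_space_axioms]) auto
  then show ?thesis by simp
qed

lemma Hausdorff_tree_top: "Hausdorff_space (tree_top T)"
  unfolding tree_top_def by (rule M.Hausdorff_space_mtopology)

lemma vertex_points_iff: assumes "x \<in> points T" shows "x \<in> vertex_points T \<longleftrightarrow> supp x \<notin> edges T"
proof
  assume "x \<in> vertex_points T"
  then obtain v where "x = indicator {v}" by (auto simp: vertex_points_def)
  then show "supp x \<notin> edges T" using edge_verts[of v v] by (auto simp: supp_indicator)
next
  assume "supp x \<notin> edges T"
  then obtain v where v: "v \<in> verts T" "supp x = {v}" using supp_simplex[OF assms] by (auto simp: simplices_def)
  then have "x v = 1" using assms by (simp add: points_def flip: supp_def)
  moreover have "x w = 0" if "w \<noteq> v" for w using v that by (auto simp: supp_def)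
  ultimately have "x = indicator {v}" by (auto simp: fun_eq_iff indicator_def)
  then show "x \<in> vertex_points T" using v by (simp add: vertex_points_def)
qed

end

context tree_pair
begin

text \<open>
  Above an open edge \<open>e\<close> of one tree, the core is the product of \<open>e\<close> with the minimal subtree of
  its stabilizer, a line. These products are open in the core, and every point of the core
  that is not a vertex is in one of them.
\<close>

lemma surface_common_core:
  assumes fg: "finitely_generated G"
    and line1: "\<forall>e \<in> edges T1. is_line (tree_dist T2) (points (minimal_subtree T2 \<phi>2 (edge_stab G \<phi>1 e)))"
    and line2: "\<forall>e \<in> edges T2. is_line (tree_dist T1) (points (minimal_subtree T1 \<phi>1 (edge_stab G \<phi>2 e)))"
  shows "surface (subtopology (prod_topology (tree_top T1) (tree_top T2))
    (common_core - vertex_points T1 \<times> vertex_points T2))" (is "surface ?X")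
proof -
  interpret S: tree_pair G T2 \<phi>2 T1 \<phi>1 by (rule swap)
  have SM2: "S.M2 \<tau> = M1 \<tau>" for \<tau> by (simp add: S.M2_def M1_def)
  let ?P = "prod_topology (tree_top T1) (tree_top T2)"
  let ?Z = "common_core - vertex_points T1 \<times> vertex_points T2"
  define Y2 where "Y2 e = {x \<in> points T2. supp x \<subseteq> M2 e}" for e
  define Y1 where "Y1 e = {x \<in> points T1. supp x \<subseteq> M1 e}" for e
  have Y2: "subtopology (tree_top T2) (Y2 e) homeomorphic_space (euclidean :: real topology)" if "e \<in> edges T1" for e
  proof (rule t2.line_homeomorphic)
    show "is_line (tree_dist T2) (Y2 e)"
      using line1 that t1.edge_stab_eq[OF that] minimal_subtree_points[OF S.edge_simplex[OF that]]
      by (auto simp: Y2_def)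
  qed (auto simp: Y2_def)
  have Y1: "subtopology (tree_top T1) (Y1 e) homeomorphic_space (euclidean :: real topology)" if "e \<in> edges T2" for e
  proof (rule t1.line_homeomorphic)
    show "is_line (tree_dist T1) (Y1 e)"
      using line2 that t2.edge_stab_eq[OF that] S.minimal_subtree_points[OF edge_simplex[OF that]] SM2
      by (auto simp: Y1_def)
  qed (auto simp: Y1_def)
  define \<U> where "\<U> = (\<lambda>e. t1.open_edge e \<times> Y2 e) ` edges T1 \<union> (\<lambda>e. Y1 e \<times> t2.open_edge e) ` edges T2"
  have sub1: "t1.open_edge e \<times> Y2 e = ?Z \<inter> t1.open_edge e \<times> points T2" if "e \<in> edges T1" for e
    using that t1.vertex_points_iff by (auto simp: common_core_def t1.open_edge_def Y2_def)
  have sub2: "Y1 e \<times> t2.open_edge e = ?Z \<inter> points T1 \<times> t2.open_edge e" if "e \<in> edges T2" for e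
    using that t2.vertex_points_iff M1_iff_M2[OF supp_simplex supp_simplex]
    by (auto simp: common_core_def t2.open_edge_def Y1_def)
  have topsp: "openin (tree_top T1) (points T1)" "openin (tree_top T2) (points T2)"
    using openin_topspace[of "tree_top T1"] openin_topspace[of "tree_top T2"]
    by (simp_all add: t1.topspace_tree_top t2.topspace_tree_top)
  have ZP: "?Z \<subseteq> points T1 \<times> points T2" by (auto simp: common_core_def)
  have open_U: "openin ?X U" if "U \<in> \<U>" for U
  proof -
    consider e where "e \<in> edges T1" "U = t1.open_edge e \<times> Y2 e" | e where "e \<in> edges T2" "U = Y1 e \<times> t2.open_edge e"
      using \<open>U \<in> \<U>\<close> by (auto simp: \<U>_def)
    then show ?thesis
    proof cases
      case 1
      have "openin ?P (t1.open_edge e \<times> points T2)"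
        using t1.openin_open_edge[OF 1(1)] topsp by (simp add: openin_prod_Times_iff)
      then show ?thesis using sub1[OF 1(1)] 1(2) by (simp add: openin_subtopology_Int2)
    next
      case 2
      have "openin ?P (points T1 \<times> t2.open_edge e)"
        using t2.openin_open_edge[OF 2(1)] topsp by (simp add: openin_prod_Times_iff)
      then show ?thesis using sub2[OF 2(1)] 2(2) by (simp add: openin_subtopology_Int2)
    qed
  qed
  have chart: "\<exists>W :: (real \<times> real) set. open W \<and> subtopology ?X U homeomorphic_space top_of_set W" if U: "U \<in> \<U>" for U
  proof -
    have UZ: "subtopology ?X U = subtopology ?P U"
      using openin_subset[OF open_U[OF U]] by (simp add: subtopology_subtopology Int_absorb1)
    consider e where "e \<in> edges T1" "U = t1.open_edge e \<times> Y2 e" | e where "e \<in> edges T2" "U = Y1 e \<times> t2.open_edge e"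
      using U by (auto simp: \<U>_def)
    then show ?thesis
    proof cases
      case 1
      have "subtopology ?X U homeomorphic_space prod_topology (top_of_set {0<..<1::real}) (top_of_set (UNIV :: real set))"
        unfolding UZ unfolding 1(2) subtopology_Times
        using homeomorphic_space_prod_topology[OF t1.open_edge_homeomorphic[OF 1(1)] Y2[OF 1(1)]] by simp
      then have "subtopology ?X U homeomorphic_space top_of_set ({0<..<1::real} \<times> (UNIV :: real set))"
        by (simp only: prod_topology_subtopology_eu)
      moreover have "open ({0<..<1::real} \<times> (UNIV :: real set))" by (intro open_Times) auto
      ultimately show ?thesis by blast
    next
      case 2
      have "subtopology ?X U homeomorphic_space prod_topology (top_of_set (UNIV :: real set)) (top_of_set {0<..<1::real})"
        unfolding UZ unfolding 2(2) subtopology_Times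
        using homeomorphic_space_prod_topology[OF Y1[OF 2(1)] t2.open_edge_homeomorphic[OF 2(1)]] by simp
      then have "subtopology ?X U homeomorphic_space top_of_set ((UNIV :: real set) \<times> {0<..<1::real})"
        by (simp only: prod_topology_subtopology_eu)
      moreover have "open ((UNIV :: real set) \<times> {0<..<1::real})" by (intro open_Times) auto
      ultimately show ?thesis by blast
    qed
  qed
  have top_X: "topspace ?X = ?Z" using ZP by (auto simp: t1.topspace_tree_top t2.topspace_tree_top)
  have cover: "\<exists>U \<in> \<U>. x \<in> U" if x: "x \<in> ?Z" for x
  proof -
    obtain x1 x2 where eq: "x = (x1, x2)" by (meson surj_pair)
    then have P: "x1 \<in> points T1" "x2 \<in> points T2" "supp x2 \<subseteq> M2 (supp x1)"
      "\<not> (x1 \<in> vertex_points T1 \<and> x2 \<in> vertex_points T2)"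
      using x by (auto simp: common_core_def)
    show ?thesis
    proof (cases "supp x1 \<in> edges T1")
      case True
      then have "t1.open_edge (supp x1) \<times> Y2 (supp x1) \<in> \<U>" by (auto simp: \<U>_def)
      moreover have "x \<in> t1.open_edge (supp x1) \<times> Y2 (supp x1)" using P by (simp add: eq t1.open_edge_def Y2_def)
      ultimately show ?thesis by (rule bexI[rotated])
    next
      case False
      then have "supp x2 \<in> edges T2" using P t1.vertex_points_iff[OF P(1)] t2.vertex_points_iff[OF P(2)] by blast
      then have "Y1 (supp x2) \<times> t2.open_edge (supp x2) \<in> \<U>" by (auto simp: \<U>_def)
      moreover have "x \<in> Y1 (supp x2) \<times> t2.open_edge (supp x2)"
        using P M1_iff_M2[OF supp_simplex[OF P(1)] supp_simplex[OF P(2)]] by (simp add: eq t2.open_edge_def Y1_def)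
      ultimately show ?thesis by (rule bexI[rotated])
    qed
  qed
  have "countable (carrier G)"
    using fg countable_generate[OF countable_finite] unfolding finitely_generated_def by metis
  then have "countable \<U>"
    using t1.countable_edges[OF minimal1] t2.countable_edges[OF minimal2] by (simp add: \<U>_def)
  moreover have "second_countable (subtopology ?X U)" if "U \<in> \<U>" for U
    using chart[OF that] homeomorphic_space_second_countability
      second_countable_subtopology[OF second_countable_euclidean] by blast
  moreover have "topspace ?X \<subseteq> \<Union>\<U>" unfolding top_X using cover by (meson Union_iff subsetI)
  ultimately have "second_countable ?X"
    using open_U by (intro second_countable_open_cover[of \<U> ?X]) blast+
  moreover have "Hausdorff_space ?X"
    using t1.Hausdorff_tree_top t2.Hausdorff_tree_top
    by (intro Hausdorff_space_subtopology) (simp add: Hausdorff_space_prod_topology)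
  moreover have "\<forall>x \<in> topspace ?X. \<exists>U (W :: (real \<times> real) set).
      openin ?X U \<and> x \<in> U \<and> open W \<and> subtopology ?X U homeomorphic_space top_of_set W"
  proof
    fix x assume "x \<in> topspace ?X"
    then obtain U where U: "U \<in> \<U>" "x \<in> U" using cover top_X by metis
    then show "\<exists>U (W :: (real \<times> real) set).
        openin ?X U \<and> x \<in> U \<and> open W \<and> subtopology ?X U homeomorphic_space top_of_set W"
      using open_U[OF U(1)] chart[OF U(1)] by blast
  qed
  ultimately show ?thesis unfolding surface_def by blast
qed

end

theorem proposition12p1:
  fixes G :: "('g, 'm) monoid_scheme"
    and T1 :: "'v sgraph" and \<phi>1 :: "'g \<Rightarrow> 'v \<Rightarrow> 'v"
    and T2 :: "'w sgraph" and \<phi>2 :: "'g \<Rightarrow> 'w \<Rightarrow> 'w"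
    and b1 :: "'v \<Rightarrow> real" and b2 :: "'w \<Rightarrow> real"
  assumes "group G" and "finitely_generated G"
    and "tree_action G T1 \<phi>1" and "minimal_action G T1 \<phi>1"
    and "tree_action G T2 \<phi>2" and "minimal_action G T2 \<phi>2"
    and base_point: "b1 \<in> points T1" "b2 \<in> points T2"
    and edge_stab1: "\<And>e. e \<in> edges T1 \<Longrightarrow> \<not> acts_trivially G T2 \<phi>2 (edge_stab G \<phi>1 e)"
    and edge_stab2: "\<And>e. e \<in> edges T2 \<Longrightarrow> \<not> acts_trivially G T1 \<phi>1 (edge_stab G \<phi>2 e)"
    and no_splitting1: "\<And>e H. \<lbrakk>e \<in> edges T1; infinite_index_subgroup G (edge_stab G \<phi>1 e) H\<rbrakk>
               \<Longrightarrow> \<not> splits_over G H"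
    and no_splitting2: "\<And>e H. \<lbrakk>e \<in> edges T2; infinite_index_subgroup G (edge_stab G \<phi>2 e) H\<rbrakk>
               \<Longrightarrow> \<not> splits_over G H"
  shows "(core G T1 \<phi>1 T2 \<phi>2 b1 b2 = asym_core1 G T1 \<phi>1 T2 \<phi>2 \<and>
          asym_core1 G T1 \<phi>1 T2 \<phi>2 = asym_core2 G T1 \<phi>1 T2 \<phi>2) \<and>
         ((\<forall>e \<in> edges T1. is_line (tree_dist T2) (points (minimal_subtree T2 \<phi>2 (edge_stab G \<phi>1 e)))) \<and>
          (\<forall>e \<in> edges T2. is_line (tree_dist T1) (points (minimal_subtree T1 \<phi>1 (edge_stab G \<phi>2 e))))
          \<longrightarrow> surface (subtopology (prod_topology (tree_top T1) (tree_top T2))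
                 (core G T1 \<phi>1 T2 \<phi>2 b1 b2 - vertex_points T1 \<times> vertex_points T2)))"
proof -
  interpret tree_pair G T1 \<phi>1 T2 \<phi>2
    using assms by (simp add: tree_pair_def tree_pair_axioms_def)
  show ?thesis
    using core_eq[OF base_point] asym_core1_eq asym_core2_eq surface_common_core[OF assms(2)] by simp
qed

end
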